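(* Let $\kappa>0$, $q:=e^{-2\kappa}$ and $\gamma_n:=\tanh(\kappa n)$, $n\in\mathbb{N}$. Consider the problem of finding $r_{m,n}(t)$, $m,n\in\mathbb{N}$, $t\ge0$, such that \[ \dot r_{m,n}(t)=-2r_{m,n}(t)+\frac{\gamma_m}{2}\bigl(r_{m+1,n}(t)+r_{m-1,n}(t)\bigr)+\frac{\gamma_n}{2}\bigl(r_{m,n+1}(t)+r_{m,n-1}(t)\bigr)\quad (m\neq n), \] with $r_{m,0}=r_{0,n}=0$, together with $r_{m,m}(t)=1$ and $r_{m,n}(t)=r_{n,m}(t)$ for all $m,n\in\mathbb{N}$, $t>0$, and with prescribed initial data $r_{m,n}(0)\in[-1,1]$ satisfying $r_{m,n}(0)=r_{n,m}(0)$ and $r_{m,m}(0)=1$. This problem has a unique solution, given by \[ r_{m,n}(t)=\rho_{m,n}+\sum_{k>\ell}r_{m,n}^{(k,\ell)}(t)\bigl(r_{k,\ell}(0)-\rho_{k,\ell}\bigr),\qquad m,n\in\mathbb{N}, \] where the sum runs over $k,\ell\in\mathbb{N}$ with $k>\ell$, $\rho$ is the stationary solution, and for $k>\ell$, $r^{(k,\ell)}_{m,n}(t)$ is the solution of the differential equations above (for $m\ne n$, with $r^{(k,\ell)}_{m,0}=r^{(k,\ell)}_{0,n}=0$), of the symmetry condition $r^{(k,\ell)}_{m,n}=r^{(k,\ell)}_{n,m}$, and of $r^{(k,\ell)}_{m,m}(t)=0$ for all $m$, with initial condition $r^{(k,\ell)}_{m,n}(0)=\delta_{m,k}\delta_{n,\ell}$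 for $m> n$. Furthermore, for $m\ge n$, \[ r_{m,n}^{(k,\ell)}(t)=\frac{3}{\pi\gamma_1^2}\,\frac{(q;q)_\infty^8}{(-q;q)_\infty^8}\sqrt{\frac{\gamma_m\gamma_n}{\gamma_k\gamma_\ell}}\,\frac{R_{k,\ell}R_{m,n}}{t^5}+O\!\left(t^{-6}\right),\qquad t\to+\infty, \] where $R_{m,n}:=P_m(0)P_n''(0)-P_m''(0)P_n(0)$.
   Context: $(a;q)_n:=\prod_{j=0}^{n-1}(1-aq^j)$ for $n\in\mathbb{N}_0\cup\{\infty\}$. For $n\in\mathbb{N}$ and $\theta\in\mathbb{R}$, \[ P_n(\theta):=\sqrt{\frac{\gamma_1}{\gamma_n}}\sum_{k=0}^{n-1}\frac{(-q;q)_k(-q;q)_{n-1-k}}{(q;q)_k(q;q)_{n-1-k}}\cos\bigl((2k-n+1)\theta\bigr), \] and $P_n''$ denotes the second derivative in $\theta$. The stationary solution $\rho=(\rho_{m,n})_{m,n\in\mathbb{N}}$ is the (unique) bounded array satisfying $-2\rho_{m,n}+\frac{\gamma_m}{2}(\rho_{m+1,n}+\rho_{m-1,n})+\frac{\gamma_n}{2}(\rho_{m,n+1}+\rho_{m,n-1})=0$ for $m\ne n$, $\rho_{m,m}=1$, and $\rho_{m,0}=\rho_{0,n}=0$. (The quantities $r_{m,n}(t)$ are two-spin correlations of a kinetic Ising chain.)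
   Formalization: Solutions r and r^{(k,ℓ)} are required to be bounded uniformly in m, n and t≥0 and continuous on t≥0 (equations for t>0); without a growth condition uniqueness fails, since nonzero solutions with zero initial data exist. *)

theory Defs
  imports "HOL-Analysis.Analysis" "HOL-Library.Landau_Symbols"
begin

definition qpoch :: "real \<Rightarrow> real \<Rightarrow> nat \<Rightarrow> real" where
  "qpoch a q n = (\<Prod>j<n. 1 - a * q ^ j)"

definition qpoch_inf :: "real \<Rightarrow> real \<Rightarrow> real" where
  "qpoch_inf a q = (\<Prod>j. 1 - a * q ^ j)"

definition qq :: "real \<Rightarrow> real" where
  "qq \<kappa> = exp (- 2 * \<kappa>)"

definition gam :: "real \<Rightarrow> nat \<Rightarrow> real" where
  "gam \<kappa> n = tanh (\<kappa> * real n)"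

definition Pn :: "real \<Rightarrow> nat \<Rightarrow> real \<Rightarrow> real" where
  "Pn \<kappa> n \<theta> = sqrt (gam \<kappa> 1 / gam \<kappa> n) *
     (\<Sum>k<n. qpoch (- qq \<kappa>) (qq \<kappa>) k * qpoch (- qq \<kappa>) (qq \<kappa>) (n - 1 - k)
           / (qpoch (qq \<kappa>) (qq \<kappa>) k * qpoch (qq \<kappa>) (qq \<kappa>) (n - 1 - k))
           * cos ((2 * real k - real n + 1) * \<theta>))"

definition Rmn :: "real \<Rightarrow> nat \<Rightarrow> nat \<Rightarrow> real" where
  "Rmn \<kappa> m n = Pn \<kappa> m 0 * deriv (deriv (Pn \<kappa> n)) 0
                 - deriv (deriv (Pn \<kappa> m)) 0 * Pn \<kappa> n 0"

definition stationary :: "real \<Rightarrow> (nat \<Rightarrow> nat \<Rightarrow> real) \<Rightarrow> bool" where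
  "stationary \<kappa> \<rho> \<longleftrightarrow>
     (\<exists>B. \<forall>m n. \<bar>\<rho> m n\<bar> \<le> B) \<and>
     (\<forall>m n. m \<ge> 1 \<and> n \<ge> 1 \<and> m \<noteq> n \<longrightarrow>
        - 2 * \<rho> m n + gam \<kappa> m / 2 * (\<rho> (m + 1) n + \<rho> (m - 1) n)
          + gam \<kappa> n / 2 * (\<rho> m (n + 1) + \<rho> m (n - 1)) = 0) \<and>
     (\<forall>m. m \<ge> 1 \<longrightarrow> \<rho> m m = 1) \<and>
     (\<forall>m. \<rho> m 0 = 0) \<and> (\<forall>n. \<rho> 0 n = 0)"

definition rho :: "real \<Rightarrow> nat \<Rightarrow> nat \<Rightarrow> real" where
  "rho \<kappa> = (THE \<rho>. stationary \<kappa> \<rho>)"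

text \<open>The evolution equations (for m \<noteq> n, t > 0), boundary conditions,
  continuity at t = 0 and boundedness (uniqueness class).\<close>
definition evolves :: "real \<Rightarrow> (nat \<Rightarrow> nat \<Rightarrow> real \<Rightarrow> real) \<Rightarrow> bool" where
  "evolves \<kappa> r \<longleftrightarrow>
     (\<exists>B. \<forall>m n t. t \<ge> 0 \<longrightarrow> \<bar>r m n t\<bar> \<le> B) \<and>
     (\<forall>m n. continuous_on {0..} (r m n)) \<and>
     (\<forall>m n t. m \<ge> 1 \<and> n \<ge> 1 \<and> m \<noteq> n \<and> t > 0 \<longrightarrow>
        (r m n has_real_derivative
           (- 2 * r m n t + gam \<kappa> m / 2 * (r (m + 1) n t + r (m - 1) n t)
            + gam \<kappa> n / 2 * (r m (n + 1) t + r m (n - 1) t))) (at t)) \<and>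
     (\<forall>m t. t \<ge> 0 \<longrightarrow> r m 0 t = 0) \<and> (\<forall>n t. t \<ge> 0 \<longrightarrow> r 0 n t = 0) \<and>
     (\<forall>m n t. t > 0 \<longrightarrow> r m n t = r n m t)"

definition is_solution :: "real \<Rightarrow> (nat \<Rightarrow> nat \<Rightarrow> real) \<Rightarrow> (nat \<Rightarrow> nat \<Rightarrow> real \<Rightarrow> real) \<Rightarrow> bool" where
  "is_solution \<kappa> r0 r \<longleftrightarrow> evolves \<kappa> r \<and>
     (\<forall>m t. m \<ge> 1 \<and> t > 0 \<longrightarrow> r m m t = 1) \<and>
     (\<forall>m n. m \<ge> 1 \<and> n \<ge> 1 \<longrightarrow> r m n 0 = r0 m n)"

definition is_fund :: "real \<Rightarrow> nat \<Rightarrow> nat \<Rightarrow> (nat \<Rightarrow> nat \<Rightarrow> real \<Rightarrow> real) \<Rightarrow> bool" where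
  "is_fund \<kappa> k l g \<longleftrightarrow> evolves \<kappa> g \<and>
     (\<forall>m t. t > 0 \<longrightarrow> g m m t = 0) \<and>
     (\<forall>m n. m \<ge> 1 \<and> n \<ge> 1 \<and> m > n \<longrightarrow>
        g m n 0 = (if m = k \<and> n = l then 1 else 0))"

end

theory Submission
  imports Defs "HOL-Computational_Algebra.Polynomial" "HOL-Probability.Distributions"
begin

text \<open>
  In the wedge \<open>m > n\<close> the fundamental solution is a free-fermion (Karlin--McGregor) determinant
  \<open>a\<^sub>m\<^sub>k a\<^sub>n\<^sub>l - a\<^sub>m\<^sub>l a\<^sub>n\<^sub>k\<close>, where \<open>a\<close> is the heat kernel of the one-dimensional
  operator \<open>(J u) m = \<gamma>\<^sub>m / 2 (u (m + 1) + u (m - 1))\<close>.  The generalised eigenvectors of \<open>J\<close> are the continuous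
  \<open>q\<close>-ultraspherical polynomials \<open>c\<^sub>m(\<theta>)\<close> with parameter \<open>-q\<close> and eigenvalue \<open>cos \<theta>\<close>.
  Their orthogonality weight \<open>w\<close> is introduced through the explicit Fourier series \<open>\<Phi>\<^sub>m\<close> of the
  products \<open>c\<^sub>m w\<close>: the \<open>\<Phi>\<^sub>m\<close> obey the three-term recurrence, and \<open>\<Phi>\<^sub>m\<close> only contains the
  frequencies \<open>m - 1, m + 1, \<dots>\<close>, so that \<open>\<integral> c\<^sub>m w = 0\<close> for \<open>m \<ge> 2\<close> by inspection.
  Comparing \<open>\<Phi>\<^sub>m = c\<^sub>m w\<close> to second order at \<open>\<theta> = 0\<close> and letting \<open>m \<rightarrow> \<infinity>\<close> gives
  \<open>w(\<theta>) = 4 \<tau>\<^sup>4 \<theta>\<^sup>2 + O(\<theta>\<^sup>4)\<close> with \<open>\<tau> = (q;q)\<^sub>\<infinity> / (-q;q)\<^sub>\<infinity>\<close>.  Hence the moments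
  of \<open>1 - cos \<theta>\<close> under \<open>exp (- t (1 - cos \<theta>)) w\<close> are asymptotically Gaussian; in the
  determinant the orders \<open>1 / t\<^sup>3\<close> and \<open>1 / t\<^sup>4\<close> cancel by antisymmetry.
\<close>

section \<open>Analytic preliminaries\<close>

text \<open>The bounds on \<open>c\<close> proved here grow exponentially in the index, so the
  determinant is not visibly a member of the bounded class in which \<open>is_fund\<close> lives.
  This is why the fundamental solution is first built as the exponential series \<open>flow\<close>
  of the bounded operator \<open>hop\<close>, and why uniqueness is proved under the growth
  \<open>K ^ (m + n)\<close>: that class contains both objects and identifies them. The series also
  gives the superposition formula for data without decay, because \<open>hop\<close> propagates by
  one site per application. The variable \<open>1 - cos \<theta>\<close> vanishes at the edge, so
  the values of \<open>P\<^sub>n\<close> and of its second derivative at 0 are, up to the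
  normalising root, the two lowest coefficients of a polynomial; the lowest surviving term is a
  product of two 2 by 2 determinants of such coefficients. The constant is 3 / pi = 3 pi * 16 / (4
  pi)^2: the Gaussian determinant \<open>\<nu> 0 * \<nu> 2 - \<nu> 1 * \<nu> 1\<close>, the square
  of the weight coefficient \<open>4 * \<tau> ^ 4\<close>, and two normalisations
  \<open>4 * pi * \<gamma> k\<close> from orthogonality.\<close>

lemma exp_sums_real: "(\<lambda>i. (x::real) ^ i / fact i) sums exp x"
  using exp_converges[of x] by (simp add: field_simps)

lemma nonneg_if_deriv_nonneg:
  fixes f :: "real \<Rightarrow> real"
  assumes "continuous_on {0..} f" "f 0 \<ge> 0" "t \<ge> 0"
    and "\<And>s. s > 0 \<Longrightarrow> \<exists>y. (f has_real_derivative y) (at s) \<and> y \<ge> 0"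
  shows "f t \<ge> 0"
proof -
  have "f 0 \<le> f t"
    by (rule DERIV_nonneg_imp_increasing_open)
       (use assms in \<open>auto intro: continuous_on_subset\<close>)
  then show ?thesis using assms by simp
qed

text \<open>Symmetry and the diagonal values are prescribed only for t > 0; continuity carries them
  to t = 0.\<close>

lemma continuous_eq_at_0:
  fixes f g :: "real \<Rightarrow> real"
  assumes "continuous_on {0..} f" "continuous_on {0..} g" "\<And>t. t > 0 \<Longrightarrow> f t = g t"
  shows "f 0 = g 0"
proof (rule tendsto_unique)
  show "(f \<longlongrightarrow> f 0) (at_right 0)"
    using assms(1) by (auto simp: continuous_on intro: tendsto_within_subset[of _ _ _ "{0..}"])
  have "(g \<longlongrightarrow> g 0) (at_right 0)"
    using assms(2) by (auto simp: continuous_on intro: tendsto_within_subset[of _ _ _ "{0..}"])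
  moreover have "eventually (\<lambda>t. g t = f t) (at_right 0)"
    using assms(3) by (simp add: eventually_at_right_less eventually_at_right[of 0 1]) (rule exI[of _ 1], simp)
  ultimately show "(f \<longlongrightarrow> g 0) (at_right 0)" using tendsto_cong by blast
qed simp

lemma cos_quadratic_bound: "\<bar>cos x - 1 + x\<^sup>2 / 2\<bar> \<le> x ^ 4 / (24 :: real)"
proof -
  obtain t where "cos x = (\<Sum>m<4. cos_coeff m * x ^ m) + (cos (t + 1/2 * real 4 * pi) / fact 4) * x ^ 4"
    using Maclaurin_cos_expansion[of x 4] by blast
  moreover have "(\<Sum>m<4. cos_coeff m * x ^ m) = 1 - x\<^sup>2 / 2"
  proof -
    have "{..<4 :: nat} = {0, 1, 2, 3}" by auto
    then show ?thesis by (simp add: cos_coeff_def)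
  qed
  ultimately have "cos x - 1 + x\<^sup>2 / 2 = cos (t + 1/2 * real 4 * pi) * (x ^ 4 / 24)"
    by (simp add: fact_numeral)
  then have "\<bar>cos x - 1 + x\<^sup>2 / 2\<bar> = \<bar>cos (t + 1/2 * real 4 * pi)\<bar> * \<bar>x ^ 4 / 24\<bar>"
    by (simp only: abs_mult)
  also have "\<bar>x ^ 4 / 24\<bar> = x ^ 4 / 24" by simp
  also have "\<bar>cos (t + 1/2 * real 4 * pi)\<bar> * (x ^ 4 / 24) \<le> 1 * (x ^ 4 / 24)"
    by (intro mult_right_mono abs_cos_le_one) simp
  finally show ?thesis by simp
qed

text \<open>The constant 1/12 is what the quartic Taylor bound leaves when
  \<open>x\<^sup>2 \<le> 10\<close>, namely 1/2 - 10/24. It supplies the Gaussian majorant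
  \<open>exp (- (t / 12) * x\<^sup>2)\<close> used on the whole interval of integration.\<close>

lemma one_minus_cos_bounds:
  fixes x :: real
  shows "1 - cos x \<ge> 0" "1 - cos x \<le> x\<^sup>2 / 2" "x\<^sup>2 / 2 - (1 - cos x) \<le> x ^ 4 / 24"
    and "\<bar>x\<bar> \<le> pi \<Longrightarrow> x\<^sup>2 / 12 \<le> 1 - cos x"
proof -
  show "1 - cos x \<ge> 0" by simp
  show "1 - cos x \<le> x\<^sup>2 / 2"
  proof -
    have "1 - cos x = 2 * (sin (x / 2))\<^sup>2" using cos_double_sin[of "x / 2"] by simp
    also have "\<dots> \<le> 2 * (x / 2)\<^sup>2"
      using abs_sin_x_le_abs_x[of "x / 2"] by (intro mult_left_mono abs_le_square_iff[THEN iffD1]) auto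
    finally show ?thesis by (simp add: power_divide)
  qed
  show d: "x\<^sup>2 / 2 - (1 - cos x) \<le> x ^ 4 / 24"
    using cos_quadratic_bound[of x] by linarith
  assume x: "\<bar>x\<bar> \<le> pi"
  have "x\<^sup>2 \<le> (3.15 :: real)\<^sup>2"
    using x pi_approx(2) by (subst abs_le_square_iff[symmetric]) auto
  then have "x\<^sup>2 \<le> 10" by (simp add: power2_eq_square)
  then have "x\<^sup>2 * x\<^sup>2 \<le> 10 * x\<^sup>2" by (intro mult_right_mono) auto
  then have "x ^ 4 \<le> 10 * x\<^sup>2" by (simp add: power4_eq_xxxx power2_eq_square mult.assoc)
  then show "x\<^sup>2 / 12 \<le> 1 - cos x" using d by linarith
qed

text \<open>Meant for \<open>y = 1 - cos x\<close> and \<open>z = x\<^sup>2 / 2\<close>: replacing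
  one factor at a time costs \<open>x ^ 4\<close> instead of \<open>x\<^sup>2\<close>.\<close>

lemma power_diff_bound:
  fixes x y z :: real
  assumes "0 \<le> y" "y \<le> z" "z \<le> x\<^sup>2" "z - y \<le> x ^ 4"
  shows "z ^ j - y ^ j \<le> real j * x ^ (2 * j + 2)"
proof (induction j)
  case (Suc j)
  have zj: "z ^ j \<le> x ^ (2 * j)"
    using power_mono[OF assms(3), of j] assms by (simp add: power_mult)
  have "z ^ Suc j - y ^ Suc j = z * (z ^ j - y ^ j) + y ^ j * (z - y)"
    by (simp add: algebra_simps)
  also have "\<dots> \<le> x\<^sup>2 * (real j * x ^ (2 * j + 2)) + x ^ (2 * j) * x ^ 4"
  proof (rule add_mono)
    have "z * (z ^ j - y ^ j) \<le> z * (real j * x ^ (2 * j + 2))"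
      using Suc assms by (intro mult_left_mono) auto
    also have "\<dots> \<le> x\<^sup>2 * (real j * x ^ (2 * j + 2))"
      using assms by (intro mult_right_mono mult_nonneg_nonneg zero_le_even_power) auto
    finally show "z * (z ^ j - y ^ j) \<le> x\<^sup>2 * (real j * x ^ (2 * j + 2))" .
    have "y ^ j \<le> x ^ (2 * j)" using power_mono[OF assms(2,1), of j] zj by simp
    then show "y ^ j * (z - y) \<le> x ^ (2 * j) * x ^ 4"
      using assms by (intro mult_mono) auto
  qed
  also have "\<dots> = real (Suc j) * x ^ (2 * Suc j + 2)"
  proof -
    have "x\<^sup>2 * x ^ (2 * j + 2) = x ^ (2 * Suc j + 2)" "x ^ (2 * j) * x ^ 4 = x ^ (2 * Suc j + 2)"
      unfolding power_add[symmetric] by (rule arg_cong[of _ _ "\<lambda>n. x ^ n"], simp)+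
    then show ?thesis by (simp only: mult.left_commute[of "x\<^sup>2"]) (simp add: algebra_simps)
  qed
  finally show ?case .
qed simp

lemma gaussian_even_moment:
  assumes "s > 0"
  shows "has_bochner_integral lborel (\<lambda>x. x ^ (2 * k) * exp (- s * x\<^sup>2))
     (sqrt (pi / s) * (fact (2 * k) / ((4 * s) ^ k * fact k)))"
proof -
  define \<sigma> where "\<sigma> = sqrt (1 / (2 * s))"
  have \<sigma>: "\<sigma>\<^sup>2 = 1 / (2 * s)" using assms by (simp add: \<sigma>_def)
  have "has_bochner_integral lborel (\<lambda>x. sqrt (pi / s) * (normal_density 0 \<sigma> x * (x - 0) ^ (2 * k)))
     (sqrt (pi / s) * (fact (2 * k) / ((2 / \<sigma>\<^sup>2) ^ k * fact k)))"
    by (intro has_bochner_integral_mult_right normal_moment_even) (use assms in \<open>simp add: \<sigma>_def\<close>)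
  moreover have "sqrt (pi / s) * (normal_density 0 \<sigma> x * (x - 0) ^ (2 * k)) = x ^ (2 * k) * exp (- s * x\<^sup>2)" for x
  proof -
    have "normal_density 0 \<sigma> x = 1 / sqrt (pi / s) * exp (- s * x\<^sup>2)"
      unfolding normal_density_def \<sigma> using assms by (simp add: field_simps)
    moreover have "sqrt (pi / s) \<noteq> 0" using assms by simp
    ultimately show ?thesis by simp
  qed
  moreover have "2 / \<sigma>\<^sup>2 = 4 * s" unfolding \<sigma> using assms by simp
  ultimately show ?thesis by (simp only:)
qed

lemma poly_eq_sum:
  fixes r :: "real poly"
  assumes "degree r \<le> N"
  shows "poly r x = (\<Sum>i\<le>N. coeff r i * x ^ i)"
  unfolding poly_altdef
  by (rule sum.mono_neutral_left) (use assms in \<open>auto simp: coeff_eq_0\<close>)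

lemma sum_first_two:
  fixes h :: "nat \<Rightarrow> real"
  assumes "N \<ge> 1" "\<And>i. i \<ge> 2 \<Longrightarrow> h i = 0"
  shows "(\<Sum>i\<le>N. h i) = h 0 + h 1"
proof -
  have "(\<Sum>i\<le>N. h i) = (\<Sum>i\<in>{0, 1}. h i)"
    by (rule sum.mono_neutral_right) (use assms in auto)
  then show ?thesis by simp
qed

lemma inverse_power_bigo:
  "m \<le> n \<Longrightarrow> (\<lambda>t :: real. 1 / t ^ n) \<in> O[at_top](\<lambda>t. 1 / t ^ m)"
proof (rule bigoI[of _ 1])
  assume "m \<le> n"
  show "\<forall>\<^sub>F t :: real in at_top. norm (1 / t ^ n) \<le> 1 * norm (1 / t ^ m)"
    using eventually_ge_at_top[of "1 :: real"]
  proof eventually_elim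
    case (elim t)
    then show ?case using power_increasing[OF \<open>m \<le> n\<close>, of t] by (simp add: frac_le)
  qed
qed

lemma cmult_inverse_power_bigo:
  "m \<le> n \<Longrightarrow> (\<lambda>t :: real. b * (1 / t ^ n)) \<in> O[at_top](\<lambda>t. 1 / t ^ m)"
  unfolding cmult_in_bigo_iff using inverse_power_bigo by blast

text \<open>The rational core of \<open>X_rec\<close>, for \<open>r = q\<close>,
  \<open>a = q ^ k\<close>, \<open>b = q ^ M\<close>, after division by the common factor
  \<open>A k / f (Suc M + k)\<close>. The factor \<open>- (r + a) / (1 - r * a)\<close> is the ratio
  of consecutive \<open>A\<close>; the quotients with denominators \<open>1 + r * r * a * b\<close>
  and \<open>1 + r * b\<close> are values of \<gamma>.\<close>

lemma X_rec_identity: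
  fixes a b r :: real
  assumes "1 - a * b \<noteq> 0" "1 - r * a * b \<noteq> 0" "1 - r * r * a * b \<noteq> 0" "1 - r * a \<noteq> 0"
    "1 + r * b \<noteq> 0" "1 + r * r * a * b \<noteq> 0"
  shows "(1 - r * b) * (1 - b * a\<^sup>2) / ((1 - a * b) * (1 - r * a * b))
     + (- (r + a) / (1 - r * a)) * ((1 - r * r * a * b) / (1 + r * r * a * b))
       * ((1 - r * b) * (1 - b * (r * a)\<^sup>2) / ((1 - r * a * b) * (1 - r * r * a * b)))
     = (1 - r * b) / (1 + r * b) * (((1 - r * r * a * b) / (1 + r * r * a * b))
       * ((1 - r * (r * b)) * (1 - r * b * a\<^sup>2) / ((1 - r * a * b) * (1 - r * r * a * b)))
     + (- (r + a) / (1 - r * a)) * ((1 - b) * (1 - r * a\<^sup>2 * b) / ((1 - a * b) * (1 - r * a * b))))"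
proof -
  define u v w x y z where "u = 1 - a * b" and "v = 1 - r * a * b" and "w = 1 - r * r * a * b"
    and "x = 1 - r * a" and "y = 1 + r * b" and "z = 1 + r * r * a * b"
  \<comment> \<open>The polynomial identity behind the claim. Named denominators remain atoms, so
    clearing them does not expand everything.\<close>
  have "(1 - r * b) * (1 - b * a\<^sup>2) * x * y * z - (r + a) * u * y * (1 - r * b) * (1 - b * (r * a)\<^sup>2)
    = (1 - r * b) * (u * x * (1 - r * (r * b)) * (1 - r * b * a\<^sup>2) - (r + a) * z * (1 - b) * (1 - r * a\<^sup>2 * b))"
    unfolding u_def x_def y_def z_def by algebra
  moreover have "u \<noteq> 0" "v \<noteq> 0" "w \<noteq> 0" "x \<noteq> 0" "y \<noteq> 0" "z \<noteq> 0"
    using assms by (simp_all add: u_def v_def w_def x_def y_def z_def)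
  ultimately show ?thesis
    unfolding u_def[symmetric] v_def[symmetric] w_def[symmetric] x_def[symmetric] y_def[symmetric] z_def[symmetric]
    by (simp add: divide_simps) algebra
qed

section \<open>The chain and its hopping operator\<close>

locale ising_chain =
  fixes \<kappa> :: real
  assumes kappa_pos: "\<kappa> > 0"
begin

abbreviation \<gamma> :: "nat \<Rightarrow> real" where "\<gamma> \<equiv> gam \<kappa>"
abbreviation q :: real where "q \<equiv> qq \<kappa>"

lemma gam_0 [simp]: "\<gamma> 0 = 0"
  by (simp add: gam_def)

lemma gam_pos: "n \<ge> 1 \<Longrightarrow> \<gamma> n > 0"
  using kappa_pos by (simp add: gam_def)

lemma gam_nonneg: "\<gamma> n \<ge> 0"
  using kappa_pos by (simp add: gam_def)

lemma gam_less_1: "\<gamma> n < 1"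
  by (simp add: gam_def tanh_real_lt_1)

lemma gam_ge_gam_1: "n \<ge> 1 \<Longrightarrow> \<gamma> n \<ge> \<gamma> 1"
  using kappa_pos by (simp add: gam_def)

section \<open>The evolution semigroup\<close>

text \<open>The value 0 on the axes and the diagonal lets data that vanish there stay 0 under all
  powers, so the homogeneous boundary conditions are built into the operator.\<close>

definition hop :: "(nat \<Rightarrow> nat \<Rightarrow> real) \<Rightarrow> nat \<Rightarrow> nat \<Rightarrow> real" where
  "hop u m n = (if m = 0 \<or> n = 0 \<or> m = n then 0
     else \<gamma> m / 2 * (u (m + 1) n + u (m - 1) n) + \<gamma> n / 2 * (u m (n + 1) + u m (n - 1)))"

text \<open>In the sup norm with weight \<open>K ^ (m + n)\<close> each of the four neighbours costs
  at most a factor \<open>K\<close>, with coefficient below 1/2. For \<open>K = 1\<close> the norm 2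
  is exactly what the damping term -2 compensates.\<close>

lemma hop_bound:
  assumes "\<And>m n. \<bar>u m n\<bar> \<le> B * K ^ (m + n)" "K \<ge> 1"
  shows "\<bar>hop u m n\<bar> \<le> 2 * K * (B * K ^ (m + n))"
proof -
  have B: "B \<ge> 0" using assms(1)[of 0 0] by simp
  let ?M = "B * K ^ (m + n)"
  have M: "?M \<ge> 0" using B assms(2) by simp
  show ?thesis
  proof (cases "m = 0 \<or> n = 0 \<or> m = n")
    case True
    then show ?thesis using M assms(2) by (auto simp: hop_def)
  next
    case False
    have up: "B * K ^ Suc (m + n) = K * ?M" by simp
    have down: "B * K ^ (m + n - 1) \<le> K * ?M"
    proof -
      have "K ^ (m + n - 1) \<le> K ^ Suc (m + n)"
        by (rule power_increasing) (use assms in auto)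
      then show ?thesis using B by (metis up mult_left_mono)
    qed
    have 1: "\<bar>u (m + 1) n\<bar> \<le> K * ?M" "\<bar>u m (n + 1)\<bar> \<le> K * ?M"
      using assms(1)[of "m + 1" n] assms(1)[of m "n + 1"] by (auto simp: mult_ac)
    have 2: "\<bar>u (m - 1) n\<bar> \<le> K * ?M" "\<bar>u m (n - 1)\<bar> \<le> K * ?M"
      using assms(1)[of "m - 1" n] assms(1)[of m "n - 1"] down False by (auto simp: algebra_simps)
    have 3: "\<bar>\<gamma> j / 2 * (x + y)\<bar> \<le> K * ?M" if "\<bar>x\<bar> \<le> K * ?M" "\<bar>y\<bar> \<le> K * ?M" for j x y
    proof -
      have "\<bar>\<gamma> j / 2 * (x + y)\<bar> = \<gamma> j / 2 * \<bar>x + y\<bar>"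
        using gam_nonneg[of j] by (simp add: abs_mult)
      also have "\<dots> \<le> 1 / 2 * (2 * (K * ?M))"
        using gam_nonneg[of j] gam_less_1[of j] that by (intro mult_mono) auto
      finally show ?thesis by simp
    qed
    show ?thesis using 3[OF 1(1) 2(1), of m] 3[OF 1(2) 2(2), of n] False
      unfolding hop_def by (auto simp: algebra_simps)
  qed
qed

lemma hop_bound_1:
  assumes "\<And>m n. \<bar>u m n\<bar> \<le> B"
  shows "\<bar>hop u m n\<bar> \<le> 2 * B"
  using hop_bound[of u B 1 m n] assms by simp

lemma hop_sum:
  assumes "finite F"
  shows "hop (\<lambda>m n. \<Sum>x\<in>F. a x * u x m n) m n = (\<Sum>x\<in>F. a x * hop (u x) m n)"
  using assms
  by (induction rule: finite_induct) (auto simp: hop_def algebra_simps)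

lemma hop_diff: "hop (\<lambda>m n. u m n - v m n) m n = hop u m n - hop v m n"
  by (auto simp: hop_def algebra_simps)

lemma hop_sym: "(\<And>m n. u m n = u n m) \<Longrightarrow> hop u m n = hop u n m"
  by (auto simp: hop_def)

lemma hop_funpow_bound:
  assumes "\<And>m n. \<bar>u m n\<bar> \<le> B"
  shows "\<bar>(hop ^^ i) u m n\<bar> \<le> 2 ^ i * B"
proof (induction i arbitrary: m n)
  case (Suc i)
  then show ?case using hop_bound_1[of "(hop ^^ i) u" "2 ^ i * B"] by (simp add: algebra_simps)
qed (use assms in simp)

lemma hop_funpow_sum:
  assumes "finite F"
  shows "(hop ^^ i) (\<lambda>m n. \<Sum>x\<in>F. a x * u x m n) m n = (\<Sum>x\<in>F. a x * (hop ^^ i) (u x) m n)"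
proof (induction i arbitrary: m n)
  case (Suc i)
  then have "(hop ^^ i) (\<lambda>m n. \<Sum>x\<in>F. a x * u x m n) = (\<lambda>m n. \<Sum>x\<in>F. a x * (hop ^^ i) (u x) m n)"
    by blast
  then show ?case using hop_sum[OF assms] by simp
qed simp

lemma hop_funpow_diff: "(hop ^^ i) (\<lambda>m n. u m n - v m n) m n = (hop ^^ i) u m n - (hop ^^ i) v m n"
proof (induction i arbitrary: m n)
  case (Suc i)
  then have "(hop ^^ i) (\<lambda>m n. u m n - v m n) = (\<lambda>m n. (hop ^^ i) u m n - (hop ^^ i) v m n)"
    by blast
  then show ?case using hop_diff by simp
qed simp

lemma hop_funpow_sym: "(\<And>m n. u m n = u n m) \<Longrightarrow> (hop ^^ i) u m n = (hop ^^ i) u n m"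
  by (induction i arbitrary: m n) (auto intro: hop_sym)

text \<open>Finite propagation: one application reads only nearest neighbours.\<close>

lemma hop_funpow_local:
  assumes "\<And>k l. k \<le> m + i \<Longrightarrow> l \<le> n + i \<Longrightarrow> u k l = 0"
  shows "(hop ^^ i) u m n = 0"
  using assms
proof (induction i arbitrary: m n)
  case (Suc i)
  show ?case
    using Suc.IH[of "m + 1" n] Suc.IH[of "m - 1" n] Suc.IH[of m "n + 1"] Suc.IH[of m "n - 1"] Suc.prems
    by (simp add: hop_def)
qed simp

section \<open>The semigroup \<open>exp (t (hop - 2))\<close> as a power series\<close>

definition flow :: "(nat \<Rightarrow> nat \<Rightarrow> real) \<Rightarrow> nat \<Rightarrow> nat \<Rightarrow> real \<Rightarrow> real" where
  "flow u m n t = exp (- 2 * t) * (\<Sum>i. (hop ^^ i) u m n / fact i * t ^ i)"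

lemma flow_norm_summable:
  assumes "\<And>m n. \<bar>u m n\<bar> \<le> B"
  shows "summable (\<lambda>i. \<bar>(hop ^^ i) u m n / fact i * t ^ i\<bar>)"
proof (rule summable_comparison_test')
  show "summable (\<lambda>i. B * ((2 * \<bar>t\<bar>) ^ i / fact i))"
    using exp_sums_real sums_summable summable_mult by blast
  fix i
  have "\<bar>(hop ^^ i) u m n\<bar> * (\<bar>t\<bar> ^ i / fact i) \<le> 2 ^ i * B * (\<bar>t\<bar> ^ i / fact i)"
    using hop_funpow_bound[of u B i m n, OF assms] by (intro mult_right_mono) auto
  then show "norm \<bar>(hop ^^ i) u m n / fact i * t ^ i\<bar> \<le> B * ((2 * \<bar>t\<bar>) ^ i / fact i)"
    by (simp add: abs_mult power_abs power_mult_distrib field_simps)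
qed

lemma flow_summable:
  assumes "\<And>m n. \<bar>u m n\<bar> \<le> B"
  shows "summable (\<lambda>i. (hop ^^ i) u m n / fact i * t ^ i)"
  using summable_rabs_cancel[OF flow_norm_summable[of u B, OF assms]] .

lemma flow_0: "flow u m n 0 = u m n"
proof -
  have "(\<lambda>i. (hop ^^ i) u m n / fact i * 0 ^ i) sums ((hop ^^ 0) u m n / fact 0)"
    using powser_sums_zero[of "\<lambda>i. (hop ^^ i) u m n / fact i"] by simp
  then show ?thesis by (simp add: flow_def sums_iff)
qed

text \<open>By finite propagation the first \<open>N\<close> terms vanish when the data vanish near
  \<open>(m, n)\<close>; what remains is a tail of the series of \<open>exp (2 * t)\<close>.\<close>

lemma flow_tail_bound:
  assumes B: "\<And>m n. \<bar>u m n\<bar> \<le> B" and "t \<ge> 0"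
    and zero: "\<And>k l. k < m + N \<Longrightarrow> l < n + N \<Longrightarrow> u k l = 0"
  shows "\<bar>flow u m n t\<bar> \<le> B * (\<Sum>i. (2 * t) ^ (i + N) / fact (i + N))"
proof -
  let ?f = "\<lambda>i. (hop ^^ i) u m n / fact i * t ^ i"
  have z: "?f i = 0" if "i < N" for i
    using hop_funpow_local[of m i n u] zero that by simp
  have "(\<Sum>i. ?f i) = (\<Sum>i. ?f (i + N)) + (\<Sum>i<N. ?f i)"
    by (rule suminf_split_initial_segment[OF flow_summable[of u B, OF B]])
  also have "(\<Sum>i<N. ?f i) = 0" by (intro sum.neutral) (use z in blast)
  finally have eq: "(\<Sum>i. ?f i) = (\<Sum>i. ?f (i + N))" by simp
  have le: "\<bar>?f i\<bar> \<le> B * ((2 * t) ^ i / fact i)" for i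
  proof -
    have "\<bar>(hop ^^ i) u m n\<bar> * (t ^ i / fact i) \<le> 2 ^ i * B * (t ^ i / fact i)"
      using hop_funpow_bound[of u B i m n, OF B] \<open>t \<ge> 0\<close> by (intro mult_right_mono) auto
    then show ?thesis using \<open>t \<ge> 0\<close>
      by (simp add: abs_mult power_abs power_mult_distrib field_simps)
  qed
  have s1: "summable (\<lambda>i. (2 * t) ^ (i + N) / fact (i + N))"
    using summable_ignore_initial_segment[OF sums_summable[OF exp_sums_real[of "2 * t"]], of N] .
  have s2: "summable (\<lambda>i. \<bar>?f (i + N)\<bar>)"
    using summable_ignore_initial_segment[OF flow_norm_summable[of u B m n t, OF B], of N] .
  have "\<bar>\<Sum>i. ?f (i + N)\<bar> \<le> (\<Sum>i. \<bar>?f (i + N)\<bar>)"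
    by (rule summable_rabs[OF s2])
  also have "\<dots> \<le> (\<Sum>i. B * ((2 * t) ^ (i + N) / fact (i + N)))"
    by (rule suminf_le[OF le s2 summable_mult[OF s1]])
  also have "\<dots> = B * (\<Sum>i. (2 * t) ^ (i + N) / fact (i + N))"
    by (rule suminf_mult[OF s1])
  finally have "\<bar>\<Sum>i. ?f i\<bar> \<le> B * (\<Sum>i. (2 * t) ^ (i + N) / fact (i + N))"
    using eq by simp
  moreover have "\<bar>flow u m n t\<bar> \<le> \<bar>\<Sum>i. ?f i\<bar>"
    unfolding flow_def abs_mult using \<open>t \<ge> 0\<close> by (intro mult_left_le_one_le) auto
  ultimately show ?thesis by linarith
qed

text \<open>The norm 2 of \<open>hop\<close> lets the series grow at most like
  \<open>exp (2 * t)\<close>, which the prefactor cancels.\<close>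

lemma flow_bound:
  assumes B: "\<And>m n. \<bar>u m n\<bar> \<le> B" and "t \<ge> 0"
  shows "\<bar>flow u m n t\<bar> \<le> B"
proof -
  let ?f = "\<lambda>i. (hop ^^ i) u m n / fact i * t ^ i"
  have le: "\<bar>?f i\<bar> \<le> B * ((2 * t) ^ i / fact i)" for i
  proof -
    have "\<bar>(hop ^^ i) u m n\<bar> * (t ^ i / fact i) \<le> 2 ^ i * B * (t ^ i / fact i)"
      using hop_funpow_bound[of u B i m n, OF B] \<open>t \<ge> 0\<close> by (intro mult_right_mono) auto
    then show ?thesis using \<open>t \<ge> 0\<close>
      by (simp add: abs_mult power_abs power_mult_distrib field_simps)
  qed
  have s: "(\<lambda>i. B * ((2 * t) ^ i / fact i)) sums (B * exp (2 * t))"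
    by (rule sums_mult[OF exp_sums_real])
  have "\<bar>\<Sum>i. ?f i\<bar> \<le> (\<Sum>i. \<bar>?f i\<bar>)"
    by (rule summable_rabs[OF flow_norm_summable[of u B, OF B]])
  also have "\<dots> \<le> (\<Sum>i. B * ((2 * t) ^ i / fact i))"
    by (rule suminf_le[OF le flow_norm_summable[of u B, OF B] sums_summable[OF s]])
  also have "\<dots> = B * exp (2 * t)" using s by (rule sums_unique[symmetric])
  finally have "\<bar>flow u m n t\<bar> \<le> exp (- 2 * t) * (B * exp (2 * t))"
    unfolding flow_def abs_mult by simp
  also have "\<dots> = B" by (simp add: exp_minus field_simps)
  finally show ?thesis .
qed

text \<open>Termwise differentiation shifts the powers of \<open>hop\<close> by one, and
  \<open>hop\<close> commutes with the series because it is a finite combination of entries.\<close>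

lemma flow_deriv:
  assumes B: "\<And>m n. \<bar>u m n\<bar> \<le> B"
  shows "(flow u m n has_real_derivative
     - 2 * flow u m n t + hop (\<lambda>m n. flow u m n t) m n) (at t)"
proof -
  let ?c = "\<lambda>m n i. (hop ^^ i) u m n / fact i"
  define S where "S = (\<lambda>m n. \<Sum>i. ?c m n i * t ^ i)"
  have d: "((\<lambda>x. \<Sum>i. ?c m n i * x ^ i) has_real_derivative (\<Sum>i. diffs (?c m n) i * t ^ i)) (at t)"
    by (rule termdiffs_strong_converges_everywhere) (rule flow_summable[of u B, OF B])
  have diffs: "diffs (?c m n) i = (hop ^^ Suc i) u m n / fact i" for i
  proof -
    have "real (Suc i) / fact (Suc i) = 1 / (fact i :: real)"
      unfolding fact_Suc by (simp del: of_nat_Suc)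
    then show ?thesis unfolding diffs_def by (simp del: of_nat_Suc fact_Suc add: field_simps)
  qed
  have sm: "summable (\<lambda>i. ?c m n i * t ^ i)" for m n by (rule flow_summable[of u B, OF B])
  have comm: "(\<Sum>i. diffs (?c m n) i * t ^ i) = hop S m n"
  proof (cases "m = 0 \<or> n = 0 \<or> m = n")
    case True
    then show ?thesis by (auto simp: diffs hop_def)
  next
    case False
    have Ssums: "(\<lambda>i. ?c m n i * t ^ i) sums S m n" for m n
      unfolding S_def by (rule summable_sums[OF sm])
    have hopS: "hop S m n = \<gamma> m / 2 * (S (m + 1) n + S (m - 1) n) + \<gamma> n / 2 * (S m (n + 1) + S m (n - 1))"
      using False by (simp add: hop_def)
    have "(\<lambda>i. \<gamma> m / 2 * (?c (m + 1) n i * t ^ i + ?c (m - 1) n i * t ^ i)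
        + \<gamma> n / 2 * (?c m (n + 1) i * t ^ i + ?c m (n - 1) i * t ^ i)) sums hop S m n"
      unfolding hopS by (intro sums_add sums_mult Ssums)
    moreover have "diffs (?c m n) i * t ^ i = \<gamma> m / 2 * (?c (m + 1) n i * t ^ i + ?c (m - 1) n i * t ^ i)
        + \<gamma> n / 2 * (?c m (n + 1) i * t ^ i + ?c m (n - 1) i * t ^ i)" for i
      unfolding diffs using False by (simp add: hop_def field_simps)
    ultimately show ?thesis by (simp add: sums_iff)
  qed
  have fl: "flow u m n t = exp (- 2 * t) * S m n" for m n by (simp add: flow_def S_def)
  have "flow u m n = (\<lambda>t. exp (- 2 * t) * (\<Sum>i. ?c m n i * t ^ i))"
    by (simp add: flow_def fun_eq_iff)
  moreover have "((\<lambda>t. exp (- 2 * t) * (\<Sum>i. ?c m n i * t ^ i)) has_real_derivative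
     - 2 * (exp (- 2 * t) * S m n) + exp (- 2 * t) * hop S m n) (at t)"
    by (rule derivative_eq_intros d refl | simp)+ (simp only: comm, simp add: S_def mult_ac)
  moreover have "exp (- 2 * t) * hop S m n = hop (\<lambda>m n. flow u m n t) m n"
    by (auto simp: hop_def fl algebra_simps)
  ultimately show ?thesis using fl[of m n] by metis
qed

lemma flow_sym: "(\<And>m n. u m n = u n m) \<Longrightarrow> flow u m n t = flow u n m t"
  unfolding flow_def using hop_funpow_sym[of u _ m n] by presburger

lemma flow_boundary:
  assumes "m = 0 \<or> n = 0 \<or> m = n" "u m n = 0"
  shows "flow u m n t = 0"
proof -
  have "(hop ^^ i) u m n = 0" for i
    using assms by (cases i) (auto simp: hop_def)
  then show ?thesis by (simp add: flow_def)
qed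

lemma flow_sum:
  assumes "finite F" and "\<And>x m n. x \<in> F \<Longrightarrow> \<bar>u x m n\<bar> \<le> B"
  shows "flow (\<lambda>m n. \<Sum>x\<in>F. a x * u x m n) m n t = (\<Sum>x\<in>F. a x * flow (u x) m n t)"
proof -
  have "(\<Sum>i. (hop ^^ i) (\<lambda>m n. \<Sum>x\<in>F. a x * u x m n) m n / fact i * t ^ i)
      = (\<Sum>i. \<Sum>x\<in>F. a x * ((hop ^^ i) (u x) m n / fact i * t ^ i))"
    unfolding hop_funpow_sum[OF assms(1)]
    by (simp add: sum_divide_distrib sum_distrib_right mult.assoc)
  also have "\<dots> = (\<Sum>x\<in>F. \<Sum>i. a x * ((hop ^^ i) (u x) m n / fact i * t ^ i))"
    by (rule suminf_sum) (intro summable_mult flow_summable[where B = B], use assms in auto)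
  also have "\<dots> = (\<Sum>x\<in>F. a x * (\<Sum>i. (hop ^^ i) (u x) m n / fact i * t ^ i))"
    by (intro sum.cong refl suminf_mult flow_summable[where B = B]) (use assms in auto)
  finally show ?thesis
    unfolding flow_def by (simp add: sum_distrib_left mult_ac)
qed

lemma flow_diff:
  assumes "\<And>m n. \<bar>u m n\<bar> \<le> B" "\<And>m n. \<bar>v m n\<bar> \<le> C"
  shows "flow (\<lambda>m n. u m n - v m n) m n t = flow u m n t - flow v m n t"
proof -
  have "(\<Sum>i. (hop ^^ i) (\<lambda>m n. u m n - v m n) m n / fact i * t ^ i)
      = (\<Sum>i. (hop ^^ i) u m n / fact i * t ^ i - (hop ^^ i) v m n / fact i * t ^ i)"
    unfolding hop_funpow_diff by (simp add: algebra_simps diff_divide_distrib)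
  also have "\<dots> = (\<Sum>i. (hop ^^ i) u m n / fact i * t ^ i) - (\<Sum>i. (hop ^^ i) v m n / fact i * t ^ i)"
    by (rule suminf_diff[symmetric]) (rule flow_summable[of u B, OF assms(1)], rule flow_summable[of v C, OF assms(2)])
  finally show ?thesis unfolding flow_def by (simp only: right_diff_distrib)
qed

text \<open>Each integration of the equation gains a factor \<open>t / (i + 1)\<close>, and the exponential weight
  is mapped by the hopping operator to at most a constant multiple of itself.\<close>

lemma hop_flow_unique:
  fixes u :: "nat \<Rightarrow> nat \<Rightarrow> real \<Rightarrow> real"
  assumes K: "K \<ge> 1" and bd: "\<And>m n t. t \<ge> 0 \<Longrightarrow> \<bar>u m n t\<bar> \<le> B * K ^ (m + n)"
    and cont: "\<And>m n. continuous_on {0..} (u m n)"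
    and der: "\<And>m n t. m \<ge> 1 \<Longrightarrow> n \<ge> 1 \<Longrightarrow> m \<noteq> n \<Longrightarrow> t > 0 \<Longrightarrow>
       (u m n has_real_derivative (- 2 * u m n t + hop (\<lambda>m n. u m n t) m n)) (at t)"
    and bdry: "\<And>m n t. m = 0 \<or> n = 0 \<or> m = n \<Longrightarrow> t \<ge> 0 \<Longrightarrow> u m n t = 0"
    and init: "\<And>m n. u m n 0 = 0"
    and t: "t \<ge> 0"
  shows "u m n t = 0"
proof -
  \<comment> \<open>A bound for the norm of \<open>hop - 2\<close> under the weight
    \<open>K ^ (m + n)\<close>.\<close>
  define c where "c = 2 + 2 * K"
  have c: "c > 0" using K by (simp add: c_def)
  have B: "B \<ge> 0" using bd[of 0 0 0] by simp
  have main: "\<bar>u m n t\<bar> \<le> B * K ^ (m + n) * ((c * t) ^ i / fact i)" if "t \<ge> 0" for m n t i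
    using that
  proof (induction i arbitrary: m n t)
    case 0
    then show ?case using bd by simp
  next
    case (Suc i)
    show ?case
    proof (cases "m = 0 \<or> n = 0 \<or> m = n")
      case True
      then show ?thesis using bdry[OF True Suc.prems] B K c Suc.prems by simp
    next
      case False
      let ?W = "B * K ^ (m + n)"
      \<comment> \<open>\<open>g\<close> integrates the bound on the derivative given by the
        previous stage and vanishes at 0, so \<open>g - u\<close> and \<open>g + u\<close> start at
        0 and do not decrease.\<close>
      define g where "g = (\<lambda>t. ?W * ((c * t) ^ Suc i / fact (Suc i)))"
      have gd: "(g has_real_derivative c * (?W * ((c * s) ^ i / fact i))) (at s)" for s
      proof -
        have "((\<lambda>t. ?W * c ^ Suc i / fact (Suc i) * t ^ Suc i) has_real_derivative
              ?W * c ^ Suc i / fact (Suc i) * (real (Suc i) * s ^ i)) (at s)"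
          by (rule derivative_eq_intros refl | simp)+
        moreover have "g = (\<lambda>t. ?W * c ^ Suc i / fact (Suc i) * t ^ Suc i)"
          by (simp add: g_def power_mult_distrib mult_ac)
        moreover have "?W * c ^ Suc i / fact (Suc i) * (real (Suc i) * s ^ i)
            = c * (?W * ((c * s) ^ i / fact i))"
        proof -
          have "real (Suc i) / fact (Suc i) = 1 / (fact i :: real)"
            unfolding fact_Suc by (simp del: of_nat_Suc)
          then show ?thesis
            by (simp del: of_nat_Suc fact_Suc add: power_mult_distrib field_simps)
        qed
        ultimately show ?thesis by (simp only:)
      qed
      have gc: "continuous_on {0..} g"
        unfolding g_def by (intro continuous_intros) auto
      have db: "\<bar>- 2 * u m n s + hop (\<lambda>m n. u m n s) m n\<bar> \<le> c * (?W * ((c * s) ^ i / fact i))"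
        if "s > 0" for s
      proof -
        have IH: "\<bar>u m n s\<bar> \<le> B * ((c * s) ^ i / fact i) * K ^ (m + n)" for m n
          using Suc.IH[of s m n] that by (simp add: mult_ac)
        have "\<bar>hop (\<lambda>m n. u m n s) m n\<bar> \<le> 2 * K * (B * ((c * s) ^ i / fact i) * K ^ (m + n))"
          by (rule hop_bound[OF IH K])
        then have "\<bar>- 2 * u m n s + hop (\<lambda>m n. u m n s) m n\<bar>
            \<le> 2 * (B * ((c * s) ^ i / fact i) * K ^ (m + n))
              + 2 * K * (B * ((c * s) ^ i / fact i) * K ^ (m + n))"
          using IH[of m n] by linarith
        also have "\<dots> = c * (?W * ((c * s) ^ i / fact i))"
          by (simp add: c_def algebra_simps add_divide_distrib)
        finally show ?thesis .
      qed
      have "g t - u m n t \<ge> 0"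
      proof (rule nonneg_if_deriv_nonneg[where f = "\<lambda>t. g t - u m n t"])
        show "continuous_on {0..} (\<lambda>t. g t - u m n t)"
          using gc cont by (intro continuous_intros) auto
        show "0 \<le> g 0 - u m n 0" using init by (simp add: g_def)
        fix s :: real assume "s > 0"
        then show "\<exists>y. ((\<lambda>t. g t - u m n t) has_real_derivative y) (at s) \<and> 0 \<le> y"
          using DERIV_diff[OF gd der[of m n s]] False db[of s]
          by (intro exI conjI) (assumption | auto)+
      qed (use Suc.prems in simp)
      moreover have "g t + u m n t \<ge> 0"
      proof (rule nonneg_if_deriv_nonneg[where f = "\<lambda>t. g t + u m n t"])
        show "continuous_on {0..} (\<lambda>t. g t + u m n t)"
          using gc cont by (intro continuous_intros) auto
        show "0 \<le> g 0 + u m n 0" using init by (simp add: g_def)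
        fix s :: real assume "s > 0"
        then show "\<exists>y. ((\<lambda>t. g t + u m n t) has_real_derivative y) (at s) \<and> 0 \<le> y"
          using DERIV_add[OF gd der[of m n s]] False db[of s]
          by (intro exI conjI) (assumption | auto)+
      qed (use Suc.prems in simp)
      ultimately show ?thesis unfolding g_def by linarith
    qed
  qed
  have "(\<lambda>i. (c * t) ^ i / fact i) \<longlonglongrightarrow> 0"
    using summable_LIMSEQ_zero[OF sums_summable[OF exp_sums_real]] .
  then have "(\<lambda>i. B * K ^ (m + n) * ((c * t) ^ i / fact i)) \<longlonglongrightarrow> B * K ^ (m + n) * 0"
    by (intro tendsto_mult_left)
  then have "\<bar>u m n t\<bar> \<le> B * K ^ (m + n) * 0"
    by (rule LIMSEQ_le_const) (use main[OF t] in auto)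
  then show ?thesis by simp
qed

section \<open>The stationary solution\<close>

lemma hop_mono: "(\<And>m n. u m n \<le> v m n) \<Longrightarrow> hop u m n \<le> hop v m n"
  unfolding hop_def using gam_nonneg by (auto intro!: add_mono mult_left_mono)

text \<open>Fixed point iteration for \<open>\<rho> = hop \<rho> / 2\<close> with diagonal value 1.
  Started at 0, it increases because \<open>hop\<close> is monotone, and it stays below 1 because
  \<open>hop\<close> has norm 2.\<close>

fun rho_iter :: "nat \<Rightarrow> nat \<Rightarrow> nat \<Rightarrow> real" where
  "rho_iter 0 m n = 0"
| "rho_iter (Suc i) m n = (if m = 0 \<or> n = 0 then 0 else if m = n then 1 else hop (rho_iter i) m n / 2)"

lemma rho_iter_nonneg: "rho_iter i m n \<ge> 0"
proof (induction i arbitrary: m n)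
  case (Suc i)
  have "hop (\<lambda>m n. 0) m n \<le> hop (rho_iter i) m n" by (rule hop_mono) (rule Suc)
  moreover have "hop (\<lambda>m n. 0) m n = 0" by (simp add: hop_def)
  ultimately show ?case by simp
qed simp

lemma rho_iter_le_1: "rho_iter i m n \<le> 1"
proof (induction i arbitrary: m n)
  case (Suc i)
  have "\<bar>hop (rho_iter i) m n\<bar> \<le> 2 * 1"
    by (rule hop_bound_1) (use Suc rho_iter_nonneg[of i] in \<open>simp add: abs_of_nonneg\<close>)
  then have "hop (rho_iter i) m n \<le> 2" by linarith
  then show ?case by simp
qed simp

lemma rho_iter_mono: "rho_iter i m n \<le> rho_iter (Suc i) m n"
proof (induction i arbitrary: m n)
  case 0
  show ?case using rho_iter_nonneg[of "Suc 0" m n] by (simp only: rho_iter.simps(1))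
next
  case (Suc i)
  have "hop (rho_iter i) m n \<le> hop (rho_iter (Suc i)) m n" by (rule hop_mono) (rule Suc)
  then show ?case by (simp del: rho_iter.simps add: rho_iter.simps(2)[of "Suc i"] rho_iter.simps(2)[of i])
qed

definition rho_lim :: "nat \<Rightarrow> nat \<Rightarrow> real" where
  "rho_lim m n = lim (\<lambda>i. rho_iter i m n)"

lemma rho_iter_tendsto: "(\<lambda>i. rho_iter i m n) \<longlonglongrightarrow> rho_lim m n"
proof -
  have "convergent (\<lambda>i. rho_iter i m n)"
  proof (rule Bseq_mono_convergent)
    show "Bseq (\<lambda>i. rho_iter i m n)"
      by (rule BseqI'[of _ 1]) (use rho_iter_le_1 rho_iter_nonneg in simp)
    show "\<forall>i j. i \<le> j \<longrightarrow> rho_iter i m n \<le> rho_iter j m n"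
      using lift_Suc_mono_le[of "\<lambda>i. rho_iter i m n"] rho_iter_mono by blast
  qed
  then show ?thesis by (simp add: rho_lim_def convergent_LIMSEQ_iff)
qed

lemma stationary_iff:
  "stationary \<kappa> \<rho> \<longleftrightarrow> (\<exists>B. \<forall>m n. \<bar>\<rho> m n\<bar> \<le> B) \<and>
     (\<forall>m n. m \<ge> 1 \<and> n \<ge> 1 \<and> m \<noteq> n \<longrightarrow> hop \<rho> m n = 2 * \<rho> m n) \<and>
     (\<forall>m. m \<ge> 1 \<longrightarrow> \<rho> m m = 1) \<and> (\<forall>m. \<rho> m 0 = 0) \<and> (\<forall>n. \<rho> 0 n = 0)"
proof -
  have "(- 2 * \<rho> m n + \<gamma> m / 2 * (\<rho> (m + 1) n + \<rho> (m - 1) n)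
          + \<gamma> n / 2 * (\<rho> m (n + 1) + \<rho> m (n - 1)) = 0) \<longleftrightarrow> hop \<rho> m n = 2 * \<rho> m n"
    if "m \<ge> 1 \<and> n \<ge> 1 \<and> m \<noteq> n" for m n
    using that by (auto simp: hop_def)
  then show ?thesis unfolding stationary_def by (simp cong: conj_cong)
qed

lemma stationary_rho_lim: "stationary \<kappa> rho_lim"
  unfolding stationary_iff
proof (intro conjI allI impI exI[of _ 1])
  fix m n
  have "(\<lambda>i. \<bar>rho_iter i m n\<bar>) \<longlonglongrightarrow> \<bar>rho_lim m n\<bar>"
    by (intro tendsto_intros rho_iter_tendsto)
  then show "\<bar>rho_lim m n\<bar> \<le> 1"
    by (rule LIMSEQ_le_const2) (use rho_iter_nonneg rho_iter_le_1 in auto)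
next
  fix m n :: nat assume mn: "m \<ge> 1 \<and> n \<ge> 1 \<and> m \<noteq> n"
  have eq: "rho_iter (Suc i) m n = hop (rho_iter i) m n / 2" for i using mn by auto
  have "(\<lambda>i. rho_iter (Suc i) m n) \<longlonglongrightarrow> rho_lim m n"
    by (rule LIMSEQ_Suc[OF rho_iter_tendsto])
  moreover have "(\<lambda>i. hop (rho_iter i) m n / 2) \<longlonglongrightarrow> hop rho_lim m n / 2"
    using mn unfolding hop_def by (auto intro!: tendsto_intros rho_iter_tendsto)
  ultimately have "rho_lim m n = hop rho_lim m n / 2"
    unfolding eq by (rule LIMSEQ_unique)
  then show "hop rho_lim m n = 2 * rho_lim m n" by simp
next
  fix m :: nat assume "m \<ge> 1"
  then have "(\<lambda>i. rho_iter (Suc i) m m) = (\<lambda>_. 1)" by auto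
  then show "rho_lim m m = 1"
    using LIMSEQ_Suc[OF rho_iter_tendsto[of m m]] by (simp add: LIMSEQ_const_iff)
next
  fix m
  have "(\<lambda>i. rho_iter (Suc i) m 0) = (\<lambda>_. 0)" "(\<lambda>i. rho_iter (Suc i) 0 m) = (\<lambda>_. 0)" by auto
  then show "rho_lim m 0 = 0" "rho_lim 0 m = 0"
    using LIMSEQ_Suc[OF rho_iter_tendsto[of m 0]] LIMSEQ_Suc[OF rho_iter_tendsto[of 0 m]]
    by (simp_all add: LIMSEQ_const_iff)
qed

text \<open>The linear function \<open>m + n\<close> is a supersolution tending to infinity, so a multiple of it
  forces the maximum of a bounded subsolution to be attained.\<close>

lemma hop_max_principle:
  assumes B: "\<And>m n. d m n \<le> B"
    and eq: "\<And>m n. m \<ge> 1 \<Longrightarrow> n \<ge> 1 \<Longrightarrow> m \<noteq> n \<Longrightarrow> hop d m n = 2 * d m n"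
    and bdry: "\<And>m n. m = 0 \<or> n = 0 \<or> m = n \<Longrightarrow> d m n \<le> 0"
  shows "d m n \<le> 0"
proof -
  have main: "d m0 n0 \<le> e * real (m0 + n0)" if e: "e > 0" for e m0 n0
  proof (rule ccontr)
    assume "\<not> ?thesis"
    then have pos0: "d m0 n0 - e * real (m0 + n0) > 0" by simp
    define v where "v = (\<lambda>(m, n). d m n - e * real (m + n))"
    define S where "S = {p. v p > 0}"
    \<comment> \<open>Positivity of \<open>v\<close> forces \<open>e * (m + n) < B\<close>, hence
      only finitely many sites compete for the maximum.\<close>
    have "S \<subseteq> {..nat \<lceil>B / e\<rceil>} \<times> {..nat \<lceil>B / e\<rceil>}"
    proof
      fix p assume "p \<in> S"
      obtain m n where p: "p = (m, n)" by (cases p)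
      have "e * real (m + n) < B" using \<open>p \<in> S\<close> B[of m n] by (auto simp: S_def v_def p)
      then have "real (m + n) < B / e" using e by (simp add: field_simps)
      then have "m + n \<le> nat \<lceil>B / e\<rceil>" by linarith
      then show "p \<in> {..nat \<lceil>B / e\<rceil>} \<times> {..nat \<lceil>B / e\<rceil>}" by (simp add: p)
    qed
    then have fin: "finite S" by (rule finite_subset) simp
    have ne: "S \<noteq> {}" using pos0 by (auto simp: S_def v_def)
    obtain p where p: "p \<in> S" "\<And>r. r \<in> S \<Longrightarrow> v r \<le> v p"
    proof -
      have "Max (v ` S) \<in> v ` S" using fin ne by simp
      then obtain p where "p \<in> S" "v p = Max (v ` S)" by auto
      then show thesis using that[of p] fin by simp
    qed
    obtain m n where mn: "p = (m, n)" by (cases p)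
    have V: "v (m, n) > 0" using p by (simp add: S_def mn)
    have le: "v (i, j) \<le> v (m, n)" for i j
      using p(2)[of "(i, j)"] V by (cases "(i, j) \<in> S") (auto simp: mn S_def)
    have int: "\<not> (m = 0 \<or> n = 0 \<or> m = n)"
    proof
      assume "m = 0 \<or> n = 0 \<or> m = n"
      from bdry[OF this] have "d m n \<le> 0" .
      moreover have "e * real (m + n) \<ge> 0" using e by simp
      ultimately show False using V unfolding v_def by simp
    qed
    have a: "\<gamma> m / 2 * (v (m + 1, n) + v (m - 1, n)) \<le> \<gamma> m / 2 * (2 * v (m, n))"
      using le[of "m + 1" n] le[of "m - 1" n] gam_nonneg by (intro mult_left_mono) auto
    have b: "\<gamma> n / 2 * (v (m, n + 1) + v (m, n - 1)) \<le> \<gamma> n / 2 * (2 * v (m, n))"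
      using le[of m "n + 1"] le[of m "n - 1"] gam_nonneg by (intro mult_left_mono) auto
    \<comment> \<open>In each coordinate direction \<open>m + n\<close> is the average of its two
      neighbours, so \<open>hop\<close> multiplies it by \<open>\<gamma> m + \<gamma> n\<close>,
      which is less than 2.\<close>
    have "hop d m n = \<gamma> m / 2 * (v (m + 1, n) + v (m - 1, n)) + \<gamma> n / 2 * (v (m, n + 1) + v (m, n - 1))
        + (\<gamma> m + \<gamma> n) * (e * real (m + n))"
      using int by (simp add: hop_def v_def algebra_simps of_nat_diff)
    then have "2 * d m n \<le> (\<gamma> m + \<gamma> n) * v (m, n) + (\<gamma> m + \<gamma> n) * (e * real (m + n))"
      using eq[of m n] int a b by (simp add: algebra_simps)
    also have "\<dots> = (\<gamma> m + \<gamma> n) * d m n"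
      by (simp add: v_def algebra_simps)
    finally have "2 * d m n \<le> (\<gamma> m + \<gamma> n) * d m n" .
    moreover have "d m n > 0" using V e by (simp add: v_def) (smt (verit) mult_nonneg_nonneg of_nat_0_le_iff)
    ultimately have "2 \<le> \<gamma> m + \<gamma> n" by simp
    then show False using gam_less_1[of m] gam_less_1[of n] by simp
  qed
  have "d m n \<le> 0 + \<epsilon>" if "\<epsilon> > 0" for \<epsilon>
  proof -
    have "d m n \<le> \<epsilon> / (1 + real (m + n)) * real (m + n)"
      using main[of "\<epsilon> / (1 + real (m + n))" m n] that by simp
    also have "\<dots> \<le> \<epsilon>" using that by (simp add: field_simps)
    finally show ?thesis by simp
  qed
  then show ?thesis by (rule field_le_epsilon)
qed

lemma stationary_le:
  assumes "stationary \<kappa> \<rho>" "stationary \<kappa> \<rho>'"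
  shows "\<rho> m n \<le> \<rho>' m n"
proof -
  obtain B C where B: "\<And>m n. \<bar>\<rho> m n\<bar> \<le> B" and C: "\<And>m n. \<bar>\<rho>' m n\<bar> \<le> C"
    using assms unfolding stationary_iff by blast
  have "(\<lambda>m n. \<rho> m n - \<rho>' m n) m n \<le> 0"
  proof (rule hop_max_principle)
    show "\<rho> m n - \<rho>' m n \<le> B + C" for m n using B[of m n] C[of m n] by linarith
    show "hop (\<lambda>m n. \<rho> m n - \<rho>' m n) m n = 2 * (\<rho> m n - \<rho>' m n)" if "m \<ge> 1" "n \<ge> 1" "m \<noteq> n" for m n
      unfolding hop_diff using assms that unfolding stationary_iff by simp
    show "\<rho> m n - \<rho>' m n \<le> 0" if "m = 0 \<or> n = 0 \<or> m = n" for m n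
      using assms that unfolding stationary_iff by (cases "m = 0") auto
  qed
  then show ?thesis by simp
qed

lemma stationary_unique: "stationary \<kappa> \<rho> \<Longrightarrow> stationary \<kappa> \<rho>' \<Longrightarrow> \<rho> = \<rho>'"
  by (intro ext antisym stationary_le)

lemma stationary_rho: "stationary \<kappa> (rho \<kappa>)"
  unfolding rho_def by (rule theI'[where P = "stationary \<kappa>"])
    (use stationary_rho_lim stationary_unique in blast)

text \<open>The transpose satisfies the same system, so uniqueness applies.\<close>

lemma rho_sym: "rho \<kappa> m n = rho \<kappa> n m"
proof -
  have "stationary \<kappa> (\<lambda>m n. rho \<kappa> n m)"
  proof -
    have "hop (\<lambda>m n. rho \<kappa> n m) m n = hop (rho \<kappa>) n m" for m n
      by (auto simp: hop_def)
    then show ?thesis using stationary_rho unfolding stationary_iff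
      by (simp only:) (metis (no_types, lifting))
  qed
  then show ?thesis using stationary_unique[OF stationary_rho] by metis
qed

lemma rho_abs_le_1: "\<bar>rho \<kappa> m n\<bar> \<le> 1"
proof -
  have "\<bar>rho_iter i m n\<bar> \<le> 1" for i
    using rho_iter_nonneg[of i m n] rho_iter_le_1[of i m n] by simp
  moreover have "(\<lambda>i. \<bar>rho_iter i m n\<bar>) \<longlonglongrightarrow> \<bar>rho_lim m n\<bar>"
    by (intro tendsto_intros rho_iter_tendsto)
  ultimately have "\<bar>rho_lim m n\<bar> \<le> 1" by (blast intro: LIMSEQ_le_const2)
  then show ?thesis using stationary_unique[OF stationary_rho stationary_rho_lim] by simp
qed

section \<open>Existence, uniqueness and superposition\<close>

lemma evolves_iff:
  "evolves \<kappa> r \<longleftrightarrow>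
     (\<exists>B. \<forall>m n t. t \<ge> 0 \<longrightarrow> \<bar>r m n t\<bar> \<le> B) \<and>
     (\<forall>m n. continuous_on {0..} (r m n)) \<and>
     (\<forall>m n t. m \<ge> 1 \<and> n \<ge> 1 \<and> m \<noteq> n \<and> t > 0 \<longrightarrow>
        (r m n has_real_derivative (- 2 * r m n t + hop (\<lambda>m n. r m n t) m n)) (at t)) \<and>
     (\<forall>m t. t \<ge> 0 \<longrightarrow> r m 0 t = 0) \<and> (\<forall>n t. t \<ge> 0 \<longrightarrow> r 0 n t = 0) \<and>
     (\<forall>m n t. t > 0 \<longrightarrow> r m n t = r n m t)"
proof -
  have eq: "- 2 * r m n t + \<gamma> m / 2 * (r (m + 1) n t + r (m - 1) n t)
            + \<gamma> n / 2 * (r m (n + 1) t + r m (n - 1) t)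
      = - 2 * r m n t + hop (\<lambda>m n. r m n t) m n"
    if "m \<ge> 1 \<and> n \<ge> 1 \<and> m \<noteq> n \<and> t > 0" for m n t
    using that by (simp add: hop_def)
  have "(\<forall>m n t. m \<ge> 1 \<and> n \<ge> 1 \<and> m \<noteq> n \<and> t > 0 \<longrightarrow>
        (r m n has_real_derivative
           (- 2 * r m n t + \<gamma> m / 2 * (r (m + 1) n t + r (m - 1) n t)
            + \<gamma> n / 2 * (r m (n + 1) t + r m (n - 1) t))) (at t))
     \<longleftrightarrow> (\<forall>m n t. m \<ge> 1 \<and> n \<ge> 1 \<and> m \<noteq> n \<and> t > 0 \<longrightarrow>
        (r m n has_real_derivative (- 2 * r m n t + hop (\<lambda>m n. r m n t) m n)) (at t))"
    by (intro all_cong1 imp_cong refl) (subst eq, assumption, rule refl)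
  then show ?thesis unfolding evolves_def by (simp only:)
qed

lemma evolvesD:
  assumes "evolves \<kappa> r"
  shows "\<exists>B. \<forall>m n t. t \<ge> 0 \<longrightarrow> \<bar>r m n t\<bar> \<le> B"
    and "continuous_on {0..} (r m n)"
    and "m \<ge> 1 \<Longrightarrow> n \<ge> 1 \<Longrightarrow> m \<noteq> n \<Longrightarrow> t > 0 \<Longrightarrow>
        (r m n has_real_derivative (- 2 * r m n t + hop (\<lambda>m n. r m n t) m n)) (at t)"
    and "t \<ge> 0 \<Longrightarrow> r m 0 t = 0" "t \<ge> 0 \<Longrightarrow> r 0 m t = 0"
    and "t > 0 \<Longrightarrow> r m n t = r n m t"
proof -
  note 1 = assms[unfolded evolves_iff]
  note 2 = conjunct2[OF 1] note 3 = conjunct2[OF 2] note 4 = conjunct2[OF 3]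
  note 5 = conjunct2[OF 4] note 6 = conjunct2[OF 5]
  show "\<exists>B. \<forall>m n t. t \<ge> 0 \<longrightarrow> \<bar>r m n t\<bar> \<le> B" by (rule conjunct1[OF 1])
  show "continuous_on {0..} (r m n)" by (rule conjunct1[OF 2, rule_format])
  show "m \<ge> 1 \<Longrightarrow> n \<ge> 1 \<Longrightarrow> m \<noteq> n \<Longrightarrow> t > 0 \<Longrightarrow>
        (r m n has_real_derivative (- 2 * r m n t + hop (\<lambda>m n. r m n t) m n)) (at t)"
    by (rule conjunct1[OF 3, rule_format]) simp
  show "t \<ge> 0 \<Longrightarrow> r m 0 t = 0" by (rule conjunct1[OF 4, rule_format])
  show "t \<ge> 0 \<Longrightarrow> r 0 m t = 0" by (rule conjunct1[OF 5, rule_format])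
  show "t > 0 \<Longrightarrow> r m n t = r n m t" by (rule 6[rule_format])
qed

text \<open>Initial agreement is assumed only below the diagonal. The other half and the diagonal
  follow at t = 0 from symmetry and the diagonal values at positive times, by continuity.\<close>

lemma evolves_unique:
  assumes r: "evolves \<kappa> r" and r': "evolves \<kappa> r'"
    and diag: "\<And>m t. m \<ge> 1 \<Longrightarrow> t > 0 \<Longrightarrow> r m m t = r' m m t"
    and init: "\<And>m n. 1 \<le> n \<Longrightarrow> n < m \<Longrightarrow> r m n 0 = r' m n 0"
    and t: "t \<ge> 0"
  shows "r m n t = r' m n t"
proof -
  define u where "u = (\<lambda>m n t. r m n t - r' m n t)"
  note R = evolvesD[OF r] and R' = evolvesD[OF r']
  obtain B where B: "\<And>m n t. t \<ge> 0 \<Longrightarrow> \<bar>r m n t\<bar> \<le> B" using R(1) by blast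
  obtain C where C: "\<And>m n t. t \<ge> 0 \<Longrightarrow> \<bar>r' m n t\<bar> \<le> C" using R'(1) by blast
  have cont: "continuous_on {0..} (u m n)" for m n
    unfolding u_def by (intro continuous_intros R(2) R'(2))
  have sym: "u m n t = u n m t" if "t > 0" for m n t
  proof -
    have "r m n t = r n m t" "r' m n t = r' n m t" using R(6) R'(6) that by blast+
    then show ?thesis by (simp add: u_def)
  qed
  have sym0: "u m n 0 = u n m 0" for m n
    by (rule continuous_eq_at_0[OF cont cont]) (rule sym)
  have zero: "u m 0 t = 0" "u 0 m t = 0" if "t \<ge> 0" for m t
  proof -
    have "r m 0 t = 0" "r' m 0 t = 0" "r 0 m t = 0" "r' 0 m t = 0" using R(4,5) R'(4,5) that by blast+
    then show "u m 0 t = 0" "u 0 m t = 0" by (simp_all add: u_def)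
  qed
  have dg: "u m m t = 0" if "t \<ge> 0" for m t
  proof (cases "t = 0")
    case True
    show ?thesis unfolding True
    proof (rule continuous_eq_at_0[OF cont continuous_on_const])
      show "u m m t = 0" if "t > 0" for t
        using that diag[of m t] zero[of t 0] by (cases "m = 0") (auto simp: u_def)
    qed
  next
    case False
    then show ?thesis using that diag[of m t] zero[of t 0] by (cases "m = 0") (auto simp: u_def)
  qed
  have "u m n t = 0"
  proof (rule hop_flow_unique[of 1 u "B + C"])
    show "\<bar>u m n t\<bar> \<le> (B + C) * 1 ^ (m + n)" if "t \<ge> 0" for m n t
      using B[OF that, of m n] C[OF that, of m n] unfolding u_def by simp
    show "(u m n has_real_derivative - 2 * u m n t + hop (\<lambda>m n. u m n t) m n) (at t)"
      if "1 \<le> m" "1 \<le> n" "m \<noteq> n" "0 < t" for m n t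
    proof -
      have 1: "(r m n has_real_derivative (- 2 * r m n t + hop (\<lambda>m n. r m n t) m n)) (at t)"
        and 2: "(r' m n has_real_derivative (- 2 * r' m n t + hop (\<lambda>m n. r' m n t) m n)) (at t)"
        using R(3) R'(3) that by blast+
      show ?thesis unfolding u_def hop_diff
        by (rule DERIV_cong[OF DERIV_diff[OF 1 2]]) simp
    qed
    show "u m n 0 = 0" for m n
    proof -
      consider "m = 0 \<or> n = 0" | "m = n" | "1 \<le> n" "n < m" | "1 \<le> m" "m < n" by linarith
      then show ?thesis
      proof cases
        case 3
        then show ?thesis using init[of n m] by (simp add: u_def)
      next
        case 4
        then have "u n m 0 = 0" using init[of m n] by (simp add: u_def)
        then show ?thesis using sym0[of m n] by simp
      qed (use zero[of 0] dg[of 0] in auto)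
    qed
  qed (use cont zero dg t in auto)
  then show ?thesis by (simp add: u_def)
qed

text \<open>The unit datum of \<open>is_fund\<close> together with its mirror image, which symmetry
  and continuity force.\<close>

definition bump :: "nat \<Rightarrow> nat \<Rightarrow> nat \<Rightarrow> nat \<Rightarrow> real" where
  "bump k l m n = (if m = k \<and> n = l \<or> m = l \<and> n = k then 1 else 0)"

lemma flow_evolves:
  assumes "\<And>m n. \<bar>u m n\<bar> \<le> B" "\<And>m n. u m n = u n m" "\<And>m n. m = 0 \<or> n = 0 \<Longrightarrow> u m n = 0"
  shows "evolves \<kappa> (flow u)"
  unfolding evolves_iff
proof (intro conjI allI impI exI[of _ B])
  show "continuous_on {0..} (flow u m n)" for m n
    using flow_deriv[of u B, OF assms(1)] by (intro continuous_at_imp_continuous_on) (auto intro: DERIV_isCont)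
  show "\<bar>flow u m n t\<bar> \<le> B" if "0 \<le> t" for m n t
    by (rule flow_bound[OF assms(1) that])
  show "(flow u m n has_real_derivative - 2 * flow u m n t + hop (\<lambda>m n. flow u m n t) m n) (at t)" for m n t
    by (rule flow_deriv[OF assms(1)])
  show "flow u m 0 t = 0" "flow u 0 m t = 0" for m t
    by (rule flow_boundary; simp add: assms(3))+
  show "flow u m n t = flow u n m t" for m n t
    by (rule flow_sym[OF assms(2)])
qed

lemma is_fund_flow:
  assumes "1 \<le> l" "l < k"
  shows "is_fund \<kappa> k l (flow (bump k l))"
  unfolding is_fund_def
proof (intro conjI allI impI)
  show "evolves \<kappa> (flow (bump k l))"
    by (rule flow_evolves[where B = 1]) (use assms in \<open>auto simp: bump_def\<close>)
  show "flow (bump k l) m m t = 0" for m t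
    by (rule flow_boundary) (use assms in \<open>auto simp: bump_def\<close>)
  show "flow (bump k l) m n 0 = (if m = k \<and> n = l then 1 else 0)" if "m \<ge> 1 \<and> n \<ge> 1 \<and> m > n" for m n
    unfolding flow_0 using that assms by (auto simp: bump_def)
qed

lemma is_fund_unique:
  assumes "is_fund \<kappa> k l g" "is_fund \<kappa> k l g'" "t \<ge> 0"
  shows "g m n t = g' m n t"
proof (rule evolves_unique[of g g'])
  show "evolves \<kappa> g" "evolves \<kappa> g'"
    using assms(1,2) unfolding is_fund_def by blast+
  show "g m m t = g' m m t" if "t > 0" for m t
    using assms(1,2) that unfolding is_fund_def by simp
  show "g m n 0 = g' m n 0" if "1 \<le> n" "n < m" for m n
    using assms(1,2) that unfolding is_fund_def by simp
qed (rule assms(3))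

lemma is_solution_unique:
  assumes "is_solution \<kappa> r0 r" "is_solution \<kappa> r0 r'" "t \<ge> 0"
  shows "r m n t = r' m n t"
proof (rule evolves_unique[of r r'])
  show "evolves \<kappa> r" "evolves \<kappa> r'"
    using assms(1,2) unfolding is_solution_def by blast+
  show "r m m t = r' m m t" if "m \<ge> 1" "t > 0" for m t
    using assms(1,2) that unfolding is_solution_def by simp
  show "r m n 0 = r' m n 0" if "1 \<le> n" "n < m" for m n
    using assms(1,2) that unfolding is_solution_def by simp
qed (rule assms(3))

text \<open>Initial data are meaningful only for positive indices, so values of \<open>r0\<close> on
  the axes are discarded. On the diagonal \<open>r0\<close> and \<open>rho\<close> are both
  1.\<close>

definition deviation :: "(nat \<Rightarrow> nat \<Rightarrow> real) \<Rightarrow> nat \<Rightarrow> nat \<Rightarrow> real" where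
  "deviation r0 m n = (if m = 0 \<or> n = 0 \<or> m = n then 0 else r0 m n - rho \<kappa> m n)"

context
  fixes r0 :: "nat \<Rightarrow> nat \<Rightarrow> real"
  assumes r0_range: "\<And>m n. m \<ge> 1 \<Longrightarrow> n \<ge> 1 \<Longrightarrow> \<bar>r0 m n\<bar> \<le> 1"
    and r0_sym: "\<And>m n. m \<ge> 1 \<Longrightarrow> n \<ge> 1 \<Longrightarrow> r0 m n = r0 n m"
    and r0_diag: "\<And>m. m \<ge> 1 \<Longrightarrow> r0 m m = 1"
begin

lemma deviation_bound: "\<bar>deviation r0 m n\<bar> \<le> 2"
  using r0_range[of m n] rho_abs_le_1[of m n] by (auto simp: deviation_def)

lemma deviation_sym: "deviation r0 m n = deviation r0 n m"
  using r0_sym[of m n] rho_sym[of m n] by (auto simp: deviation_def)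

text \<open>The stationary part absorbs the inhomogeneous diagonal condition; the deviation then
  evolves with zero diagonal.\<close>

lemma is_solution_flow: "is_solution \<kappa> r0 (\<lambda>m n t. rho \<kappa> m n + flow (deviation r0) m n t)"
  unfolding is_solution_def
proof (intro conjI allI impI)
  have ev: "evolves \<kappa> (flow (deviation r0))"
    by (rule flow_evolves[OF deviation_bound deviation_sym]) (auto simp: deviation_def)
  have st: "m \<ge> 1 \<Longrightarrow> n \<ge> 1 \<Longrightarrow> m \<noteq> n \<Longrightarrow> hop (rho \<kappa>) m n = 2 * rho \<kappa> m n"
    "m \<ge> 1 \<Longrightarrow> rho \<kappa> m m = 1" "rho \<kappa> m 0 = 0" "rho \<kappa> 0 n = 0" for m n
    using stationary_rho unfolding stationary_iff by auto
  have hop_add: "hop (\<lambda>m n. rho \<kappa> m n + flow (deviation r0) m n t) m n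
      = hop (rho \<kappa>) m n + hop (\<lambda>m n. flow (deviation r0) m n t) m n" for m n t
    by (auto simp: hop_def algebra_simps)
  show "evolves \<kappa> (\<lambda>m n t. rho \<kappa> m n + flow (deviation r0) m n t)"
    unfolding evolves_iff
  proof (intro conjI allI impI exI[of _ 3])
    show "\<bar>rho \<kappa> m n + flow (deviation r0) m n t\<bar> \<le> 3" if "0 \<le> t" for m n t
      using rho_abs_le_1[of m n] flow_bound[of "deviation r0" 2, OF deviation_bound that, of m n] by linarith
    show "continuous_on {0..} (\<lambda>t. rho \<kappa> m n + flow (deviation r0) m n t)" for m n
      by (intro continuous_intros evolvesD(2)[OF ev])
    show "((\<lambda>t. rho \<kappa> m n + flow (deviation r0) m n t) has_real_derivative
        - 2 * (rho \<kappa> m n + flow (deviation r0) m n t)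
        + hop (\<lambda>m n. rho \<kappa> m n + flow (deviation r0) m n t) m n) (at t)"
      if "1 \<le> m \<and> 1 \<le> n \<and> m \<noteq> n \<and> 0 < t" for m n t
    proof -
      have "(flow (deviation r0) m n has_real_derivative
          - 2 * flow (deviation r0) m n t + hop (\<lambda>m n. flow (deviation r0) m n t) m n) (at t)"
        using evolvesD(3)[OF ev] that by blast
      from DERIV_add[OF DERIV_const this] show ?thesis
        by (rule DERIV_cong) (use st that in \<open>simp add: hop_add\<close>)
    qed
    show "rho \<kappa> m 0 + flow (deviation r0) m 0 t = 0" "rho \<kappa> 0 m + flow (deviation r0) 0 m t = 0"
      if "0 \<le> t" for m t
      using evolvesD(4,5)[OF ev] st that by simp_all
    show "rho \<kappa> m n + flow (deviation r0) m n t = rho \<kappa> n m + flow (deviation r0) n m t" if "0 < t" for m n t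
      using evolvesD(6)[OF ev that, of m n] rho_sym[of m n] by simp
  qed
  show "rho \<kappa> m m + flow (deviation r0) m m t = 1" if "m \<ge> 1 \<and> t > 0" for m t
    using st(2)[of m] flow_boundary[of m m "deviation r0" t] that by (simp add: deviation_def)
  show "rho \<kappa> m n + flow (deviation r0) m n 0 = r0 m n" if "m \<ge> 1 \<and> n \<ge> 1" for m n
    using that st(2)[of m] r0_diag[of m] by (auto simp: flow_0 deviation_def)
qed

text \<open>A site \<open>(a, b)\<close> off the diagonal is hit by a single bump, the one indexed
  by its larger and smaller coordinate.\<close>

lemma bump_expansion:
  assumes "finite F" "F \<subseteq> {(k, l). 1 \<le> l \<and> l < k}"
  shows "(\<Sum>(k, l)\<in>F. (r0 k l - rho \<kappa> k l) * bump k l a b)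
    = (if (max a b, min a b) \<in> F then deviation r0 a b else 0)"
proof -
  have "(\<Sum>(k, l)\<in>F. (r0 k l - rho \<kappa> k l) * bump k l a b)
      = (\<Sum>x\<in>F. if x = (max a b, min a b) then deviation r0 a b else 0)"
  proof (rule sum.cong[OF refl])
    fix x assume "x \<in> F"
    obtain k l where x: "x = (k, l)" by (cases x)
    have kl: "1 \<le> l" "l < k" using \<open>x \<in> F\<close> assms(2) by (auto simp: x)
    then have d: "r0 k l - rho \<kappa> k l = deviation r0 k l" by (simp add: deviation_def)
    have "bump k l a b = (if x = (max a b, min a b) then 1 else 0)"
      using kl by (simp add: x bump_def max_def min_def)
    moreover have "deviation r0 k l = deviation r0 a b" if "x = (max a b, min a b)"
      using that deviation_sym[of a b] by (cases "a \<le> b") (simp_all add: x)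
    ultimately show "(case x of (k, l) \<Rightarrow> (r0 k l - rho \<kappa> k l) * bump k l a b)
        = (if x = (max a b, min a b) then deviation r0 a b else 0)"
      unfolding x prod.case d by simp
  qed
  then show ?thesis using assms(1) by simp
qed

text \<open>The data need not decay, so convergence rests on finite propagation: once the index set
  covers a large box, the omitted data contribute at most a tail of the exponential series, whatever
  else the set contains.\<close>

lemma flow_superposition:
  assumes "t \<ge> 0"
  shows "((\<lambda>(k, l). (r0 k l - rho \<kappa> k l) * flow (bump k l) m n t) has_sum flow (deviation r0) m n t)
     {(k, l). 1 \<le> l \<and> l < k}"
  unfolding has_sum_def
proof (rule tendstoI)
  let ?A = "{(k :: nat, l :: nat). 1 \<le> l \<and> l < k}"
  fix \<epsilon> :: real assume e: "\<epsilon> > 0"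
  let ?T = "\<lambda>N. \<Sum>i. (2 * t) ^ (i + N) / fact (i + N)"
  have "?T \<longlonglongrightarrow> 0"
    using suminf_exist_split2[OF sums_summable[OF exp_sums_real[of "2 * t"]]] .
  then have "eventually (\<lambda>N. ?T N < \<epsilon> / 2) sequentially"
    by (rule order_tendstoD(2)) (use e in simp)
  then obtain N where N: "?T N < \<epsilon> / 2" by (auto simp: eventually_sequentially)
  \<comment> \<open>Large enough that the box contains every pair with \<open>a < m + N\<close> and
    \<open>b < n + N\<close> after ordering its coordinates.\<close>
  define M where "M = m + n + N"
  have "dist (\<Sum>x\<in>F. case x of (k, l) \<Rightarrow> (r0 k l - rho \<kappa> k l) * flow (bump k l) m n t)
     (flow (deviation r0) m n t) < \<epsilon>"
    if F: "finite F" "?A \<inter> {..<M} \<times> {..<M} \<subseteq> F" "F \<subseteq> ?A" for F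
  proof -
    let ?w = "\<lambda>a b. \<Sum>x\<in>F. (case x of (k, l) \<Rightarrow> r0 k l - rho \<kappa> k l) * (case x of (k, l) \<Rightarrow> bump k l a b)"
    have w: "?w a b = (if (max a b, min a b) \<in> F then deviation r0 a b else 0)" for a b
      using bump_expansion[OF F(1,3), of a b] by (simp add: case_prod_unfold)
    have wb: "\<bar>?w a b\<bar> \<le> 2" for a b unfolding w using deviation_bound by simp
    have "flow ?w m n t = (\<Sum>x\<in>F. (case x of (k, l) \<Rightarrow> r0 k l - rho \<kappa> k l) * flow (case x of (k, l) \<Rightarrow> bump k l) m n t)"
      using flow_sum[OF F(1), of "\<lambda>x. case x of (k, l) \<Rightarrow> bump k l" 1
          "\<lambda>x. case x of (k, l) \<Rightarrow> r0 k l - rho \<kappa> k l" m n t]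
      by (simp add: case_prod_unfold bump_def)
    then have sum: "(\<Sum>x\<in>F. case x of (k, l) \<Rightarrow> (r0 k l - rho \<kappa> k l) * flow (bump k l) m n t) = flow ?w m n t"
      by (simp add: case_prod_unfold)
    have "\<bar>flow (\<lambda>a b. deviation r0 a b - ?w a b) m n t\<bar> \<le> 2 * ?T N"
    proof (rule flow_tail_bound[OF _ assms])
      show "\<bar>deviation r0 a b - ?w a b\<bar> \<le> 2" for a b
        unfolding w using deviation_bound[of a b] by simp
      show "deviation r0 a b - ?w a b = 0" if "a < m + N" "b < n + N" for a b
      proof (cases "a = 0 \<or> b = 0 \<or> a = b")
        case True
        then show ?thesis unfolding w by (simp add: deviation_def)
      next
        case False
        then have "(max a b, min a b) \<in> ?A \<inter> {..<M} \<times> {..<M}"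
          using that by (auto simp: M_def max_def min_def)
        then have "(max a b, min a b) \<in> F" using F(2) by blast
        then show ?thesis unfolding w by simp
      qed
    qed
    moreover have "flow (\<lambda>a b. deviation r0 a b - ?w a b) m n t
        = flow (deviation r0) m n t - flow ?w m n t"
      by (rule flow_diff[OF deviation_bound wb])
    ultimately show ?thesis unfolding sum dist_real_def using N by linarith
  qed
  moreover have "finite (?A \<inter> {..<M} \<times> {..<M})" by simp
  ultimately show "\<forall>\<^sub>F F in finite_subsets_at_top ?A.
     dist (\<Sum>x\<in>F. case x of (k, l) \<Rightarrow> (r0 k l - rho \<kappa> k l) * flow (bump k l) m n t)
       (flow (deviation r0) m n t) < \<epsilon>"
    unfolding eventually_finite_subsets_at_top
    by (intro exI[of _ "?A \<inter> {..<M} \<times> {..<M}"]) blast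
qed

end

section \<open>The Rogers polynomials\<close>

lemma q_pos: "0 < q" and q_less_1: "q < 1"
  using kappa_pos by (auto simp: qq_def)

lemma q_power_le_1: "q ^ n \<le> 1"
  using q_pos q_less_1 by (simp add: power_le_one)

lemma q_power_pos: "0 < q ^ n"
  using q_pos by simp

lemma q_power_less_1: "n \<ge> 1 \<Longrightarrow> q ^ n < 1"
  using q_pos q_less_1 by (simp add: power_less_one_iff)

lemma q_power_le_q: "n \<ge> 1 \<Longrightarrow> q ^ n \<le> q"
  using power_decreasing[of 1 n q] q_pos q_less_1 by simp

lemma gam_eq: "\<gamma> n = (1 - q ^ n) / (1 + q ^ n)"
proof -
  have "exp (- 2 * (\<kappa> * real n)) = q ^ n"
    by (simp add: qq_def exp_of_nat_mult[symmetric] mult_ac)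
  then show ?thesis unfolding gam_def tanh_real_altdef by simp
qed

definition f :: "nat \<Rightarrow> real" where
  "f k = qpoch (- q) q k / qpoch q q k"

lemma f_0 [simp]: "f 0 = 1"
  by (simp add: f_def qpoch_def)

lemma f_Suc: "f (Suc k) = f k * ((1 + q ^ Suc k) / (1 - q ^ Suc k))"
  by (simp add: f_def qpoch_def)

text \<open>Hence \<open>1 / f k\<close> is the product of \<gamma> over 1, ..., k; this ties the
  polynomial coefficients to the rates of the chain.\<close>

lemma inverse_f_Suc: "1 / f (Suc k) = 1 / f k * \<gamma> (Suc k)"
  by (simp add: f_Suc gam_eq)

lemma f_mono: "f k \<le> f (Suc k)" and f_ge_1: "f k \<ge> 1"
proof -
  have r: "(1 + q ^ Suc k) / (1 - q ^ Suc k) \<ge> 1" for k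
    using q_power_less_1[of "Suc k"] q_power_pos[of "Suc k"] by (simp add: field_simps)
  show g: "f k \<ge> 1" for k
  proof (induction k)
    case (Suc k)
    have "1 * 1 \<le> f k * ((1 + q ^ Suc k) / (1 - q ^ Suc k))"
      by (rule mult_mono) (use Suc r[of k] in auto)
    then show ?case by (simp only: f_Suc mult_1)
  qed simp
  show "f k \<le> f (Suc k)" unfolding f_Suc
    using mult_left_mono[OF r[of k], of "f k"] g[of k] by simp
qed

text \<open>The Rogers polynomial of degree \<open>n - 1\<close> in \<open>cos \<theta>\<close>.
  With this shift the value 0 at \<open>n = 0\<close> is the boundary condition of the
  chain.\<close>

definition c :: "nat \<Rightarrow> real \<Rightarrow> real" where
  "c n \<theta> = (\<Sum>k<n. f k * f (n - 1 - k) * cos ((2 * real k - real n + 1) * \<theta>))"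

lemma Pn_eq: "Pn \<kappa> n \<theta> = sqrt (\<gamma> 1 / \<gamma> n) * c n \<theta>"
  by (simp add: Pn_def c_def f_def)

lemma c_0: "c 0 \<theta> = 0" and c_1: "c (Suc 0) \<theta> = 1"
  by (simp_all add: c_def)

text \<open>After division by \<open>f (k - 1) * f (N - k)\<close> this is the addition formula coth
  x + coth y = tanh (x + y) (coth x coth y + 1) for \<open>x = \<kappa> * k\<close> and
  \<open>y = \<kappa> * (N + 1 - k)\<close>.\<close>

lemma f_convolution:
  assumes "1 \<le> k" "k \<le> N"
  shows "f (k - 1) * f (N + 1 - k) + f k * f (N - k) = \<gamma> (N + 1) * (f k * f (N + 1 - k) + f (k - 1) * f (N - k))"
proof -
  obtain i j where i: "k = Suc i" and j: "N = Suc i + j"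
    using assms by (metis Suc_le_D le_Suc_ex One_nat_def)
  define a where "a = q ^ Suc i" define b where "b = q ^ Suc j"
  have ab: "q ^ (N + 1) = a * b" by (simp add: a_def b_def j power_add)
  have nz: "a < 1" "b < 1" "a > 0" "b > 0" unfolding a_def b_def by (simp_all only: q_power_less_1 q_power_pos)
  have ab1: "1 + a * b > 0" using nz by (simp add: add_pos_pos)
  have "(1 + b) / (1 - b) + (1 + a) / (1 - a) = 2 * (1 - a * b) / ((1 - a) * (1 - b))"
    using nz by (simp add: field_simps)
  also have "\<dots> = (1 - a * b) / (1 + a * b) * (2 * (1 + a * b) / ((1 - a) * (1 - b)))"
  proof -
    have gen: "2 * x / D = x / s * (2 * s / D)" if "s \<noteq> 0" for x s D :: real using that by simp
    show ?thesis by (rule gen) (use ab1 in simp)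
  qed
  also have "2 * (1 + a * b) / ((1 - a) * (1 - b)) = (1 + a) / (1 - a) * ((1 + b) / (1 - b)) + 1"
    using nz by (simp add: divide_simps) (simp add: algebra_simps)
  finally have key: "(1 + b) / (1 - b) + (1 + a) / (1 - a)
      = (1 - a * b) / (1 + a * b) * ((1 + a) / (1 - a) * ((1 + b) / (1 - b)) + 1)" .
  have e: "f k = f i * ((1 + a) / (1 - a))" "f (N + 1 - k) = f j * ((1 + b) / (1 - b))"
    "k - 1 = i" "N - k = j"
    unfolding a_def b_def by (simp_all add: i j f_Suc)
  have "f (k - 1) * f (N + 1 - k) + f k * f (N - k) = f i * f j * ((1 + b) / (1 - b) + (1 + a) / (1 - a))"
    unfolding e by (simp only: algebra_simps)
  also have "\<dots> = \<gamma> (N + 1) * (f k * f (N + 1 - k) + f (k - 1) * f (N - k))"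
    unfolding e key gam_eq ab by (simp only: algebra_simps)
  finally show ?thesis .
qed

text \<open>Multiplication by \<open>2 * cos \<theta>\<close> moves every frequency to its two
  neighbours. Inner frequencies match by \<open>f_convolution\<close>; the two extreme ones by
  \<open>\<gamma> (Suc N) * f (Suc N) = f N\<close>.\<close>

lemma c_rec: "2 * cos \<theta> * c (Suc N) \<theta> = \<gamma> (Suc N) * (c (Suc (Suc N)) \<theta> + c N \<theta>)"
proof -
  define g where "g = (\<lambda>k. cos ((2 * real k - real N - 1) * \<theta>))"
  have prod: "2 * cos \<theta> * cos ((2 * real k - real N) * \<theta>) = g (Suc k) + g k" for k
  proof -
    have "(2 * real (Suc k) - real N - 1) * \<theta> = (2 * real k - real N) * \<theta> + \<theta>"
      "(2 * real k - real N - 1) * \<theta> = (2 * real k - real N) * \<theta> - \<theta>"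
      by (simp_all add: algebra_simps)
    then show ?thesis unfolding g_def by (simp only: cos_add cos_diff) (simp add: algebra_simps)
  qed
  have c1: "c (Suc N) \<theta> = (\<Sum>k\<le>N. f k * f (N - k) * cos ((2 * real k - real N) * \<theta>))"
    by (simp add: c_def lessThan_Suc_atMost algebra_simps)
  have c2: "c (Suc (Suc N)) \<theta> = (\<Sum>k\<le>Suc N. f k * f (N + 1 - k) * g k)"
    unfolding c_def lessThan_Suc_atMost by (intro sum.cong refl) (simp add: g_def algebra_simps)
  \<comment> \<open>Padding with zero coefficients brings all three polynomials to the same list of
    frequencies \<open>g k\<close>.\<close>
  have c0: "c N \<theta> = (\<Sum>k\<le>Suc N. (if 1 \<le> k \<and> k \<le> N then f (k - 1) * f (N - k) else 0) * g k)"
  proof -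
    have "(\<Sum>k\<le>Suc N. (if 1 \<le> k \<and> k \<le> N then f (k - 1) * f (N - k) else 0) * g k)
        = (\<Sum>k\<le>N. (if k < N then f k * f (N - Suc k) else 0) * g (Suc k))"
      by (subst sum.atMost_Suc_shift) (auto intro!: sum.cong)
    also have "\<dots> = (\<Sum>k<N. (if k < N then f k * f (N - Suc k) else 0) * g (Suc k))"
      unfolding lessThan_Suc_atMost[symmetric] by simp
    also have "\<dots> = c N \<theta>" unfolding c_def g_def
      by (intro sum.cong refl) (simp add: algebra_simps)
    finally show ?thesis by simp
  qed
  have "2 * cos \<theta> * c (Suc N) \<theta> = (\<Sum>k\<le>N. f k * f (N - k) * (2 * cos \<theta> * cos ((2 * real k - real N) * \<theta>)))"
    unfolding c1 sum_distrib_left by (intro sum.cong refl) (simp add: algebra_simps)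
  also have "\<dots> = (\<Sum>k\<le>N. f k * f (N - k) * g (Suc k)) + (\<Sum>k\<le>N. f k * f (N - k) * g k)"
    unfolding prod by (simp add: algebra_simps sum.distrib)
  also have "(\<Sum>k\<le>N. f k * f (N - k) * g (Suc k)) = (\<Sum>k\<le>Suc N. (if 1 \<le> k then f (k - 1) * f (N + 1 - k) else 0) * g k)"
    by (subst sum.atMost_Suc_shift) (auto intro!: sum.cong)
  also have "(\<Sum>k\<le>N. f k * f (N - k) * g k) = (\<Sum>k\<le>Suc N. (if k \<le> N then f k * f (N - k) else 0) * g k)"
    by simp
  finally have lhs: "2 * cos \<theta> * c (Suc N) \<theta> = (\<Sum>k\<le>Suc N.
     ((if 1 \<le> k then f (k - 1) * f (N + 1 - k) else 0) + (if k \<le> N then f k * f (N - k) else 0)) * g k)"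
    by (simp only: sum.distrib[symmetric] distrib_right[symmetric])
  have rhs: "\<gamma> (Suc N) * (c (Suc (Suc N)) \<theta> + c N \<theta>) = (\<Sum>k\<le>Suc N.
     (\<gamma> (Suc N) * (f k * f (N + 1 - k) + (if 1 \<le> k \<and> k \<le> N then f (k - 1) * f (N - k) else 0))) * g k)"
    unfolding c0 c2 sum.distrib[symmetric] sum_distrib_left
    by (intro sum.cong refl) (simp only: distrib_right distrib_left mult_ac)
  have coeff: "(if 1 \<le> k then f (k - 1) * f (N + 1 - k) else 0) + (if k \<le> N then f k * f (N - k) else 0)
     = \<gamma> (Suc N) * (f k * f (N + 1 - k) + (if 1 \<le> k \<and> k \<le> N then f (k - 1) * f (N - k) else 0))"
    if kN: "k \<le> Suc N" for k
  proof -
    have r: "\<gamma> (Suc N) * f (Suc N) = f N"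
      using inverse_f_Suc[of N] f_ge_1[of N] f_ge_1[of "Suc N"] by (simp add: field_simps)
    consider "1 \<le> k \<and> k \<le> N" | "k = 0" | "k = Suc N" using kN by linarith
    then show ?thesis
    proof cases
      case 1
      then show ?thesis using f_convolution[of k N] by simp
    qed (use r in auto)
  qed
  show ?thesis unfolding lhs rhs by (intro sum.cong refl) (simp only: coeff atMost_iff)
qed

text \<open>The argument is \<open>1 - cos \<theta>\<close>, so that \<open>[:1, -1:]\<close> stands
  for \<open>cos \<theta>\<close> and the lowest coefficients describe the edge \<theta> =
  0.\<close>

fun p :: "nat \<Rightarrow> real poly" where
  "p 0 = 0"
| "p (Suc 0) = 1"
| "p (Suc (Suc n)) = smult (2 / \<gamma> (Suc n)) ([:1, -1:] * p (Suc n)) - p n"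

lemma c_eq_poly: "c n \<theta> = poly (p n) (1 - cos \<theta>)"
proof (induction n rule: p.induct)
  case (3 n)
  have "\<gamma> (Suc n) > 0" by (rule gam_pos) simp
  then have "c (Suc (Suc n)) \<theta> = 2 / \<gamma> (Suc n) * (cos \<theta> * c (Suc n) \<theta>) - c n \<theta>"
    using c_rec[of \<theta> n] by (simp add: field_simps)
  then show ?case by (simp add: 3 algebra_simps)
qed (simp_all add: c_0 c_1)

text \<open>Crude but uniform in \<theta>: it only has to place the determinant in the growth class
  of \<open>hop_flow_unique\<close>.\<close>

lemma c_bound: "\<bar>c n \<theta>\<bar> \<le> (2 / \<gamma> 1 + 1) ^ n"
proof (induction n rule: p.induct)
  case (3 n)
  let ?K = "2 / \<gamma> 1 + 1"
  have g1: "\<gamma> 1 > 0" and g: "\<gamma> (Suc n) > 0" by (rule gam_pos, simp)+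
  have "c (Suc (Suc n)) \<theta> = 2 / \<gamma> (Suc n) * (cos \<theta> * c (Suc n) \<theta>) - c n \<theta>"
    using c_rec[of \<theta> n] g by (simp add: field_simps)
  then have "\<bar>c (Suc (Suc n)) \<theta>\<bar> \<le> \<bar>2 / \<gamma> (Suc n) * (cos \<theta> * c (Suc n) \<theta>)\<bar> + \<bar>c n \<theta>\<bar>"
    by (simp only:)
  also have "\<bar>2 / \<gamma> (Suc n) * (cos \<theta> * c (Suc n) \<theta>)\<bar> = 2 / \<gamma> (Suc n) * (\<bar>cos \<theta>\<bar> * \<bar>c (Suc n) \<theta>\<bar>)"
    using g by (simp add: abs_mult)
  also have "\<dots> \<le> 2 / \<gamma> 1 * (1 * ?K ^ Suc n)"
    using g1 g gam_ge_gam_1[of "Suc n"] 3 by (intro mult_mono divide_left_mono) auto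
  also have "\<bar>c n \<theta>\<bar> \<le> ?K ^ Suc n"
    using 3(2) power_increasing[of n "Suc n" ?K] g1 by simp
  also have "2 / \<gamma> 1 * (1 * ?K ^ Suc n) + ?K ^ Suc n = ?K ^ Suc (Suc n)"
    by (simp only: power_Suc[of _ "Suc n"] distrib_right mult_1)
  finally show ?case by (simp only: add_right_mono)
qed (simp_all add: c_0 c_1 gam_nonneg)

section \<open>Fourier series of the weight\<close>

text \<open>
  Up to normalisation \<open>X m k\<close> is Rogers' connection coefficient of \<open>cos ((m - 1 + 2 k) \<theta>)\<close> in the
  basis \<open>c\<close>, and \<open>A\<close> are the Taylor coefficients of \<open>(z;q)\<^sub>\<infinity> / (-q z;q)\<^sub>\<infinity>\<close>.  The general formula
  for \<open>X\<close> is \<open>0 / 0\<close> at \<open>m = 1\<close>, \<open>k = 0\<close>; the value there is half the constant Fourier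
  coefficient of the weight.
\<close>

primrec A :: "nat \<Rightarrow> real" where
  "A 0 = 1"
| "A (Suc k) = - A k * (q + q ^ k) / (1 - q ^ Suc k)"

definition X :: "nat \<Rightarrow> nat \<Rightarrow> real" where
  "X m k = (if m = 0 then 0 else if k = 0 then 1 / f m else
     A k / f (m + k) * ((1 - q ^ m) * (1 - q ^ (m + 2 * k - 1)) / ((1 - q ^ (m + k - 1)) * (1 - q ^ (m + k)))))"

text \<open>One formula for both branches of \<open>X\<close>: at \<open>k = 0\<close> the fraction
  cancels to 1, and the condition keeps out the corner where it would be 0 / 0.\<close>

lemma X_Suc_left:
  assumes "M + k \<ge> 1"
  shows "X (Suc M) k = A k / f (Suc M + k) * ((1 - q * q ^ M) * (1 - q ^ M * (q ^ k)\<^sup>2)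
     / ((1 - q ^ k * q ^ M) * (1 - q * q ^ k * q ^ M)))"
proof (cases "k = 0")
  case True
  have "q ^ M \<noteq> 1" "q * q ^ M \<noteq> 1"
    using q_power_less_1[of M] q_power_less_1[of "Suc M"] assms True by auto
  then show ?thesis using True by (simp add: X_def)
next
  case False
  have "Suc M + 2 * k - 1 = M + k * 2" "Suc M + k - 1 = M + k" by auto
  then show ?thesis using False by (simp add: X_def power_add power_mult mult_ac)
qed

lemma X_Suc_right:
  "X M (Suc k) = A (Suc k) / f (M + Suc k) * ((1 - q ^ M) * (1 - q * (q ^ k)\<^sup>2 * q ^ M)
     / ((1 - q ^ k * q ^ M) * (1 - q * q ^ k * q ^ M)))"
proof -
  have "M + 2 * Suc k - 1 = Suc (M + k * 2)" "M + Suc k - 1 = M + k" by auto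
  then show ?thesis by (simp add: X_def power_add power_mult mult_ac)
qed

text \<open>The coefficient of frequency \<open>M + 1 + 2 * k\<close> in the recurrence for \<Phi>;
  the excluded corner is handled by \<open>X_corner\<close>.\<close>

lemma X_rec:
  assumes "M + k \<ge> 1"
  shows "X (Suc M) k + X (Suc M) (Suc k) = \<gamma> (Suc M) * (X (Suc (Suc M)) k + X M (Suc k))"
proof -
  define a where "a = q ^ k" define b where "b = q ^ M"
  have ab: "a > 0" "b > 0" by (simp_all add: a_def b_def q_pos)
  have "q ^ (M + k) < 1" "q ^ Suc (M + k) < 1" "q ^ Suc (Suc (M + k)) < 1" "q ^ Suc k < 1"
    using assms by (simp_all only: q_power_less_1)
  then have lt: "a * b < 1" "q * a * b < 1" "q * q * a * b < 1" "q * a < 1"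
    by (simp_all add: a_def b_def power_add mult_ac)
  have pos: "1 + q * b > 0" "1 + q * q * a * b > 0"
    using ab q_pos by (simp_all add: add_pos_pos)
  note id = X_rec_identity[of a b q]
  define Y where "Y = A k / f (Suc M + k)"
  have f1: "f (M + Suc k) = f (Suc M + k)" by simp
  have i2: "1 / f (Suc (Suc M + k)) = 1 / f (Suc M + k) * ((1 - q * q * a * b) / (1 + q * q * a * b))"
    unfolding inverse_f_Suc gam_eq by (simp add: a_def b_def power_add mult_ac)
  have i3: "z / f (Suc (Suc M + k)) = z / f (Suc M + k) * ((1 - q * q * a * b) / (1 + q * q * a * b))" for z
    using arg_cong[OF i2, of "\<lambda>x. z * x"] by simp
  have A1: "A (Suc k) = A k * (- (q + a) / (1 - q * a))"
    by (simp add: a_def algebra_simps diff_divide_distrib add_divide_distrib)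
  have "X (Suc M) k = Y * ((1 - q * b) * (1 - b * a\<^sup>2) / ((1 - a * b) * (1 - q * a * b)))"
    using X_Suc_left[OF assms] by (simp add: Y_def a_def b_def)
  moreover have "X (Suc M) (Suc k) = Y * ((- (q + a) / (1 - q * a)) * ((1 - q * q * a * b) / (1 + q * q * a * b))
       * ((1 - q * b) * (1 - b * (q * a)\<^sup>2) / ((1 - q * a * b) * (1 - q * q * a * b))))"
  proof -
    have "X (Suc M) (Suc k) = A (Suc k) / f (Suc (Suc M + k)) * ((1 - q * b) * (1 - b * (q * a)\<^sup>2)
       / ((1 - q * a * b) * (1 - q * (q * a) * b)))"
      using X_Suc_left[of M "Suc k"] by (simp add: a_def b_def)
    then show ?thesis unfolding i3 A1 Y_def by (simp only: mult_ac times_divide_eq_left times_divide_eq_right divide_divide_eq_left)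
  qed
  moreover have "X (Suc (Suc M)) k = Y * (((1 - q * q * a * b) / (1 + q * q * a * b))
       * ((1 - q * (q * b)) * (1 - q * b * a\<^sup>2) / ((1 - q * a * b) * (1 - q * q * a * b))))"
  proof -
    have "X (Suc (Suc M)) k = A k / f (Suc (Suc M + k)) * ((1 - q * (q * b)) * (1 - q * b * a\<^sup>2)
       / ((1 - a * (q * b)) * (1 - q * a * (q * b))))"
      using X_Suc_left[of "Suc M" k] by (simp add: a_def b_def)
    then show ?thesis unfolding i3 Y_def by (simp only: mult_ac times_divide_eq_left times_divide_eq_right divide_divide_eq_left)
  qed
  moreover have "X M (Suc k) = Y * ((- (q + a) / (1 - q * a)) * ((1 - b) * (1 - q * a\<^sup>2 * b) / ((1 - a * b) * (1 - q * a * b))))"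
    unfolding X_Suc_right f1 A1 Y_def a_def[symmetric] b_def[symmetric]
    by (simp only: mult_ac times_divide_eq_left times_divide_eq_right divide_divide_eq_left)
  moreover have "\<gamma> (Suc M) = (1 - q * b) / (1 + q * b)" by (simp add: gam_eq b_def)
  ultimately show ?thesis
    using arg_cong[OF id, of "\<lambda>x. Y * x"] lt pos by (simp only: distrib_left mult.left_commute)
qed

text \<open>The lowest frequency of that recurrence, reached only by the downward shift on the left
  and by the series of smaller index on the right.\<close>

lemma X_edge: "X (Suc (Suc M)) 0 = \<gamma> (Suc (Suc M)) * X (Suc M) 0"
  using inverse_f_Suc[of "Suc M"] by (simp add: X_def)

text \<open>For \<open>M = 0\<close> the frequencies 1 and -1 give the same cosine, so the constant
  term of the weight is counted twice.\<close>

lemma X_corner: "2 * X (Suc 0) 0 + X (Suc 0) (Suc 0) = \<gamma> (Suc 0) * X (Suc (Suc 0)) 0"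
proof -
  have q: "1 - q > 0" "1 + q > 0" "1 - q * q > 0" "1 + q * q > 0"
    using q_pos q_less_1 q_power_less_1[of 2] by (auto simp: power2_eq_square add_pos_pos)
  have f1: "f (Suc 0) = (1 + q) / (1 - q)" and f2: "f (Suc (Suc 0)) = (1 + q) / (1 - q) * ((1 + q * q) / (1 - q * q))"
    by (simp_all add: f_Suc)
  have X11: "X (Suc 0) (Suc 0) = - ((1 - q * q) / (1 + q * q))"
    unfolding X_def using q by (simp add: f2 divide_simps) algebra
  have X10: "X (Suc 0) 0 = (1 - q) / (1 + q)" "X (Suc (Suc 0)) 0 = (1 - q) / (1 + q) * ((1 - q * q) / (1 + q * q))"
    by (simp_all add: X_def f1 f2)
  show ?thesis unfolding X11 X10 gam_eq using q by (simp add: divide_simps) algebra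
qed

lemma q_power_tendsto_0: "(\<lambda>n. q ^ n) \<longlonglongrightarrow> 0"
  using q_pos q_less_1 by (intro LIMSEQ_realpow_zero) auto

text \<open>Consecutive terms have ratio tending to \<open>q\<close> in absolute value, for every
  polynomial weight; \<open>(1 + q) / 2\<close> is a number between \<open>q\<close> and 1.\<close>

lemma A_summable: "summable (\<lambda>k. \<bar>real k ^ j * A k\<bar>)"
proof -
  define r where "r = (\<lambda>n. (1 + 1 / real n) ^ j * ((q + q ^ n) / (1 - q ^ Suc n)))"
  have "r \<longlonglongrightarrow> (1 + 0) ^ j * ((q + 0) / (1 - 0))"
    unfolding r_def
    by (intro tendsto_intros q_power_tendsto_0 LIMSEQ_Suc[OF q_power_tendsto_0] lim_1_over_n) auto
  then have "eventually (\<lambda>n. r n < (1 + q) / 2) sequentially"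
    by (rule order_tendstoD(2)) (use q_less_1 in simp)
  then obtain N where N: "\<And>n. n \<ge> N \<Longrightarrow> r n < (1 + q) / 2"
    by (auto simp: eventually_sequentially)
  show ?thesis
  proof (rule summable_ratio_test)
    show "(1 + q) / 2 < 1" using q_less_1 by simp
    fix n assume n: "n \<ge> max N 1"
    have "1 - q ^ Suc n > 0" using q_power_less_1[of "Suc n"] by simp
    moreover have "q + q ^ n > 0" using q_pos by (simp add: add_pos_pos)
    ultimately have "\<bar>A (Suc n)\<bar> = \<bar>A n\<bar> * ((q + q ^ n) / (1 - q ^ Suc n))"
      by (simp add: abs_mult)
    moreover have "real (Suc n) = real n * (1 + 1 / real n)" using n by (simp add: field_simps)
    ultimately have "\<bar>real (Suc n) ^ j * A (Suc n)\<bar> = r n * \<bar>real n ^ j * A n\<bar>"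
      by (simp only: abs_mult power_mult_distrib power_abs r_def) (simp add: abs_mult)
    also have "\<dots> \<le> (1 + q) / 2 * \<bar>real n ^ j * A n\<bar>"
      using N[of n] n by (intro mult_right_mono) auto
    finally show "norm \<bar>real (Suc n) ^ j * A (Suc n)\<bar> \<le> (1 + q) / 2 * norm \<bar>real n ^ j * A n\<bar>" by simp
  qed
qed

text \<open>The point is uniformity in \<open>m\<close>: this is the dominating sequence for the
  limits m \<rightarrow> \<infinity> below.\<close>

lemma X_bound: "\<bar>X m k\<bar> \<le> \<bar>A k\<bar> / (1 - q)\<^sup>2"
proof -
  have sq: "0 < (1 - q)\<^sup>2" "(1 - q)\<^sup>2 \<le> 1"
    using q_pos q_less_1 by (auto intro!: power_le_one)
  consider "m = 0" | "m \<ge> 1" "k = 0" | "m \<ge> 1" "k \<ge> 1" by linarith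
  then show ?thesis
  proof cases
    case 2
    have "1 / f m \<le> 1" using f_ge_1[of m] by simp
    also have "1 \<le> 1 / (1 - q)\<^sup>2" using sq by simp
    finally show ?thesis using 2 f_ge_1[of m] by (simp add: X_def)
  next
    case 3
    have d1: "1 - q \<le> 1 - q ^ (m + k - 1)" and d2: "1 - q \<le> 1 - q ^ (m + k)"
      using q_power_le_q[of "m + k - 1"] q_power_le_q[of "m + k"] 3 by auto
    have den: "(1 - q)\<^sup>2 \<le> (1 - q ^ (m + k - 1)) * (1 - q ^ (m + k))"
      unfolding power2_eq_square using d1 d2 q_less_1 by (intro mult_mono) auto
    have n: "0 \<le> (1 - q ^ m) * (1 - q ^ (m + 2 * k - 1))" "(1 - q ^ m) * (1 - q ^ (m + 2 * k - 1)) \<le> 1"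
      using q_power_le_1[of m] q_power_le_1[of "m + 2 * k - 1"] q_power_pos[of m] q_power_pos[of "m + 2 * k - 1"]
      by (auto intro!: mult_nonneg_nonneg mult_le_one)
    define Z where "Z = (1 - q ^ m) * (1 - q ^ (m + 2 * k - 1)) / ((1 - q ^ (m + k - 1)) * (1 - q ^ (m + k)))"
    have "Z \<le> 1 / (1 - q)\<^sup>2"
      unfolding Z_def by (intro frac_le) (use n den sq in auto)
    moreover have "0 \<le> Z"
      unfolding Z_def by (intro divide_nonneg_nonneg) (use n den sq in linarith)+
    moreover have "\<bar>A k / f (m + k)\<bar> \<le> \<bar>A k\<bar>"
      using f_ge_1[of "m + k"] by (simp add: field_simps mult_le_cancel_left1)
    ultimately have "\<bar>A k / f (m + k)\<bar> * \<bar>Z\<bar>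
       \<le> \<bar>A k\<bar> * (1 / (1 - q)\<^sup>2)"
      by (intro mult_mono) auto
    then show ?thesis using 3 by (simp add: X_def abs_mult Z_def)
  qed (simp add: X_def)
qed

lemma X_summable: "summable (\<lambda>k. \<bar>real k ^ j * X m k\<bar>)"
proof (rule summable_comparison_test')
  show "summable (\<lambda>k. \<bar>real k ^ j * A k\<bar> / (1 - q)\<^sup>2)"
    by (intro summable_divide A_summable)
  show "norm \<bar>real k ^ j * X m k\<bar> \<le> \<bar>real k ^ j * A k\<bar> / (1 - q)\<^sup>2" for k
    using mult_left_mono[OF X_bound[of m k], of "real k ^ j"] by (simp add: abs_mult)
qed

lemma X_summable_0: "summable (\<lambda>k. \<bar>X m k\<bar>)"
  using X_summable[of 0 m] by simp

definition \<Phi> :: "nat \<Rightarrow> real \<Rightarrow> real" where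
  "\<Phi> m \<theta> = (\<Sum>k. 2 * X m k * cos ((real m - 1 + 2 * real k) * \<theta>))"

lemma X_cos_summable: "summable (\<lambda>k. 2 * X m (k + j) * cos (y k * \<theta>))"
proof (rule summable_comparison_test')
  show "summable (\<lambda>k. 2 * \<bar>X m (k + j)\<bar>)"
    by (intro summable_mult) (rule summable_ignore_initial_segment[OF X_summable_0])
  show "norm (2 * X m (k + j) * cos (y k * \<theta>)) \<le> 2 * \<bar>X m (k + j)\<bar>" for k
    using mult_left_mono[of "\<bar>cos (y k * \<theta>)\<bar>" 1 "2 * \<bar>X m (k + j)\<bar>"] by (simp add: abs_mult)
qed

lemma \<Phi>_0: "\<Phi> 0 \<theta> = 0"
  by (simp add: \<Phi>_def X_def)

lemma \<Phi>_rec: "2 * cos \<theta> * \<Phi> (Suc M) \<theta> = \<gamma> (Suc M) * (\<Phi> (Suc (Suc M)) \<theta> + \<Phi> M \<theta>)"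
proof -
  let ?C = "\<lambda>x. cos (x * \<theta>)"
  let ?D = "\<lambda>k. ?C (real M + 1 + 2 * real k)"
  let ?S = "\<lambda>m j. \<Sum>k. 2 * X m (k + j) * ?D k"
  have sm: "summable (\<lambda>k. 2 * X m (k + j) * ?D k)" for m j by (rule X_cos_summable)
  have down: "(\<Sum>k. 2 * X m k * ?C (real M - 1 + 2 * real k)) = ?S m 1 + 2 * X m 0 * ?C (real M - 1)" for m
    using suminf_split_head[OF X_cos_summable[of m 0 "\<lambda>k. real M - 1 + 2 * real k" \<theta>]]
    by (simp add: algebra_simps)
  have prod: "2 * cos \<theta> * ?C (real (Suc M) - 1 + 2 * real k) = ?D k + ?C (real M - 1 + 2 * real k)" for k
  proof -
    have "(real M + 1 + 2 * real k) * \<theta> = (real (Suc M) - 1 + 2 * real k) * \<theta> + \<theta>"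
      "(real M - 1 + 2 * real k) * \<theta> = (real (Suc M) - 1 + 2 * real k) * \<theta> - \<theta>"
      by (simp_all add: algebra_simps)
    then show ?thesis by (simp only: cos_add cos_diff) (simp add: algebra_simps)
  qed
  have "2 * cos \<theta> * \<Phi> (Suc M) \<theta> = (\<Sum>k. 2 * cos \<theta> * (2 * X (Suc M) k * ?C (real (Suc M) - 1 + 2 * real k)))"
    unfolding \<Phi>_def using X_cos_summable[of "Suc M" 0] by (intro suminf_mult[symmetric]) simp
  also have "\<dots> = (\<Sum>k. 2 * X (Suc M) k * ?D k + 2 * X (Suc M) k * ?C (real M - 1 + 2 * real k))"
    unfolding mult.left_commute[of "2 * cos \<theta>"] prod distrib_left ..
  also have "\<dots> = ?S (Suc M) 0 + (\<Sum>k. 2 * X (Suc M) k * ?C (real M - 1 + 2 * real k))"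
    using suminf_add[OF X_cos_summable[of "Suc M" 0] X_cos_summable[of "Suc M" 0]] by simp
  finally have L: "2 * cos \<theta> * \<Phi> (Suc M) \<theta> = ?S (Suc M) 0 + ?S (Suc M) 1 + 2 * X (Suc M) 0 * ?C (real M - 1)"
    unfolding down by simp
  have R1: "\<Phi> (Suc (Suc M)) \<theta> = ?S (Suc (Suc M)) 0" by (simp add: \<Phi>_def add_ac)
  have R2: "\<Phi> M \<theta> = ?S M 1 + 2 * X M 0 * ?C (real M - 1)"
    using down[of M] by (simp add: \<Phi>_def)
  \<comment> \<open>The defect of the coefficient recurrence. By \<open>X_rec\<close> it vanishes
    except possibly at \<open>k = 0\<close>, where \<open>M = 0\<close> is the corner.\<close>
  define e where "e = (\<lambda>k. X (Suc M) k + X (Suc M) (Suc k) - \<gamma> (Suc M) * (X (Suc (Suc M)) k + X M (Suc k)))"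
  have "(\<lambda>k. (2 * X (Suc M) (k + 0) * ?D k + 2 * X (Suc M) (k + 1) * ?D k)
      - \<gamma> (Suc M) * (2 * X (Suc (Suc M)) (k + 0) * ?D k + 2 * X M (k + 1) * ?D k))
    sums (?S (Suc M) 0 + ?S (Suc M) 1 - \<gamma> (Suc M) * (?S (Suc (Suc M)) 0 + ?S M 1))"
    by (intro sums_add sums_diff sums_mult summable_sums sm)
  then have s1: "(\<lambda>k. 2 * e k * ?D k) sums (?S (Suc M) 0 + ?S (Suc M) 1 - \<gamma> (Suc M) * (?S (Suc (Suc M)) 0 + ?S M 1))"
    by (rule back_subst[of "\<lambda>x. x sums _"]) (simp add: e_def fun_eq_iff algebra_simps)
  have "e k = 0" if "k \<noteq> 0" for k
    using X_rec[of M k] that by (simp add: e_def)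
  then have "(\<lambda>k. 2 * e k * ?D k) = (\<lambda>k. if k = 0 then 2 * e 0 * ?D 0 else 0)"
    by auto
  then have s2: "(\<lambda>k. 2 * e k * ?D k) sums (2 * e 0 * ?D 0)"
    using sums_single[of 0 "\<lambda>_. 2 * e 0 * ?D 0"] by simp
  have key: "?S (Suc M) 0 + ?S (Suc M) 1 - \<gamma> (Suc M) * (?S (Suc (Suc M)) 0 + ?S M 1) = 2 * e 0 * ?D 0"
    by (rule sums_unique2[OF s1 s2])
  \<comment> \<open>For \<open>M = 0\<close> the two terms cancel since
    \<open>cos (- \<theta>) = cos \<theta>\<close>; for positive \<open>M\<close> each of them
    vanishes.\<close>
  have "2 * e 0 * ?D 0 + 2 * (X (Suc M) 0 - \<gamma> (Suc M) * X M 0) * ?C (real M - 1) = 0"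
  proof (cases M)
    case 0
    have "e 0 = - X (Suc 0) 0" using X_corner 0 by (simp add: e_def X_def[of 0])
    then show ?thesis using 0 by (simp add: X_def[of 0])
  next
    case (Suc M')
    then show ?thesis using X_rec[of M 0] X_edge[of M'] by (simp add: e_def)
  qed
  then show ?thesis unfolding L R1 R2 using key by (simp add: algebra_simps)
qed

section \<open>The weight and the orthogonality relations\<close>

abbreviation w :: "real \<Rightarrow> real" where "w \<equiv> \<Phi> (Suc 0)"

text \<open>Both sides obey the same second-order recurrence in \<open>m\<close> and agree at 0 and
  1.\<close>

lemma \<Phi>_eq: "\<Phi> m \<theta> = c m \<theta> * w \<theta>"
proof (induction m rule: p.induct)
  case (3 n)
  have "\<gamma> (Suc n) > 0" by (rule gam_pos) simp
  moreover have "\<gamma> (Suc n) * (\<Phi> (Suc (Suc n)) \<theta> + \<Phi> n \<theta>) = \<gamma> (Suc n) * (c (Suc (Suc n)) \<theta> + c n \<theta>) * w \<theta>"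
    by (simp only: \<Phi>_rec[symmetric] c_rec[symmetric]) (simp add: 3)
  ultimately show ?case using 3 by (simp add: algebra_simps)
qed (simp_all add: \<Phi>_0 c_0 c_1)

lemma \<Phi>_uniform_limit:
  "uniform_limit S (\<lambda>n \<theta>. \<Sum>k<n. 2 * X m k * cos ((real m - 1 + 2 * real k) * \<theta>)) (\<Phi> m) sequentially"
  unfolding \<Phi>_def
proof (rule Weierstrass_m_test)
  show "norm (2 * X m k * cos ((real m - 1 + 2 * real k) * \<theta>)) \<le> 2 * \<bar>X m k\<bar>" for k \<theta>
    using mult_left_mono[of "\<bar>cos ((real m - 1 + 2 * real k) * \<theta>)\<bar>" 1 "2 * \<bar>X m k\<bar>"] by (simp add: abs_mult)
  show "summable (\<lambda>k. 2 * \<bar>X m k\<bar>)" by (intro summable_mult X_summable_0)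
qed

lemma \<Phi>_continuous: "continuous_on S (\<Phi> m)"
  by (rule uniform_limit_theorem[OF _ \<Phi>_uniform_limit])
     (auto intro!: always_eventually continuous_intros)

lemma w_continuous [continuous_intros]: "continuous_on S h \<Longrightarrow> continuous_on S (\<lambda>x. w (h x))"
  using continuous_on_compose2[OF \<Phi>_continuous[of UNIV]] by auto

lemma \<Phi>_has_integral:
  assumes "m \<ge> 1"
  shows "(\<Phi> m has_integral (if m = 1 then 4 * pi * \<gamma> 1 else 0)) {-pi..pi}"
proof -
  let ?s = "\<lambda>n \<theta>. \<Sum>k<n. 2 * X m k * cos ((real m - 1 + 2 * real k) * \<theta>)"
  obtain I J where I: "\<And>n. (?s n has_integral I n) {-pi..pi}"
    and J: "(\<Phi> m has_integral J) {-pi..pi}" and IJ: "I \<longlonglongrightarrow> J"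
  proof (rule uniform_limit_integral[OF \<Phi>_uniform_limit[of m "{-pi..pi}"]])
    show "continuous_on {-pi..pi} (?s n)" for n by (intro continuous_intros)
  qed auto
  \<comment> \<open>The only frequency 0 occurs at \<open>m = 1\<close>, \<open>k = 0\<close>; it
    contributes \<open>2 * \<gamma> 1 * (2 * pi)\<close>.\<close>
  have X10: "X (Suc 0) 0 = \<gamma> 1" using inverse_f_Suc[of 0] by (simp add: X_def)
  have "I n = (if m = 1 then 4 * pi * \<gamma> 1 else 0)" if "n \<ge> 1" for n
  proof -
    have t: "((\<lambda>\<theta>. 2 * X m k * cos ((real m - 1 + 2 * real k) * \<theta>)) has_integral
        2 * X m k * (if m = 1 \<and> k = 0 then 2 * pi else 0)) {-pi..pi}" for k
    proof -
      have "((\<lambda>\<theta>. 2 * X m k * cos (real_of_int (int m - 1 + 2 * int k) * \<theta>)) has_integral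
        2 * X m k * (if int m - 1 + 2 * int k = 0 then 2 * pi else 0)) {-pi..pi}"
        by (intro has_integral_mult_right has_integral_cos_nx)
      moreover have "real_of_int (int m - 1 + 2 * int k) = real m - 1 + 2 * real k" by simp
      moreover have "(int m - 1 + 2 * int k = 0) \<longleftrightarrow> m = 1 \<and> k = 0" using assms by auto
      ultimately show ?thesis by (simp only:)
    qed
    have "(?s n has_integral (\<Sum>k<n. 2 * X m k * (if m = 1 \<and> k = 0 then 2 * pi else 0))) {-pi..pi}"
      by (intro has_integral_sum t) simp
    then have "I n = (\<Sum>k<n. 2 * X m k * (if m = 1 \<and> k = 0 then 2 * pi else 0))"
      using I has_integral_unique by blast
    also have "\<dots> = (\<Sum>k<n. if k = 0 then (if m = 1 then 4 * pi * \<gamma> 1 else 0) else 0)"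
      by (intro sum.cong refl) (auto simp: X10)
    also have "\<dots> = (if m = 1 then 4 * pi * \<gamma> 1 else 0)" using that by simp
    finally show ?thesis .
  qed
  then have "eventually (\<lambda>n. I n = (if m = 1 then 4 * pi * \<gamma> 1 else 0)) sequentially"
    unfolding eventually_sequentially by blast
  then have "I \<longlonglongrightarrow> (if m = 1 then 4 * pi * \<gamma> 1 else 0)"
    by (rule tendsto_eventually)
  then show ?thesis using J IJ LIMSEQ_unique by blast
qed

lemma c_continuous [continuous_intros]: "continuous_on S (h :: real \<Rightarrow> real) \<Longrightarrow> continuous_on S (\<lambda>x. c n (h x))"
  unfolding c_def by (auto intro!: continuous_intros)

text \<open>Induction on \<open>k\<close>: the recurrence trades index \<open>k\<close> for a factor
  \<open>cos \<theta>\<close>, which the recurrence for \<open>c m\<close> then absorbs. The case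
  \<open>k = 1\<close> is \<open>\<Phi>_has_integral\<close>.\<close>

lemma c_orthogonal:
  assumes "m \<ge> 1" "k \<ge> 1"
  shows "((\<lambda>\<theta>. c m \<theta> * c k \<theta> * w \<theta>) has_integral (if m = k then 4 * pi * \<gamma> k else 0)) {-pi..pi}"
  using assms
proof (induction k arbitrary: m rule: p.induct)
  case 1
  then show ?case by simp
next
  case 2
  have eq: "(\<lambda>\<theta>. c m \<theta> * c (Suc 0) \<theta> * w \<theta>) = \<Phi> m" by (rule ext) (simp add: \<Phi>_eq[of m] c_1)
  show ?case unfolding eq by (rule \<Phi>_has_integral[of m, unfolded One_nat_def]) (use 2 in simp)
next
  case (3 n)
  \<comment> \<open>Index 0 may be included, because \<open>\<gamma> 0 = 0\<close> makes
    \<open>h 0 0 = 0\<close> agree with \<open>c 0 = 0\<close>.\<close>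
  define h where "h = (\<lambda>m k. if m = k then 4 * pi * \<gamma> k else 0)"
  have IH: "((\<lambda>\<theta>. c m \<theta> * c j \<theta> * w \<theta>) has_integral h m j) {-pi..pi}" if "j = n \<or> j = Suc n" for m j
  proof (cases "m = 0 \<or> j = 0")
    case True
    then have "(\<lambda>\<theta>. c m \<theta> * c j \<theta> * w \<theta>) = (\<lambda>_. 0)" "h m j = 0" by (auto simp: c_0 h_def)
    then show ?thesis by simp
  next
    case False
    then have "m \<ge> 1" "j \<ge> 1" by auto
    note mj = this
    from that show ?thesis
    proof
      assume j: "j = n"
      show ?thesis unfolding h_def j by (rule "3.IH"(2)) (use mj j in auto)
    next
      assume j: "j = Suc n"
      show ?thesis unfolding h_def j by (rule "3.IH"(1)) (use mj j in auto)
    qed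
  qed
  have g: "\<gamma> (Suc n) > 0" by (rule gam_pos) simp
  obtain m' where m': "m = Suc m'" using 3 by (cases m) auto
  have "c m \<theta> * c (Suc (Suc n)) \<theta> * w \<theta> = \<gamma> m / \<gamma> (Suc n) * (c (Suc m) \<theta> * c (Suc n) \<theta> * w \<theta> + c (m - 1) \<theta> * c (Suc n) \<theta> * w \<theta>)
      - c m \<theta> * c n \<theta> * w \<theta>" for \<theta>
  proof -
    have c2: "c (Suc (Suc n)) \<theta> = 2 * cos \<theta> * c (Suc n) \<theta> / \<gamma> (Suc n) - c n \<theta>"
      using c_rec[of \<theta> n] g by (simp add: field_simps)
    have "c m \<theta> * c (Suc (Suc n)) \<theta> * w \<theta> = (2 * cos \<theta> * c m \<theta>) * (c (Suc n) \<theta> / \<gamma> (Suc n)) * w \<theta> - c m \<theta> * c n \<theta> * w \<theta>"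
      unfolding c2 by (simp add: algebra_simps)
    also have "2 * cos \<theta> * c m \<theta> = \<gamma> m * (c (Suc m) \<theta> + c (m - 1) \<theta>)"
      using c_rec[of \<theta> m'] m' by simp
    finally show ?thesis by (simp add: algebra_simps add_divide_distrib)
  qed
  moreover have "((\<lambda>\<theta>. \<gamma> m / \<gamma> (Suc n) * (c (Suc m) \<theta> * c (Suc n) \<theta> * w \<theta> + c (m - 1) \<theta> * c (Suc n) \<theta> * w \<theta>)
      - c m \<theta> * c n \<theta> * w \<theta>) has_integral
      (\<gamma> m / \<gamma> (Suc n) * (h (Suc m) (Suc n) + h (m - 1) (Suc n)) - h m n)) {-pi..pi}"
    by (intro has_integral_diff has_integral_mult_right has_integral_add IH) auto
  moreover have "\<gamma> m / \<gamma> (Suc n) * (h (Suc m) (Suc n) + h (m - 1) (Suc n)) - h m n = h m (Suc (Suc n))"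
  proof -
    consider "m = n" | "m' = Suc n" | "m \<noteq> n" "m' \<noteq> Suc n" by blast
    then show ?thesis using g by cases (simp_all add: h_def m')
  qed
  ultimately show ?case unfolding h_def by (simp only:)
qed

section \<open>The weight near the edge of the spectrum\<close>

lemma qpoch_tendsto:
  assumes "\<bar>a\<bar> < 1"
  shows "qpoch a q \<longlonglongrightarrow> qpoch_inf a q" and "qpoch_inf a q \<noteq> 0"
proof -
  have lt: "\<bar>a * q ^ k\<bar> < 1" for k
  proof -
    have "\<bar>a * q ^ k\<bar> \<le> \<bar>a\<bar> * 1"
      unfolding abs_mult using q_power_le_1[of k] q_power_pos[of k] by (intro mult_left_mono) auto
    then show ?thesis using assms by simp
  qed
  have nz: "1 - a * q ^ k \<noteq> 0" for k using lt[of k] by auto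
  have "summable (\<lambda>k. \<bar>a\<bar> * q ^ k)"
    using q_pos q_less_1 by (intro summable_mult summable_geometric) simp
  then have "convergent_prod (\<lambda>k. 1 + - (a * q ^ k))"
  proof (intro summable_imp_convergent_prod_real)
    show "- (a * q ^ k) \<noteq> - 1" for k using lt[of k] by auto
  qed (use q_pos in \<open>simp add: abs_mult\<close>)
  then have conv: "convergent_prod (\<lambda>k. 1 - a * q ^ k)" by simp
  have "(\<lambda>n. \<Prod>k<n. 1 - a * q ^ k) \<longlonglongrightarrow> qpoch_inf a q"
    unfolding qpoch_inf_def by (rule has_prod_imp_tendsto'[OF convergent_prod_has_prod[OF conv]])
  then show "qpoch a q \<longlonglongrightarrow> qpoch_inf a q"
    by (simp add: qpoch_def[abs_def])
  show "qpoch_inf a q \<noteq> 0" unfolding qpoch_inf_def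
    by (rule prodinf_nonzero[OF conv]) (use nz in blast)
qed

definition \<tau> :: real where
  "\<tau> = qpoch_inf q q / qpoch_inf (- q) q"

lemma f_tendsto: "f \<longlonglongrightarrow> 1 / \<tau>"
proof -
  have q: "\<bar>q\<bar> < 1" "\<bar>- q\<bar> < 1" using q_pos q_less_1 by auto
  have "(\<lambda>k. qpoch (- q) q k / qpoch q q k) \<longlonglongrightarrow> qpoch_inf (- q) q / qpoch_inf q q"
    by (intro tendsto_divide qpoch_tendsto[OF q(2)] qpoch_tendsto[OF q(1)])
  then show ?thesis by (simp add: f_def[abs_def] \<tau>_def)
qed

lemma \<tau>_pos: "\<tau> > 0"
proof -
  have "1 \<le> 1 / \<tau>" by (rule LIMSEQ_le_const[OF f_tendsto]) (use f_ge_1 in auto)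
  then have "0 < 1 / \<tau>" by linarith
  then show ?thesis by simp
qed

lemma f_le: "f k \<le> 1 / \<tau>"
  by (rule incseq_le[OF _ f_tendsto]) (simp add: incseq_SucI f_mono)

text \<open>The increments of \<open>f\<close> are dominated by telescoping differences. One factor
  \<open>1 - q\<close> in the constant bounds a denominator, the other turns \<open>q ^ n\<close>
  into such a difference.\<close>

lemma f_rate: "1 / \<tau> - f k \<le> 2 / \<tau> * q / (1 - q)\<^sup>2 * q ^ k"
proof -
  define C where "C = 2 / \<tau> * q / (1 - q)\<^sup>2"
  have step: "f (Suc n) - f n \<le> C * (q ^ n - q ^ Suc n)" for n
  proof -
    have d: "1 - q ^ Suc n \<ge> 1 - q" using q_power_le_q[of "Suc n"] by simp
    have nz: "1 - q ^ Suc n > 0" using q_power_less_1[of "Suc n"] by simp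
    have "f (Suc n) - f n = f n * (2 * q ^ Suc n / (1 - q ^ Suc n))"
      unfolding f_Suc using nz by (simp add: field_simps)
    also have "\<dots> \<le> 1 / \<tau> * (2 * q ^ Suc n / (1 - q))"
      using f_le[of n] f_ge_1[of n] d q_less_1 q_pos \<tau>_pos nz
      by (intro mult_mono frac_le divide_nonneg_nonneg) auto
    also have "\<dots> = C * (q ^ n - q ^ Suc n)"
    proof -
      have "q ^ n - q ^ Suc n = (1 - q) * q ^ n" by (simp add: algebra_simps)
      then show ?thesis using q_less_1 by (simp only: C_def power2_eq_square) simp
    qed
    finally show ?thesis .
  qed
  have le: "f (k + n) \<le> f k + C * (q ^ k - q ^ (k + n))" for n
  proof (induction n)
    case (Suc n)
    then show ?case using step[of "k + n"] by (simp add: algebra_simps)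
  qed simp
  have "(\<lambda>n. f (n + k)) \<longlonglongrightarrow> 1 / \<tau>"
    by (rule LIMSEQ_ignore_initial_segment[OF f_tendsto])
  moreover have "(\<lambda>n. f k + C * (q ^ k - q ^ (n + k))) \<longlonglongrightarrow> f k + C * (q ^ k - 0)"
    by (intro tendsto_intros LIMSEQ_ignore_initial_segment[OF q_power_tendsto_0])
  ultimately have "1 / \<tau> \<le> f k + C * (q ^ k - 0)"
    by (rule LIMSEQ_le) (use le in \<open>auto simp: add.commute\<close>)
  then show ?thesis by (simp add: C_def)
qed

lemma c_at_0: "c m 0 = (\<Sum>k<m. f k * f (m - 1 - k))"
  by (simp add: c_def)

lemma c_at_0_ge: "c m 0 \<ge> real m"
proof -
  have "(\<Sum>k<m. 1 * 1) \<le> (\<Sum>k<m. f k * f (m - 1 - k))"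
    by (intro sum_mono mult_mono) (use f_ge_1 order_trans[OF zero_le_one f_ge_1] in auto)
  then show ?thesis by (simp add: c_at_0)
qed

text \<open>At \<theta> = 0 the polynomial is a convolution of \<open>m\<close> products, each near
  \<open>1 / \<tau>\<^sup>2\<close> away from the two ends. The geometric rate keeps the total error
  bounded in \<open>m\<close>.\<close>

lemma c_at_0_asymp: "(\<lambda>m. c (Suc m) 0 / real (Suc m)) \<longlonglongrightarrow> 1 / \<tau>\<^sup>2"
proof -
  define F where "F = 1 / \<tau>"
  define C where "C = 2 / \<tau> * q / (1 - q)\<^sup>2"
  have F: "F > 0" using \<tau>_pos by (simp add: F_def)
  have C: "C \<ge> 0" using \<tau>_pos q_pos by (simp add: C_def)
  have rate: "F - f k \<le> C * q ^ k" for k using f_rate[of k] by (simp add: C_def F_def)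
  have geo: "(\<Sum>k<m. C * q ^ k) \<le> C / (1 - q)" for m
  proof -
    have "(\<Sum>k<m. q ^ k) \<le> 1 / (1 - q)"
      using sum_le_suminf[OF summable_geometric, of q "{..<m}"] suminf_geometric[of q] q_pos q_less_1 by simp
    from mult_left_mono[OF this C] show ?thesis by (simp add: sum_distrib_left)
  qed
  have bound: "\<bar>c m 0 - real m * F\<^sup>2\<bar> \<le> 2 * F * C / (1 - q)" for m
  proof -
    \<comment> \<open>The two sides differ by the nonnegative product
      \<open>(F - x) * (F - y)\<close>.\<close>
    have lo: "F\<^sup>2 - x * y \<le> F * (F - x) + F * (F - y)" if "x \<le> F" "y \<le> F" for x y
    proof -
      have "F * (F - x) + F * (F - y) - (F\<^sup>2 - x * y) = (F - x) * (F - y)"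
        by (simp add: power2_eq_square algebra_simps)
      then show ?thesis using that mult_nonneg_nonneg[of "F - x" "F - y"] by linarith
    qed
    have "real m * F\<^sup>2 - c m 0 = (\<Sum>k<m. F\<^sup>2 - f k * f (m - 1 - k))"
      by (simp add: c_at_0 sum_subtractf)
    also have "\<dots> \<le> (\<Sum>k<m. F * (C * q ^ k) + F * (C * q ^ (m - 1 - k)))"
    proof (rule sum_mono)
      fix k
      have "F * (F - f k) \<le> F * (C * q ^ k)" "F * (F - f (m - 1 - k)) \<le> F * (C * q ^ (m - 1 - k))"
        using rate[of k] rate[of "m - 1 - k"] F by (auto intro: mult_left_mono)
      then show "F\<^sup>2 - f k * f (m - 1 - k) \<le> F * (C * q ^ k) + F * (C * q ^ (m - 1 - k))"
        using lo[of "f k" "f (m - 1 - k)"] f_le unfolding F_def by (smt (verit))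
    qed
    also have "\<dots> = F * (\<Sum>k<m. C * q ^ k) + F * (\<Sum>k<m. C * q ^ (m - 1 - k))"
      by (simp add: sum.distrib sum_distrib_left)
    also have "(\<Sum>k<m. C * q ^ (m - 1 - k)) = (\<Sum>k<m. C * q ^ k)"
      using sum.nat_diff_reindex[of "\<lambda>k. C * q ^ k" m] by simp
    also have "F * (\<Sum>k<m. C * q ^ k) + F * (\<Sum>k<m. C * q ^ k) \<le> F * (C / (1 - q)) + F * (C / (1 - q))"
      using geo[of m] F by (intro add_mono mult_left_mono) auto
    finally have up: "real m * F\<^sup>2 - c m 0 \<le> 2 * F * C / (1 - q)" by (simp add: mult_ac)
    have "(\<Sum>k<m. f k * f (m - 1 - k)) \<le> (\<Sum>k<m. F * F)"
      using f_le f_ge_1 F unfolding F_def by (intro sum_mono mult_mono) (auto intro: order_trans[OF zero_le_one])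
    then have "c m 0 \<le> real m * F\<^sup>2" by (simp add: c_at_0 power2_eq_square)
    then show ?thesis using up by linarith
  qed
  have "(\<lambda>m. c (Suc m) 0 / real (Suc m) - F\<^sup>2) \<longlonglongrightarrow> 0"
  proof (rule Lim_null_comparison)
    show "\<forall>\<^sub>F m in sequentially. norm (c (Suc m) 0 / real (Suc m) - F\<^sup>2) \<le> 2 * F * C / (1 - q) * (1 / real (Suc m))"
    proof (rule always_eventually, rule allI)
      fix m
      have "c (Suc m) 0 / real (Suc m) - F\<^sup>2 = (c (Suc m) 0 - real (Suc m) * F\<^sup>2) * (1 / real (Suc m))"
        by (simp add: field_simps)
      then have "norm (c (Suc m) 0 / real (Suc m) - F\<^sup>2) = \<bar>c (Suc m) 0 - real (Suc m) * F\<^sup>2\<bar> * (1 / real (Suc m))"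
        by (simp add: abs_mult)
      also have "\<dots> \<le> 2 * F * C / (1 - q) * (1 / real (Suc m))"
        using bound[of "Suc m"] by (intro mult_right_mono) auto
      finally show "norm (c (Suc m) 0 / real (Suc m) - F\<^sup>2) \<le> 2 * F * C / (1 - q) * (1 / real (Suc m))" .
    qed
    have "(\<lambda>m. 2 * F * C / (1 - q) * (1 / real (Suc m))) \<longlonglongrightarrow> 2 * F * C / (1 - q) * 0"
      by (intro tendsto_intros LIMSEQ_Suc[OF lim_1_over_n])
    then show "(\<lambda>m. 2 * F * C / (1 - q) * (1 / real (Suc m))) \<longlonglongrightarrow> 0" by simp
  qed
  then have "(\<lambda>m. c (Suc m) 0 / real (Suc m)) \<longlonglongrightarrow> F\<^sup>2" by (rule LIM_zero_cancel)
  then show ?thesis by (simp add: F_def power_divide)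
qed

section \<open>Moments of the edge coefficients\<close>

lemma A_abs_summable: "summable (\<lambda>k. \<bar>A k\<bar>)"
  using A_summable[of 0] by simp

lemma A_q_summable: "summable (\<lambda>k. real k ^ j * A k * q ^ (i * k))"
proof (rule summable_comparison_test'[OF A_summable[of j]])
  show "norm (real k ^ j * A k * q ^ (i * k)) \<le> \<bar>real k ^ j * A k\<bar>" for k
    unfolding real_norm_def abs_mult[of _ "q ^ (i * k)"]
    using q_power_le_1[of "i * k"] q_power_pos[of "i * k"] by (intro mult_right_le_one_le) auto
qed

text \<open>The generating function G(z) of the sequence \<open>A\<close>, sampled at
  \<open>z = q ^ i\<close>.\<close>

definition \<phi> :: "nat \<Rightarrow> real" where
  "\<phi> i = (\<Sum>k. A k * q ^ (i * k))"

lemma \<phi>_sums: "(\<lambda>k. A k * q ^ (i * k)) sums \<phi> i"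
  using A_q_summable[of 0 i] by (simp add: \<phi>_def summable_sums)

lemma A_rec: "(1 - q ^ Suc k) * A (Suc k) = - (q + q ^ k) * A k"
  using q_power_less_1[of "Suc k"] by (simp add: field_simps)

text \<open>The q-difference equation (1 + q z) G(z) = (1 - z) G(q z) at \<open>z = q ^ i\<close>,
  obtained by summing \<open>A_rec\<close>.\<close>

lemma \<phi>_rec: "(1 + q ^ Suc i) * \<phi> i = (1 - q ^ i) * \<phi> (Suc i)"
proof -
  have "(\<lambda>k. A k * q ^ (i * k) - A k * q ^ (Suc i * k)) sums (\<phi> i - \<phi> (Suc i))"
    by (intro sums_diff \<phi>_sums)
  \<comment> \<open>The term \<open>k = 0\<close> is \<open>A 0 - A 0\<close>, so the index can be
    shifted without a remainder.\<close>
  then have "(\<lambda>k. A (Suc k) * q ^ (i * Suc k) - A (Suc k) * q ^ (Suc i * Suc k)) sums (\<phi> i - \<phi> (Suc i))"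
    by (subst sums_Suc_iff) simp
  moreover have "A (Suc k) * q ^ (i * Suc k) - A (Suc k) * q ^ (Suc i * Suc k)
     = - (q ^ i) * (q * (A k * q ^ (i * k)) + A k * q ^ (Suc i * k))" for k
  proof -
    have "A (Suc k) * q ^ (i * Suc k) - A (Suc k) * q ^ (Suc i * Suc k)
       = (1 - q ^ Suc k) * A (Suc k) * q ^ (i * Suc k)"
      by (simp only: mult_Suc power_add) (simp only: algebra_simps)
    also have "\<dots> = - (q ^ i) * (q * (A k * q ^ (i * k)) + A k * q ^ (Suc i * k))"
      unfolding A_rec mult_Suc mult_Suc_right power_add by (simp add: algebra_simps)
    finally show ?thesis .
  qed
  ultimately have "(\<lambda>k. - (q ^ i) * (q * (A k * q ^ (i * k)) + A k * q ^ (Suc i * k))) sums (\<phi> i - \<phi> (Suc i))"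
    by (simp only:)
  moreover have "(\<lambda>k. - (q ^ i) * (q * (A k * q ^ (i * k)) + A k * q ^ (Suc i * k)))
     sums (- (q ^ i) * (q * \<phi> i + \<phi> (Suc i)))"
    by (intro sums_mult sums_add \<phi>_sums)
  ultimately have "\<phi> i - \<phi> (Suc i) = - (q ^ i) * (q * \<phi> i + \<phi> (Suc i))"
    by (rule sums_unique2)
  then show ?thesis by (simp add: algebra_simps)
qed

lemma \<phi>_0: "\<phi> 0 = 0"
  using \<phi>_rec[of 0] q_pos by simp

text \<open>This is G(0) = \<open>A 0\<close>, reached by dominated convergence since
  \<open>q ^ (i * k)\<close> tends to 0 for positive \<open>k\<close>.\<close>

lemma \<phi>_tendsto: "\<phi> \<longlonglongrightarrow> 1"
proof -
  have "((\<lambda>i. \<Sum>k. A k * q ^ (i * k)) \<longlongrightarrow> (\<Sum>k. if k = 0 then 1 else 0)) sequentially"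
  proof (rule conjunct2[OF conjunct2[OF tannerys_theorem]])
    show "(\<lambda>i. A k * q ^ (i * k)) \<longlonglongrightarrow> (if k = 0 then 1 else 0)" for k
    proof (cases "k = 0")
      case False
      have "(\<lambda>i. (q ^ k) ^ i) \<longlonglongrightarrow> 0"
        using q_power_less_1[of k] q_power_pos[of k] False by (intro LIMSEQ_realpow_zero) auto
      from tendsto_mult_left[OF this, of "A k"] show ?thesis
        using False by (simp add: power_mult[symmetric] mult.commute)
    qed simp
    show "\<forall>\<^sub>F (k, i) in at_top \<times>\<^sub>F sequentially. norm (A k * q ^ (i * k)) \<le> \<bar>A k\<bar>"
    proof (rule always_eventually, clarify)
      fix k i
      show "norm (A k * q ^ (i * k)) \<le> \<bar>A k\<bar>"
        unfolding real_norm_def abs_mult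
        using q_power_le_1[of "i * k"] q_power_pos[of "i * k"] by (intro mult_right_le_one_le) auto
    qed
  qed (use A_abs_summable in auto)
  moreover have "(\<Sum>k. if k = 0 then 1 else 0 :: real) = 1"
    using sums_single[of 0 "\<lambda>_. 1 :: real"] by (simp add: sums_iff)
  ultimately show ?thesis by (simp add: \<phi>_def[abs_def])
qed

text \<open>Iterating the q-difference equation from \<open>q\<close> towards 0 gives G(q) as an
  infinite product. The denominator product starts at \<open>1 + q\<^sup>2\<close>, whence the extra
  factor \<open>1 + q\<close>.\<close>

lemma \<phi>_1: "\<phi> (Suc 0) = (1 + q) * \<tau>"
proof -
  have q: "\<bar>q\<bar> < 1" "\<bar>- q\<bar> < 1" using q_pos q_less_1 by auto
  have eq: "\<phi> (Suc 0) * qpoch (- q) q (Suc N) = (1 + q) * (qpoch q q N * \<phi> (Suc N))" for N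
  proof (induction N)
    case (Suc N)
    have "\<phi> (Suc 0) * qpoch (- q) q (Suc (Suc N)) = \<phi> (Suc 0) * qpoch (- q) q (Suc N) * (1 + q ^ Suc (Suc N))"
      by (simp add: qpoch_def)
    also have "\<dots> = (1 + q) * (qpoch q q N * ((1 + q ^ Suc (Suc N)) * \<phi> (Suc N)))"
      unfolding Suc by (simp only: mult_ac)
    also have "\<dots> = (1 + q) * (qpoch q q (Suc N) * \<phi> (Suc (Suc N)))"
      unfolding \<phi>_rec by (simp add: qpoch_def)
    finally show ?case .
  qed (simp add: qpoch_def)
  have lim1: "(\<lambda>N. \<phi> (Suc 0) * qpoch (- q) q (Suc N)) \<longlonglongrightarrow> \<phi> (Suc 0) * qpoch_inf (- q) q"
    by (intro tendsto_intros LIMSEQ_Suc[OF qpoch_tendsto(1)[OF q(2)]])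
  have lim2: "(\<lambda>N. (1 + q) * (qpoch q q N * \<phi> (Suc N))) \<longlonglongrightarrow> (1 + q) * (qpoch_inf q q * 1)"
    by (intro tendsto_intros qpoch_tendsto(1)[OF q(1)] LIMSEQ_Suc[OF \<phi>_tendsto])
  have "\<phi> (Suc 0) * qpoch_inf (- q) q = (1 + q) * (qpoch_inf q q * 1)"
    by (rule LIMSEQ_unique[OF lim1[unfolded eq] lim2])
  then show ?thesis using qpoch_tendsto(2)[OF q(2)] by (simp add: \<tau>_def field_simps)
qed

text \<open>The sum is G'(1). Differentiating the q-difference equation at z = 1 and using G(1) = 0
  gives (1 + q) G'(1) = - G(q); the proof does this on the coefficients.\<close>

lemma A_first_moment: "(\<Sum>k. real k * A k) = - \<tau>"
proof -
  define \<psi> where "\<psi> = (\<lambda>i. \<Sum>k. real k * A k * q ^ (i * k))"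
  have s: "(\<lambda>k. real k * A k * q ^ (i * k)) sums \<psi> i" for i
    unfolding \<psi>_def using A_q_summable[of 1 i] by (simp add: summable_sums)
  have "(\<lambda>k. real k * A k * q ^ (0 * k) - real k * A k * q ^ (1 * k)) sums (\<psi> 0 - \<psi> 1)"
    by (intro sums_diff s)
  then have "(\<lambda>k. real (Suc k) * A (Suc k) * q ^ (0 * Suc k) - real (Suc k) * A (Suc k) * q ^ (1 * Suc k)) sums (\<psi> 0 - \<psi> 1)"
    by (subst sums_Suc_iff) simp
  moreover have "real (Suc k) * A (Suc k) * q ^ (0 * Suc k) - real (Suc k) * A (Suc k) * q ^ (1 * Suc k)
     = - (q * (real k * A k * q ^ (0 * k)) + q * (A k * q ^ (0 * k)) + real k * A k * q ^ (1 * k) + A k * q ^ (1 * k))" for k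
  proof -
    have "real (Suc k) * A (Suc k) * q ^ (0 * Suc k) - real (Suc k) * A (Suc k) * q ^ (1 * Suc k)
       = real (Suc k) * ((1 - q ^ Suc k) * A (Suc k))"
      by (simp only: mult_0 power_0 mult_1) (simp only: algebra_simps mult_1_right mult_1)
    also have "\<dots> = real (Suc k) * (- (q + q ^ k) * A k)" by (simp only: A_rec)
    finally show ?thesis by (simp add: algebra_simps)
  qed
  ultimately have "(\<lambda>k. - (q * (real k * A k * q ^ (0 * k)) + q * (A k * q ^ (0 * k)) + real k * A k * q ^ (1 * k) + A k * q ^ (1 * k)))
      sums (\<psi> 0 - \<psi> 1)" by (simp only:)
  moreover have "(\<lambda>k. - (q * (real k * A k * q ^ (0 * k)) + q * (A k * q ^ (0 * k)) + real k * A k * q ^ (1 * k) + A k * q ^ (1 * k)))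
      sums (- (q * \<psi> 0 + q * \<phi> 0 + \<psi> 1 + \<phi> 1))"
    by (intro sums_minus sums_add sums_mult s \<phi>_sums)
  ultimately have "\<psi> 0 - \<psi> 1 = - (q * \<psi> 0 + q * \<phi> 0 + \<psi> 1 + \<phi> 1)" by (rule sums_unique2)
  then have "(1 + q) * \<psi> 0 = - \<phi> (Suc 0)" by (simp add: \<phi>_0 algebra_simps)
  then have "(1 + q) * \<psi> 0 = (1 + q) * (- \<tau>)" by (simp add: \<phi>_1)
  moreover have "1 + q \<noteq> 0" using q_pos by simp
  ultimately have "\<psi> 0 = - \<tau>" using mult_left_cancel[of "1 + q" "\<psi> 0" "- \<tau>"] by blast
  then show ?thesis by (simp add: \<psi>_def)
qed

section \<open>Second-order behaviour of the series at angle zero\<close>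

lemma X_poly_summable: "summable (\<lambda>k. \<bar>X m k * (real m - 1 + 2 * real k) ^ j\<bar>)"
proof (rule summable_comparison_test')
  show "summable (\<lambda>k. (real m + 3) ^ j * (\<bar>X m k\<bar> + \<bar>real k ^ j * X m k\<bar>))"
    by (intro summable_mult summable_add X_summable X_summable_0)
  fix k
  have "\<bar>real m - 1 + 2 * real k\<bar> ^ j \<le> (real m + 3) ^ j * (1 + real k ^ j)"
  proof (cases "k = 0")
    case True
    have "\<bar>real m - 1\<bar> ^ j \<le> (real m + 3) ^ j" by (rule power_mono) auto
    moreover have "(real m + 3) ^ j \<le> (real m + 3) ^ j * (1 + 0 ^ j)" by simp
    ultimately have "\<bar>real m - 1\<bar> ^ j \<le> (real m + 3) ^ j * (1 + 0 ^ j)" by (rule order_trans)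
    then show ?thesis using True by simp
  next
    case False
    then have k1: "real k \<ge> 1" by simp
    have "(real m + 3) * real k \<ge> \<bar>real m - 1 + 2 * real k\<bar>"
      using k1 mult_left_mono[of 1 "real k" "real m"] by (simp add: algebra_simps abs_le_iff)
    then have "\<bar>real m - 1 + 2 * real k\<bar> ^ j \<le> ((real m + 3) * real k) ^ j"
      by (rule power_mono) simp
    also have "\<dots> \<le> (real m + 3) ^ j * (1 + real k ^ j)"
      by (simp only: power_mult_distrib distrib_left) simp
    finally show ?thesis .
  qed
  from mult_left_mono[OF this, of "\<bar>X m k\<bar>"]
  show "norm \<bar>X m k * (real m - 1 + 2 * real k) ^ j\<bar> \<le> (real m + 3) ^ j * (\<bar>X m k\<bar> + \<bar>real k ^ j * X m k\<bar>)"
    by (simp add: abs_mult power_abs algebra_simps)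
qed

text \<open>\<open>- Q m\<close> is the coefficient of \<open>\<theta>\<^sup>2\<close> in the
  expansion of \<open>\<Phi> m\<close> at 0.\<close>

definition Q :: "nat \<Rightarrow> real" where
  "Q m = (\<Sum>k. X m k * (real m - 1 + 2 * real k)\<^sup>2)"

text \<open>The Taylor bound for the cosine holds on the whole line, so it can be summed against the
  fourth moment of the frequencies.\<close>

lemma \<Phi>_quadratic:
  obtains E where "\<And>\<theta>. \<bar>\<Phi> m \<theta> - \<Phi> m 0 + \<theta>\<^sup>2 * Q m\<bar> \<le> E * \<theta> ^ 4"
proof
  let ?y = "\<lambda>k. real m - 1 + 2 * real k"
  let ?E = "\<Sum>k. 1 / 12 * \<bar>X m k * ?y k ^ 4\<bar>"
  fix \<theta>
  let ?d = "\<lambda>k. 2 * X m k * cos (?y k * \<theta>) - 2 * X m k * cos (?y k * 0) + \<theta>\<^sup>2 * (X m k * (?y k)\<^sup>2)"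
  have sQ: "summable (\<lambda>k. X m k * (?y k)\<^sup>2)"
    by (rule summable_rabs_cancel[OF X_poly_summable])
  have s: "?d sums (\<Phi> m \<theta> - \<Phi> m 0 + \<theta>\<^sup>2 * Q m)"
    unfolding \<Phi>_def Q_def
    using X_cos_summable[of m 0 ?y \<theta>] X_cos_summable[of m 0 ?y 0]
    by (intro sums_add sums_diff sums_mult summable_sums sQ) simp_all
  have le: "\<bar>?d k\<bar> \<le> \<theta> ^ 4 * (1 / 12 * \<bar>X m k * ?y k ^ 4\<bar>)" for k
  proof -
    have "?d k = 2 * X m k * (cos (?y k * \<theta>) - 1 + (?y k * \<theta>)\<^sup>2 / 2)"
    proof -
      have "2 * x * cos (y * \<theta>) - 2 * x * cos (y * 0) + \<theta>\<^sup>2 * (x * y\<^sup>2)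
          = 2 * x * (cos (y * \<theta>) - 1 + (y * \<theta>)\<^sup>2 / 2)" for x y
        by (simp add: algebra_simps power_mult_distrib)
      then show ?thesis .
    qed
    then have "\<bar>?d k\<bar> = 2 * \<bar>X m k\<bar> * \<bar>cos (?y k * \<theta>) - 1 + (?y k * \<theta>)\<^sup>2 / 2\<bar>"
      by (simp only: abs_mult abs_numeral)
    also have "\<dots> \<le> 2 * \<bar>X m k\<bar> * ((?y k * \<theta>) ^ 4 / 24)"
      by (intro mult_left_mono cos_quadratic_bound) simp
    also have "\<dots> = \<theta> ^ 4 * (1 / 12 * \<bar>X m k * ?y k ^ 4\<bar>)"
      by (simp add: power_mult_distrib abs_mult)
    finally show ?thesis .
  qed
  have sE: "summable (\<lambda>k. 1 / 12 * \<bar>X m k * ?y k ^ 4\<bar>)"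
    by (intro summable_mult X_poly_summable)
  have sa: "summable (\<lambda>k. \<bar>?d k\<bar>)"
    by (rule summable_comparison_test'[OF summable_mult[OF sE, of "\<theta> ^ 4"]]) (use le in simp)
  have "\<bar>\<Sum>k. ?d k\<bar> \<le> (\<Sum>k. \<bar>?d k\<bar>)" by (rule summable_rabs[OF sa])
  also have "\<dots> \<le> (\<Sum>k. \<theta> ^ 4 * (1 / 12 * \<bar>X m k * ?y k ^ 4\<bar>))"
    by (rule suminf_le[OF le sa summable_mult[OF sE]])
  also have "\<dots> = \<theta> ^ 4 * ?E" by (rule suminf_mult[OF sE])
  finally show "\<bar>\<Phi> m \<theta> - \<Phi> m 0 + \<theta>\<^sup>2 * Q m\<bar> \<le> ?E * \<theta> ^ 4"
    using sums_unique[OF s] by (simp add: mult.commute)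
qed

text \<open>By \<open>X_bound\<close> the values \<open>\<Phi> m 0 = c m 0 * w 0\<close> are bounded
  in \<open>m\<close>, whereas \<open>c m 0\<close> is at least \<open>m\<close>.\<close>

lemma w_at_0: "w 0 = 0"
proof (rule ccontr)
  assume nz: "w 0 \<noteq> 0"
  define Bd where "Bd = (\<Sum>k. 2 * (\<bar>A k\<bar> / (1 - q)\<^sup>2))"
  have sB: "summable (\<lambda>k. 2 * (\<bar>A k\<bar> / (1 - q)\<^sup>2))"
    by (intro summable_mult summable_divide A_abs_summable)
  have bd: "\<bar>\<Phi> m 0\<bar> \<le> Bd" for m
  proof -
    have sa: "summable (\<lambda>k. \<bar>2 * X m k * cos ((real m - 1 + 2 * real k) * 0)\<bar>)"
      using summable_mult[OF X_summable_0, of 2 m] by (simp add: abs_mult)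
    have "\<bar>\<Phi> m 0\<bar> \<le> (\<Sum>k. \<bar>2 * X m k * cos ((real m - 1 + 2 * real k) * 0)\<bar>)"
      unfolding \<Phi>_def by (rule summable_rabs[OF sa])
    also have "\<dots> \<le> Bd" unfolding Bd_def
    proof (rule suminf_le[OF _ sa sB])
      show "\<bar>2 * X m k * cos ((real m - 1 + 2 * real k) * 0)\<bar> \<le> 2 * (\<bar>A k\<bar> / (1 - q)\<^sup>2)" for k
        using mult_left_mono[OF X_bound[of m k], of 2] by (simp add: abs_mult)
    qed
    finally show ?thesis .
  qed
  obtain m where m: "Bd < real m * \<bar>w 0\<bar>"
    using reals_Archimedean3[of "\<bar>w 0\<bar>"] nz by auto
  have "real m * \<bar>w 0\<bar> \<le> \<bar>c m 0\<bar> * \<bar>w 0\<bar>"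
    using c_at_0_ge[of m] by (intro mult_right_mono) auto
  also have "\<dots> = \<bar>\<Phi> m 0\<bar>" by (simp add: \<Phi>_eq[of m] abs_mult)
  finally show False using bd[of m] m by linarith
qed

lemma \<Phi>_at_0: "\<Phi> m 0 = 0"
  using \<Phi>_eq[of m 0] w_at_0 by simp

lemma \<Phi>_quadratic_limit: "((\<lambda>\<theta>. \<Phi> m \<theta> / \<theta>\<^sup>2) \<longlongrightarrow> - Q m) (at 0)"
proof -
  obtain E where E: "\<And>\<theta>. \<bar>\<Phi> m \<theta> - \<Phi> m 0 + \<theta>\<^sup>2 * Q m\<bar> \<le> E * \<theta> ^ 4"
    using \<Phi>_quadratic by blast
  have "((\<lambda>\<theta>. \<Phi> m \<theta> / \<theta>\<^sup>2 - (- Q m)) \<longlongrightarrow> 0) (at 0)"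
  proof (rule Lim_null_comparison)
    show "\<forall>\<^sub>F \<theta> in at 0. norm (\<Phi> m \<theta> / \<theta>\<^sup>2 - - Q m) \<le> E * \<theta>\<^sup>2"
      unfolding eventually_at_filter
    proof (rule always_eventually, intro allI impI)
      fix \<theta> :: real assume "\<theta> \<noteq> 0"
      then have "\<Phi> m \<theta> / \<theta>\<^sup>2 - - Q m = (\<Phi> m \<theta> + \<theta>\<^sup>2 * Q m) / \<theta>\<^sup>2"
        by (simp add: field_simps)
      then have "norm (\<Phi> m \<theta> / \<theta>\<^sup>2 - - Q m) = \<bar>\<Phi> m \<theta> + \<theta>\<^sup>2 * Q m\<bar> / \<theta>\<^sup>2"
        by simp
      also have "\<dots> \<le> E * \<theta> ^ 4 / \<theta>\<^sup>2"
        using E[of \<theta>] by (intro divide_right_mono) (auto simp: \<Phi>_at_0)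
      also have "\<dots> = E * \<theta>\<^sup>2" using \<open>\<theta> \<noteq> 0\<close> by (simp add: power4_eq_xxxx power2_eq_square)
      finally show "norm (\<Phi> m \<theta> / \<theta>\<^sup>2 - - Q m) \<le> E * \<theta>\<^sup>2" .
    qed
    have "((\<lambda>\<theta>. E * \<theta>\<^sup>2) \<longlongrightarrow> E * 0\<^sup>2) (at 0)" by (intro tendsto_intros)
    then show "((\<lambda>\<theta>. E * \<theta>\<^sup>2) \<longlongrightarrow> 0) (at 0)" by simp
  qed
  then show ?thesis by (rule LIM_zero_cancel)
qed

text \<open>Compare the coefficients of \<open>\<theta>\<^sup>2\<close> in
  \<open>\<Phi> m = c m * w\<close>; since \<open>w\<close> vanishes to second order, only
  \<open>c m 0\<close> enters.\<close>

lemma Q_eq: "Q m = c m 0 * Q (Suc 0)"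
proof -
  have "isCont (c m) 0"
    using c_continuous[of UNIV "\<lambda>x. x" m] by (simp add: continuous_on_eq_continuous_at)
  then have "(c m \<longlongrightarrow> c m 0) (at 0)" by (simp add: isCont_def)
  from tendsto_mult[OF this \<Phi>_quadratic_limit[of "Suc 0"]]
  have "((\<lambda>\<theta>. \<Phi> m \<theta> / \<theta>\<^sup>2) \<longlongrightarrow> c m 0 * - Q (Suc 0)) (at 0)"
    by (simp add: \<Phi>_eq[of m])
  then have "c m 0 * - Q (Suc 0) = - Q m"
    using tendsto_unique[OF _ _ \<Phi>_quadratic_limit[of m]] by simp
  then show ?thesis by simp
qed

lemma X_tendsto:
  assumes "k \<ge> 1"
  shows "(\<lambda>M. X (Suc M) k) \<longlonglongrightarrow> A k * \<tau>"
proof -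
  have q0: "(\<lambda>M. q ^ (M + j)) \<longlonglongrightarrow> 0" for j
    by (rule LIMSEQ_ignore_initial_segment[OF q_power_tendsto_0])
  have f0: "(\<lambda>M. f (M + j)) \<longlonglongrightarrow> 1 / \<tau>" for j
    by (rule LIMSEQ_ignore_initial_segment[OF f_tendsto])
  have "(\<lambda>M. A k / f (M + Suc k) * ((1 - q ^ (M + 1)) * (1 - q ^ (M + 2 * k)) / ((1 - q ^ (M + k)) * (1 - q ^ (M + Suc k)))))
      \<longlonglongrightarrow> A k / (1 / \<tau>) * ((1 - 0) * (1 - 0) / ((1 - 0) * (1 - 0)))"
    by (intro tendsto_intros q0 f0) (use \<tau>_pos in auto)
  moreover have "X (Suc M) k = A k / f (M + Suc k) * ((1 - q ^ (M + 1)) * (1 - q ^ (M + 2 * k)) / ((1 - q ^ (M + k)) * (1 - q ^ (M + Suc k))))" for M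
    using assms by (simp add: X_def)
  ultimately show ?thesis by simp
qed

text \<open>Dominated convergence by \<open>X_bound\<close>; for \<open>j \<ge> 1\<close> the term
  \<open>k = 0\<close>, outside the range of \<open>X_tendsto\<close>, is zero.\<close>

lemma X_moment_tendsto:
  assumes "j \<ge> 1"
  shows "(\<lambda>M. \<Sum>k. real k ^ j * X (Suc M) k) \<longlonglongrightarrow> (\<Sum>k. real k ^ j * (A k * \<tau>))"
proof (rule conjunct2[OF conjunct2[OF tannerys_theorem]])
  show "(\<lambda>M. real k ^ j * X (Suc M) k) \<longlonglongrightarrow> real k ^ j * (A k * \<tau>)" for k
    using X_tendsto[of k] assms by (cases "k = 0") (auto intro: tendsto_mult_left simp: power_0_left)
  show "\<forall>\<^sub>F (k, M) in at_top \<times>\<^sub>F sequentially. norm (real k ^ j * X (Suc M) k) \<le> \<bar>real k ^ j * A k\<bar> / (1 - q)\<^sup>2"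
  proof (rule always_eventually, clarify)
    fix k M
    show "norm (real k ^ j * X (Suc M) k) \<le> \<bar>real k ^ j * A k\<bar> / (1 - q)\<^sup>2"
      using mult_left_mono[OF X_bound[of "Suc M" k], of "real k ^ j"] by (simp add: abs_mult)
  qed
  show "summable (\<lambda>k. \<bar>real k ^ j * A k\<bar> / (1 - q)\<^sup>2)"
    by (intro summable_divide A_summable)
qed simp

text \<open>Expand \<open>(M + 2 k)\<^sup>2\<close>; the quadratic term in \<open>M\<close> drops
  out because the coefficients sum to \<open>\<Phi> (Suc M) 0 / 2 = 0\<close>. The remaining growth
  is linear, like that of \<open>c (Suc M) 0\<close>.\<close>

lemma Q_expand: "Q (Suc M) = 4 * real M * (\<Sum>k. real k * X (Suc M) k) + 4 * (\<Sum>k. (real k)\<^sup>2 * X (Suc M) k)"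
proof -
  have s: "summable (\<lambda>k. real k ^ j * X (Suc M) k)" for j
    by (rule summable_rabs_cancel[OF X_summable])
  have s0: "summable (\<lambda>k. X (Suc M) k)" using s[of 0] by simp
  have s1: "summable (\<lambda>k. real k * X (Suc M) k)" using s[of 1] by simp
  have "(\<lambda>k. (real M)\<^sup>2 * X (Suc M) k + (4 * real M * (real k * X (Suc M) k) + 4 * ((real k)\<^sup>2 * X (Suc M) k)))
     sums ((real M)\<^sup>2 * (\<Sum>k. X (Suc M) k) + (4 * real M * (\<Sum>k. real k * X (Suc M) k) + 4 * (\<Sum>k. (real k)\<^sup>2 * X (Suc M) k)))"
    by (intro sums_add sums_mult summable_sums s s0 s1)
  moreover have "(\<Sum>k. X (Suc M) k) = 0"
  proof -
    have "\<Phi> (Suc M) 0 = 2 * (\<Sum>k. X (Suc M) k)"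
      using suminf_mult[OF s0, of 2] by (simp add: \<Phi>_def)
    then show ?thesis using \<Phi>_at_0 by simp
  qed
  moreover have "X (Suc M) k * (real (Suc M) - 1 + 2 * real k)\<^sup>2 =
     (real M)\<^sup>2 * X (Suc M) k + (4 * real M * (real k * X (Suc M) k) + 4 * ((real k)\<^sup>2 * X (Suc M) k))" for k
    by (simp add: power2_eq_square algebra_simps)
  ultimately show ?thesis unfolding Q_def by (simp add: sums_iff)
qed

text \<open>Divide \<open>Q (Suc M) = c (Suc M) 0 * Q 1\<close> by \<open>Suc M\<close> and let
  \<open>M\<close> grow: the left side tends to \<open>- 4 * \<tau>\<^sup>2\<close> by the first
  moment of \<open>A\<close>, the right side to \<open>Q 1 / \<tau>\<^sup>2\<close>.\<close>

lemma Q_1: "Q (Suc 0) = - 4 * \<tau> ^ 4"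
proof -
  have S1: "(\<lambda>M. \<Sum>k. real k * X (Suc M) k) \<longlonglongrightarrow> - \<tau>\<^sup>2"
  proof -
    have "(\<Sum>k. real k ^ 1 * (A k * \<tau>)) = (\<Sum>k. real k * A k * \<tau>)" by (simp add: mult.assoc)
    also have "\<dots> = - \<tau> * \<tau>"
      using suminf_mult2[of "\<lambda>k. real k * A k" \<tau>] summable_rabs_cancel[OF A_summable[of 1]] A_first_moment by simp
    finally show ?thesis using X_moment_tendsto[of 1] by (simp add: power2_eq_square)
  qed
  have S2: "(\<lambda>M. \<Sum>k. (real k)\<^sup>2 * X (Suc M) k) \<longlonglongrightarrow> (\<Sum>k. (real k)\<^sup>2 * (A k * \<tau>))"
    using X_moment_tendsto[of 2] by simp
  have r: "(\<lambda>M. real M / real (Suc M)) \<longlonglongrightarrow> 1" by (rule LIMSEQ_n_over_Suc_n)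
  have i: "(\<lambda>M. 1 / real (Suc M)) \<longlonglongrightarrow> 0" by (rule LIMSEQ_Suc[OF lim_1_over_n])
  have "(\<lambda>M. 4 * (real M / real (Suc M)) * (\<Sum>k. real k * X (Suc M) k) + 4 * (\<Sum>k. (real k)\<^sup>2 * X (Suc M) k) * (1 / real (Suc M)))
     \<longlonglongrightarrow> 4 * 1 * (- \<tau>\<^sup>2) + 4 * (\<Sum>k. (real k)\<^sup>2 * (A k * \<tau>)) * 0"
    by (intro tendsto_intros S1 S2 r i)
  moreover have "4 * (real M / real (Suc M)) * (\<Sum>k. real k * X (Suc M) k) + 4 * (\<Sum>k. (real k)\<^sup>2 * X (Suc M) k) * (1 / real (Suc M))
     = c (Suc M) 0 / real (Suc M) * Q (Suc 0)" for M
  proof -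
    have "c (Suc M) 0 / real (Suc M) * Q (Suc 0) = Q (Suc M) / real (Suc M)"
      using Q_eq[of "Suc M"] by simp
    then show ?thesis unfolding Q_expand[of M] by (simp add: add_divide_distrib)
  qed
  ultimately have "(\<lambda>M. c (Suc M) 0 / real (Suc M) * Q (Suc 0)) \<longlonglongrightarrow> - 4 * \<tau>\<^sup>2" by simp
  moreover have "(\<lambda>M. c (Suc M) 0 / real (Suc M) * Q (Suc 0)) \<longlonglongrightarrow> 1 / \<tau>\<^sup>2 * Q (Suc 0)"
    by (intro tendsto_mult_right c_at_0_asymp)
  ultimately have "- 4 * \<tau>\<^sup>2 = 1 / \<tau>\<^sup>2 * Q (Suc 0)" by (rule LIMSEQ_unique)
  then show ?thesis using \<tau>_pos by (simp add: field_simps power4_eq_xxxx power2_eq_square)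
qed

lemma w_local:
  obtains E where "\<And>\<theta>. \<bar>w \<theta> - 4 * \<tau> ^ 4 * \<theta>\<^sup>2\<bar> \<le> E * \<theta> ^ 4"
proof -
  obtain E where E: "\<And>\<theta>. \<bar>w \<theta> - w 0 + \<theta>\<^sup>2 * Q (Suc 0)\<bar> \<le> E * \<theta> ^ 4"
    using \<Phi>_quadratic by blast
  show thesis by (rule that[of E]) (use E in \<open>simp add: w_at_0 Q_1 mult_ac\<close>)
qed

section \<open>Gaussian comparison\<close>

abbreviation W :: real where "W \<equiv> 4 * \<tau> ^ 4"

text \<open>Three errors share one Gaussian majorant: the quartic remainder of \<open>w\<close>, the
  replacement of \<open>1 - cos x\<close> by \<open>x\<^sup>2 / 2\<close> in the power and in the
  exponential, and the Gaussian outside \<open>[-pi, pi]\<close>.\<close>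

lemma moment_integrand_bound:
  obtains C where "C \<ge> 0" and "\<And>t x. t > 0 \<Longrightarrow>
    \<bar>indicator {-pi..pi} x * ((1 - cos x) ^ j * exp (- t * (1 - cos x)) * w x)
       - W * (x\<^sup>2 * (x\<^sup>2 / 2) ^ j * exp (- t * (x\<^sup>2 / 2)))\<bar>
    \<le> C * ((x ^ (2 * (j + 2)) + t * x ^ (2 * (j + 3))) * exp (- (t / 12) * x\<^sup>2))"
proof -
  obtain E where E: "\<And>\<theta>. \<bar>w \<theta> - W * \<theta>\<^sup>2\<bar> \<le> E * \<theta> ^ 4"
    using w_local by blast
  have E0: "E \<ge> 0" using E[of 1] by simp
  have W0: "W \<ge> 0" by simp
  \<comment> \<open>\<open>E\<close> pays for the weight, \<open>W * j\<close> for the power, and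
    the last \<open>W\<close> for the exponential or for the part outside the interval.\<close>
  define C where "C = E + W * (real j + 1)"
  have C0: "C \<ge> 0" using E0 by (simp add: C_def)
  show thesis
  proof (rule that[OF C0])
    fix t x :: real assume t: "t > 0"
    define z where "z = x\<^sup>2 / 2" define y where "y = 1 - cos x"
    define e where "e = exp (- (t / 12) * x\<^sup>2)"
    have z0: "z \<ge> 0" "z \<le> x\<^sup>2" by (simp_all add: z_def)
    have zj: "z ^ j \<le> x ^ (2 * j)" using power_mono[OF z0(2,1), of j] by (simp add: power_mult)
    have p: "x\<^sup>2 * x ^ (2 * j + 2) = x ^ (2 * (j + 2))" "x\<^sup>2 * (x ^ (2 * j) * x ^ 4) = x ^ (2 * (j + 3))"
      "x ^ (2 * j) * x ^ 4 = x ^ (2 * (j + 2))"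
      unfolding power_add[symmetric] by (rule arg_cong[of _ _ "\<lambda>n. x ^ n"], simp)+
    have P0: "0 \<le> x ^ (2 * (j + 2))" "0 \<le> t * x ^ (2 * (j + 3))"
      by (rule zero_le_even_power') (rule mult_nonneg_nonneg[OF less_imp_le[OF t] zero_le_even_power'])
    have ez: "exp (- t * z) \<le> e" unfolding e_def z_def using t by (simp add: field_simps)
    have e0: "e > 0" by (simp add: e_def)
    show "\<bar>indicator {-pi..pi} x * ((1 - cos x) ^ j * exp (- t * (1 - cos x)) * w x)
       - W * (x\<^sup>2 * (x\<^sup>2 / 2) ^ j * exp (- t * (x\<^sup>2 / 2)))\<bar>
      \<le> C * ((x ^ (2 * (j + 2)) + t * x ^ (2 * (j + 3))) * exp (- (t / 12) * x\<^sup>2))"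
    proof (cases "\<bar>x\<bar> \<le> pi")
      case True
      then have ind: "indicator {-pi..pi} x = (1 :: real)" by (auto simp: abs_le_iff)
      have y: "0 \<le> y" "y \<le> z" "z - y \<le> x ^ 4" "x\<^sup>2 / 12 \<le> y"
        using one_minus_cos_bounds[of x] True zero_le_even_power[of 4 x] unfolding y_def z_def by auto
      have ye: "exp (- t * y) \<le> e"
        using mult_left_mono[OF y(4), of t] t unfolding e_def by (simp add: field_simps)
      have yj: "y ^ j \<le> x ^ (2 * j)" using power_mono[OF y(2,1), of j] zj by simp
      have first: "\<bar>y ^ j * exp (- t * y) * (w x - W * x\<^sup>2)\<bar> \<le> E * x ^ (2 * (j + 2)) * e"
      proof -
        have "\<bar>y ^ j * exp (- t * y) * (w x - W * x\<^sup>2)\<bar> = y ^ j * exp (- t * y) * \<bar>w x - W * x\<^sup>2\<bar>"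
          using y(1) by (simp add: abs_mult)
        also have "\<dots> \<le> x ^ (2 * j) * e * (E * x ^ 4)"
          using y(1) yj ye e0 E[of x] by (intro mult_mono mult_nonneg_nonneg zero_le_even_power) auto
        also have "\<dots> = E * (x ^ (2 * j) * x ^ 4) * e" by (simp only: mult_ac)
        finally show ?thesis unfolding p .
      qed
      have second: "\<bar>y ^ j * exp (- t * y) - z ^ j * exp (- t * z)\<bar>
          \<le> (real j * x ^ (2 * j + 2) + t * (x ^ (2 * j) * x ^ 4)) * e"
      proof -
        have "exp (- t * z) = exp (- t * y) * exp (- (t * (z - y)))"
          by (simp add: exp_add[symmetric] algebra_simps)
        moreover have "1 - exp (- (t * (z - y))) \<le> t * (z - y)"
          using exp_ge_add_one_self[of "- (t * (z - y))"] by linarith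
        ultimately have d1: "exp (- t * y) - exp (- t * z) \<le> exp (- t * y) * (t * (z - y))"
          using mult_left_mono[of "1 - exp (- (t * (z - y)))" "t * (z - y)" "exp (- t * y)"]
          by (simp add: algebra_simps)
        have d0: "exp (- t * y) - exp (- t * z) \<ge> 0" using y t by simp
        \<comment> \<open>A difference of two nonnegative pieces, so its absolute value is at most
          their sum.\<close>
        have "y ^ j * exp (- t * y) - z ^ j * exp (- t * z)
            = z ^ j * (exp (- t * y) - exp (- t * z)) - (z ^ j - y ^ j) * exp (- t * y)"
          by (simp add: algebra_simps)
        moreover have "0 \<le> z ^ j * (exp (- t * y) - exp (- t * z))"
          "0 \<le> (z ^ j - y ^ j) * exp (- t * y)"
          using d0 z0 power_mono[OF y(2,1), of j] by simp_all
        moreover have "z ^ j * (exp (- t * y) - exp (- t * z)) \<le> t * (x ^ (2 * j) * x ^ 4) * e"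
        proof -
          have "z ^ j * (exp (- t * y) - exp (- t * z)) \<le> x ^ (2 * j) * (e * (t * x ^ 4))"
          proof (rule mult_mono[OF zj _ zero_le_even_power d0])
            have "exp (- t * y) * (t * (z - y)) \<le> e * (t * x ^ 4)"
              using ye e0 y t by (intro mult_mono mult_left_mono mult_nonneg_nonneg) auto
            then show "exp (- t * y) - exp (- t * z) \<le> e * (t * x ^ 4)" using d1 by linarith
          qed simp
          then show ?thesis by (simp only: mult_ac)
        qed
        moreover have "(z ^ j - y ^ j) * exp (- t * y) \<le> real j * x ^ (2 * j + 2) * e"
          using power_diff_bound[OF y(1,2) z0(2) y(3), of j] ye power_mono[OF y(2,1), of j]
          by (intro mult_mono mult_nonneg_nonneg zero_le_even_power) auto
        ultimately have "\<bar>y ^ j * exp (- t * y) - z ^ j * exp (- t * z)\<bar>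
            \<le> real j * x ^ (2 * j + 2) * e + t * (x ^ (2 * j) * x ^ 4) * e" by linarith
        then show ?thesis by (simp only: distrib_right)
      qed
      have "indicator {-pi..pi} x * ((1 - cos x) ^ j * exp (- t * (1 - cos x)) * w x)
         - W * (x\<^sup>2 * (x\<^sup>2 / 2) ^ j * exp (- t * (x\<^sup>2 / 2)))
         = y ^ j * exp (- t * y) * (w x - W * x\<^sup>2) + (W * x\<^sup>2) * (y ^ j * exp (- t * y) - z ^ j * exp (- t * z))"
        unfolding ind y_def[symmetric] z_def[symmetric] by (simp add: algebra_simps)
      also have "\<bar>\<dots>\<bar> \<le> E * x ^ (2 * (j + 2)) * e + (W * x\<^sup>2) * ((real j * x ^ (2 * j + 2) + t * (x ^ (2 * j) * x ^ 4)) * e)"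
      proof -
        have "\<bar>(W * x\<^sup>2) * (y ^ j * exp (- t * y) - z ^ j * exp (- t * z))\<bar>
            = (W * x\<^sup>2) * \<bar>y ^ j * exp (- t * y) - z ^ j * exp (- t * z)\<bar>"
          by (simp add: abs_mult)
        also have "\<dots> \<le> (W * x\<^sup>2) * ((real j * x ^ (2 * j + 2) + t * (x ^ (2 * j) * x ^ 4)) * e)"
          by (intro mult_left_mono second) simp
        finally show ?thesis using first by linarith
      qed
      also have "\<dots> = (E * x ^ (2 * (j + 2)) + W * (real j * (x\<^sup>2 * x ^ (2 * j + 2)) + t * (x\<^sup>2 * (x ^ (2 * j) * x ^ 4)))) * e"
        by (simp only: algebra_simps)
      also have "\<dots> = (E * x ^ (2 * (j + 2)) + W * (real j * x ^ (2 * (j + 2)) + t * x ^ (2 * (j + 3)))) * e"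
        by (simp only: p(1,2))
      also have "\<dots> \<le> (C * (x ^ (2 * (j + 2)) + t * x ^ (2 * (j + 3)))) * e"
      proof (rule mult_right_mono)
        have "0 \<le> W * x ^ (2 * (j + 2))" "0 \<le> E * (t * x ^ (2 * (j + 3)))" "0 \<le> W * real j * (t * x ^ (2 * (j + 3)))"
          using P0 E0 by (auto intro!: mult_nonneg_nonneg)
        then show "E * x ^ (2 * (j + 2)) + W * (real j * x ^ (2 * (j + 2)) + t * x ^ (2 * (j + 3)))
            \<le> C * (x ^ (2 * (j + 2)) + t * x ^ (2 * (j + 3)))"
          unfolding C_def distrib_left distrib_right by (simp only: mult_ac mult_1_right)
      qed (use e0 in simp)
      finally show ?thesis unfolding e_def by (simp only: mult.assoc)
    next
      case False
      then have ind: "indicator {-pi..pi} x = (0 :: real)" by (auto simp: indicator_def abs_le_iff)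
      have "1 \<le> \<bar>x\<bar>" using False pi_gt3 by linarith
      \<comment> \<open>Outside the interval one more factor \<open>x\<^sup>2 \<ge> 1\<close> raises
        the Gaussian integrand to the power in the bound.\<close>
      then have x1: "1 \<le> x\<^sup>2" using abs_le_square_iff[of 1 x] by simp
      have "W * (x\<^sup>2 * z ^ j * exp (- t * z)) \<le> W * (x\<^sup>2 * x ^ (2 * j) * e)"
        using zj ez z0 e0 by (intro mult_left_mono mult_mono mult_nonneg_nonneg zero_le_even_power) auto
      also have "\<dots> \<le> W * (x ^ (2 * (j + 2)) * e)"
      proof (intro mult_left_mono mult_right_mono W0)
        have "x\<^sup>2 * x ^ (2 * j) * 1 \<le> x\<^sup>2 * x ^ (2 * j) * x\<^sup>2"
          using x1 by (intro mult_left_mono mult_nonneg_nonneg zero_le_even_power) auto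
        also have "\<dots> = x ^ (2 * (j + 2))"
          unfolding power_add[symmetric] by (rule arg_cong[of _ _ "\<lambda>n. x ^ n"], simp)
        finally show "x\<^sup>2 * x ^ (2 * j) \<le> x ^ (2 * (j + 2))" by simp
      qed (use e0 in simp)
      also have "\<dots> \<le> C * ((x ^ (2 * (j + 2)) + t * x ^ (2 * (j + 3))) * e)"
      proof (intro mult_mono mult_right_mono C0)
        have "W * 1 \<le> W * (real j + 1)" by (intro mult_left_mono) auto
        then show "W \<le> C" using E0 unfolding C_def by linarith
      qed (use P0 e0 in auto)
      finally have "W * (x\<^sup>2 * z ^ j * exp (- t * z)) \<le> C * ((x ^ (2 * (j + 2)) + t * x ^ (2 * (j + 3))) * e)" .
      moreover have "0 \<le> W * (x\<^sup>2 * z ^ j * exp (- t * z))" using z0 by simp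
      ultimately show ?thesis unfolding ind e_def z_def by simp
    qed
  qed
qed

definition M :: "nat \<Rightarrow> real \<Rightarrow> real" where
  "M j t = integral {-pi..pi} (\<lambda>x. (1 - cos x) ^ j * exp (- t * (1 - cos x)) * w x)"

text \<open>The Gaussian moment of \<open>x\<^sup>2 * (x\<^sup>2 / 2) ^ j\<close> under
  \<open>exp (- x\<^sup>2 / 2)\<close> on the real line.\<close>

definition \<nu> :: "nat \<Rightarrow> real" where
  "\<nu> j = sqrt (2 * pi) * (fact (2 * (j + 1)) / (2 ^ (2 * j + 1) * fact (j + 1)))"

text \<open>The factor \<open>sqrt t\<close> removes the half-integer power of the Gaussian
  integral. Both error terms have the same order, since the factor \<open>t\<close> comes with one
  more power of \<open>x\<^sup>2\<close>.\<close>

lemma M_asymptotic: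
  obtains C where "\<And>t. t > 0 \<Longrightarrow> \<bar>sqrt t * M j t - W * \<nu> j / t ^ (j + 1)\<bar> \<le> C / t ^ (j + 2)"
proof -
  obtain C where C: "C \<ge> 0" "\<And>t x. t > 0 \<Longrightarrow>
    \<bar>indicator {-pi..pi} x * ((1 - cos x) ^ j * exp (- t * (1 - cos x)) * w x)
       - W * (x\<^sup>2 * (x\<^sup>2 / 2) ^ j * exp (- t * (x\<^sup>2 / 2)))\<bar>
    \<le> C * ((x ^ (2 * (j + 2)) + t * x ^ (2 * (j + 3))) * exp (- (t / 12) * x\<^sup>2))"
    using moment_integrand_bound[of j] by metis
  \<comment> \<open>Even moments for the majorant rate \<open>t / 12\<close>: the scale
    \<open>4 * (t / 12)\<close> equals \<open>t / 3\<close>.\<close>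
  define K where "K = (\<lambda>k. sqrt (12 * pi) * (fact (2 * k) / ((1 / 3) ^ k * fact k)) :: real)"
  show thesis
  proof (rule that[of "C * (K (j + 2) + K (j + 3))"])
    fix t :: real assume t: "t > 0"
    let ?g = "\<lambda>x. indicator {-pi..pi} x * ((1 - cos x) ^ j * exp (- t * (1 - cos x)) * w x)"
    let ?h = "\<lambda>x. W * (x\<^sup>2 * (x\<^sup>2 / 2) ^ j * exp (- t * (x\<^sup>2 / 2)))"
    let ?b = "\<lambda>x. C * ((x ^ (2 * (j + 2)) + t * x ^ (2 * (j + 3))) * exp (- (t / 12) * x\<^sup>2))"
    have si: "set_integrable lborel {-pi..pi} (\<lambda>x. (1 - cos x) ^ j * exp (- t * (1 - cos x)) * w x)"
      by (intro borel_integrable_atLeastAtMost' continuous_intros)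
    have ig: "integrable lborel ?g" using si by (simp add: set_integrable_def)
    have Ig: "(\<integral>x. ?g x \<partial>lborel) = M j t"
      using set_borel_integral_eq_integral(2)[OF si] by (simp add: M_def set_lebesgue_integral_def)
    have hh: "has_bochner_integral lborel ?h (W * \<nu> j / t ^ (j + 1) / sqrt t)"
    proof -
      have "has_bochner_integral lborel (\<lambda>x. W / 2 ^ j * (x ^ (2 * (j + 1)) * exp (- (t / 2) * x\<^sup>2)))
        (W / 2 ^ j * (sqrt (pi / (t / 2)) * (fact (2 * (j + 1)) / ((4 * (t / 2)) ^ (j + 1) * fact (j + 1)))))"
        by (intro has_bochner_integral_mult_right gaussian_even_moment) (use t in simp)
      moreover have "W / 2 ^ j * (x ^ (2 * (j + 1)) * exp (- (t / 2) * x\<^sup>2)) = ?h x" for x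
        by (simp add: power_divide power_mult power2_eq_square power_add power_mult_distrib mult_ac)
      moreover have "W / 2 ^ j * (sqrt (pi / (t / 2)) * (fact (2 * (j + 1)) / ((4 * (t / 2)) ^ (j + 1) * fact (j + 1))))
         = W * \<nu> j / t ^ (j + 1) / sqrt t"
      proof -
        have "sqrt (pi / (t / 2)) = sqrt (2 * pi) / sqrt t"
          unfolding real_sqrt_divide[symmetric] by (simp add: mult.commute)
        moreover have "(4 * (t / 2)) ^ (j + 1) = 2 ^ (j + 1) * t ^ (j + 1)"
          unfolding power_mult_distrib[symmetric] by simp
        moreover have "(2 :: real) ^ (2 * j + 1) = 2 ^ j * 2 ^ (j + 1)"
          unfolding power_add[symmetric] by (rule arg_cong[of _ _ "\<lambda>n. 2 ^ n"], simp)
        ultimately show ?thesis unfolding \<nu>_def by (simp only: times_divide_eq_left times_divide_eq_right divide_divide_eq_left mult_ac)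
      qed
      ultimately show ?thesis by (simp only:)
    qed
    have gm: "has_bochner_integral lborel (\<lambda>x. x ^ (2 * k) * exp (- (t / 12) * x\<^sup>2)) (K k / t ^ k / sqrt t)" for k
    proof -
      have "sqrt (pi / (t / 12)) = sqrt (12 * pi) / sqrt t"
        unfolding real_sqrt_divide[symmetric] by (simp add: mult.commute)
      moreover have "(4 * (t / 12)) ^ k = (1 / 3) ^ k * t ^ k"
        unfolding power_mult_distrib[symmetric] by simp
      ultimately have "sqrt (pi / (t / 12)) * (fact (2 * k) / ((4 * (t / 12)) ^ k * fact k)) = K k / t ^ k / sqrt t"
        unfolding K_def by (simp only: times_divide_eq_left times_divide_eq_right divide_divide_eq_left mult_ac)
      then show ?thesis using gaussian_even_moment[of "t / 12" k] t by (simp only: zero_less_divide_iff) simp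
    qed
    have hb: "has_bochner_integral lborel ?b (C * (K (j + 2) / t ^ (j + 2) / sqrt t + t * (K (j + 3) / t ^ (j + 3) / sqrt t)))"
    proof -
      have "has_bochner_integral lborel (\<lambda>x. C * (x ^ (2 * (j + 2)) * exp (- (t / 12) * x\<^sup>2) + t * (x ^ (2 * (j + 3)) * exp (- (t / 12) * x\<^sup>2))))
         (C * (K (j + 2) / t ^ (j + 2) / sqrt t + t * (K (j + 3) / t ^ (j + 3) / sqrt t)))"
        by (intro has_bochner_integral_mult_right has_bochner_integral_add gm)
      then show ?thesis by (simp only: distrib_right mult.assoc)
    qed
    have "\<bar>\<integral>x. ?g x - ?h x \<partial>lborel\<bar> \<le> (\<integral>x. ?b x \<partial>lborel)"
      by (rule integral_abs_bound_integral)
         (use ig integrable.intros[OF hh] integrable.intros[OF hb] C(2)[OF t] in \<open>auto intro: Bochner_Integration.integrable_diff\<close>)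
    moreover have "(\<integral>x. ?g x - ?h x \<partial>lborel) = M j t - W * \<nu> j / t ^ (j + 1) / sqrt t"
      using Bochner_Integration.integral_diff[OF ig integrable.intros[OF hh]] Ig has_bochner_integral_integral_eq[OF hh]
      by (simp only:)
    moreover note has_bochner_integral_integral_eq[OF hb]
    ultimately have "\<bar>M j t - W * \<nu> j / t ^ (j + 1) / sqrt t\<bar>
        \<le> C * (K (j + 2) / t ^ (j + 2) / sqrt t + t * (K (j + 3) / t ^ (j + 3) / sqrt t))"
      by (simp only:)
    then have "sqrt t * \<bar>M j t - W * \<nu> j / t ^ (j + 1) / sqrt t\<bar>
        \<le> sqrt t * (C * (K (j + 2) / t ^ (j + 2) / sqrt t + t * (K (j + 3) / t ^ (j + 3) / sqrt t)))"
      using t by (intro mult_left_mono) auto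
    also have "sqrt t * \<bar>M j t - W * \<nu> j / t ^ (j + 1) / sqrt t\<bar> = \<bar>sqrt t * (M j t - W * \<nu> j / t ^ (j + 1) / sqrt t)\<bar>"
      using t by (simp add: abs_mult)
    also have "sqrt t * (M j t - W * \<nu> j / t ^ (j + 1) / sqrt t) = sqrt t * M j t - W * \<nu> j / t ^ (j + 1)"
    proof -
      have gen: "s * (m - a / s) = s * m - a" if "s \<noteq> 0" for s m a :: real
        using that by (simp add: algebra_simps)
      show ?thesis by (rule gen) (use t in simp)
    qed
    also have "sqrt t * (C * (K (j + 2) / t ^ (j + 2) / sqrt t + t * (K (j + 3) / t ^ (j + 3) / sqrt t)))
        = C * (K (j + 2) + K (j + 3)) / t ^ (j + 2)"
    proof -
      have gen: "s * (C * (a / u / s + t * (b / (t * u) / s))) = C * (a + b) / u" if "s \<noteq> 0" "u \<noteq> 0" for s a b u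
        using that t by (simp add: field_simps)
      have t3: "t ^ (j + 3) = t * t ^ (j + 2)" by (simp add: numeral_3_eq_3)
      show ?thesis unfolding t3 by (rule gen) (use t in simp_all)
    qed
    finally show "\<bar>sqrt t * M j t - W * \<nu> j / t ^ (j + 1)\<bar> \<le> C * (K (j + 2) + K (j + 3)) / t ^ (j + 2)" .
  qed
qed

section \<open>The determinantal solution\<close>

text \<open>The spectral representation of \<open>exp (t (J - 1))\<close>, normalised by
  \<open>c_orthogonal\<close>. The shift by 1 is half of the damping term -2; the other half comes
  from the second factor in \<open>D\<close>.\<close>

definition a :: "nat \<Rightarrow> nat \<Rightarrow> real \<Rightarrow> real" where
  "a m k t = integral {-pi..pi} (\<lambda>x. exp (- t * (1 - cos x)) * (c m x * c k x * w x)) / (4 * pi * \<gamma> k)"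

lemma a_integrable: "(\<lambda>x. exp (- t * (1 - cos x)) * (c m x * c k x * w x)) integrable_on {-pi..pi}"
  by (intro integrable_continuous_real continuous_intros)

lemma a_0: "a 0 k t = 0"
  by (simp add: a_def c_0)

lemma a_init: "m \<ge> 1 \<Longrightarrow> k \<ge> 1 \<Longrightarrow> a m k 0 = (if m = k then 1 else 0)"
  using integral_unique[OF c_orthogonal[of m k]] gam_pos[of k] by (simp add: a_def)

text \<open>Differentiation under the integral produces \<open>cos x - 1\<close>, which
  \<open>c_rec\<close> turns into hopping in the index \<open>m\<close>.\<close>

lemma a_deriv:
  assumes "m \<ge> 1"
  shows "(a m k has_real_derivative (- a m k t + \<gamma> m / 2 * (a (m + 1) k t + a (m - 1) k t))) (at t)"
proof -
  let ?h = "\<lambda>m x. exp (- t * (1 - cos x)) * (c m x * c k x * w x)"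
  let ?f = "\<lambda>t x. exp (- t * (1 - cos x)) * (c m x * c k x * w x)"
  let ?f' = "\<lambda>t x. - (1 - cos x) * exp (- t * (1 - cos x)) * (c m x * c k x * w x)"
  have "((\<lambda>t. integral (cbox (-pi) pi) (?f t)) has_field_derivative integral (cbox (-pi) pi) (?f' t)) (at t within UNIV)"
  proof (rule leibniz_rule_field_derivative)
    show "((\<lambda>t. ?f t x) has_field_derivative ?f' t x) (at t within UNIV)" for t x
      by (auto intro!: derivative_eq_intros)
    show "?f t integrable_on cbox (-pi) pi" for t
      using a_integrable by simp
    have c': "continuous_on S (\<lambda>p. c j (snd p))" for S :: "(real \<times> real) set" and j
      unfolding c_def by (intro continuous_intros)
    have w': "continuous_on S (\<lambda>p. w (snd p))" for S :: "(real \<times> real) set"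
      by (intro continuous_intros)
    show "continuous_on (UNIV \<times> cbox (-pi) pi) (\<lambda>(t, x). ?f' t x)"
      unfolding case_prod_unfold by (intro continuous_intros c' w')
  qed auto
  then have d: "((\<lambda>t. integral {-pi..pi} (?f t)) has_field_derivative integral {-pi..pi} (?f' t)) (at t)"
    by simp
  obtain m' where m': "m = Suc m'" using assms by (cases m) auto
  have "?f' t x = - ?h m x + \<gamma> m / 2 * (?h (m + 1) x + ?h (m - 1) x)" for x
  proof -
    have "cos x * c m x = \<gamma> m / 2 * (c (m + 1) x + c (m - 1) x)"
      using c_rec[of x m'] by (simp add: m')
    then have "?f' t x = - ?h m x + exp (- t * (1 - cos x)) * ((\<gamma> m / 2 * (c (m + 1) x + c (m - 1) x)) * c k x * w x)"
    proof -
      have gen: "- (1 - b) * e * (u * v * z) = - (e * (u * v * z)) + e * ((b * u) * v * z)" for b e u v z :: real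
        by (simp add: algebra_simps)
      assume eq: "cos x * c m x = \<gamma> m / 2 * (c (m + 1) x + c (m - 1) x)"
      show ?thesis unfolding eq[symmetric] by (rule gen)
    qed
    then show ?thesis by (simp add: algebra_simps)
  qed
  then have "integral {-pi..pi} (?f' t) = integral {-pi..pi} (\<lambda>x. - ?h m x + \<gamma> m / 2 * (?h (m + 1) x + ?h (m - 1) x))"
    by (simp only:)
  also have "\<dots> = - integral {-pi..pi} (?h m) + \<gamma> m / 2 * (integral {-pi..pi} (?h (m + 1)) + integral {-pi..pi} (?h (m - 1)))"
    by (intro integral_unique has_integral_add has_integral_neg has_integral_mult_right integrable_integral a_integrable)
  finally have I: "integral {-pi..pi} (?f' t) = \<dots>" .
  have "((\<lambda>t. integral {-pi..pi} (?f t) / (4 * pi * \<gamma> k)) has_field_derivative integral {-pi..pi} (?f' t) / (4 * pi * \<gamma> k)) (at t)"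
    by (rule DERIV_cdivide[OF d])
  then show ?thesis unfolding a_def[abs_def] I
    by (rule DERIV_cong) (simp add: add_divide_distrib diff_divide_distrib algebra_simps)
qed

lemma a_bound:
  obtains B where "B \<ge> 0" "\<And>m t. t \<ge> 0 \<Longrightarrow> \<bar>a m k t\<bar> \<le> B * (2 / \<gamma> 1 + 1) ^ m"
proof -
  let ?K = "2 / \<gamma> 1 + 1"
  have "compact (w ` {-pi..pi})"
    by (intro compact_continuous_image \<Phi>_continuous compact_Icc)
  then obtain V where V: "V > 0" "\<And>x. x \<in> {-pi..pi} \<Longrightarrow> \<bar>w x\<bar> \<le> V"
    by (auto simp: bounded_pos dest!: compact_imp_bounded)
  have K: "?K > 0" using gam_nonneg[of 1] by (simp add: add_nonneg_pos)
  define B where "B = ?K ^ k * V * (2 * pi) / \<bar>4 * pi * \<gamma> k\<bar>"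
  show thesis
  proof (rule that[of B])
    show "B \<ge> 0" using K V by (simp add: B_def)
    fix m and t :: real assume t: "t \<ge> 0"
    have "norm (integral {-pi..pi} (\<lambda>x. exp (- t * (1 - cos x)) * (c m x * c k x * w x)))
        \<le> ?K ^ m * ?K ^ k * V * (pi - - pi)"
    proof (rule integral_bound)
      fix x assume x: "x \<in> {-pi..pi}"
      have "\<bar>exp (- t * (1 - cos x)) * (c m x * c k x * w x)\<bar> = exp (- t * (1 - cos x)) * (\<bar>c m x\<bar> * \<bar>c k x\<bar> * \<bar>w x\<bar>)"
        by (simp add: abs_mult)
      also have "\<dots> \<le> 1 * (?K ^ m * ?K ^ k * V)"
        using t K V(1) V(2)[OF x] c_bound[of m x] c_bound[of k x]
        by (intro mult_mono mult_nonneg_nonneg) auto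
      finally show "norm (exp (- t * (1 - cos x)) * (c m x * c k x * w x)) \<le> ?K ^ m * ?K ^ k * V" by simp
    qed (auto intro!: continuous_intros)
    then have "\<bar>a m k t\<bar> \<le> ?K ^ m * ?K ^ k * V * (pi - - pi) / \<bar>4 * pi * \<gamma> k\<bar>"
      unfolding a_def abs_divide by (intro divide_right_mono) auto
    then show "\<bar>a m k t\<bar> \<le> B * ?K ^ m" unfolding B_def by (simp add: mult_ac)
  qed
qed

definition D :: "nat \<Rightarrow> nat \<Rightarrow> nat \<Rightarrow> nat \<Rightarrow> real \<Rightarrow> real" where
  "D k l m n t = a m k t * a n l t - a m l t * a n k t"

lemma D_deriv:
  assumes "m \<ge> 1" "n \<ge> 1"
  shows "(D k l m n has_real_derivative (- 2 * D k l m n t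
     + \<gamma> m / 2 * (D k l (m + 1) n t + D k l (m - 1) n t) + \<gamma> n / 2 * (D k l m (n + 1) t + D k l m (n - 1) t))) (at t)"
  unfolding D_def[abs_def]
  by (rule DERIV_cong[OF DERIV_diff[OF DERIV_mult[OF a_deriv[OF assms(1)] a_deriv[OF assms(2)]]
        DERIV_mult[OF a_deriv[OF assms(1)] a_deriv[OF assms(2)]]]])
     (simp add: D_def algebra_simps)

lemma a_continuous: "continuous_on S (a m k)"
proof (cases "m = 0")
  case True
  then have "a m k = (\<lambda>_. 0)" by (simp add: fun_eq_iff a_0)
  then show ?thesis by simp
next
  case False
  then show ?thesis using a_deriv[of m k]
    by (intro continuous_at_imp_continuous_on) (auto intro: DERIV_isCont)
qed

text \<open>\<open>D\<close> is antisymmetric in \<open>m\<close> and \<open>n\<close>, but the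
  problem is symmetric. The wedge values are reflected, consistently since \<open>D\<close> vanishes
  on the diagonal.\<close>

definition Dsym :: "nat \<Rightarrow> nat \<Rightarrow> nat \<Rightarrow> nat \<Rightarrow> real \<Rightarrow> real" where
  "Dsym k l m n = (if n \<le> m then D k l m n else D k l n m)"

lemma Dsym_sym: "Dsym k l m n = Dsym k l n m"
  by (auto simp: Dsym_def)

text \<open>For \<open>n < m\<close> all four neighbours still satisfy \<open>n \<le> m\<close>, so
  the equation sees only \<open>D\<close>; the other half follows by symmetry.\<close>

lemma Dsym_deriv:
  assumes "m \<ge> 1" "n \<ge> 1" "m \<noteq> n"
  shows "(Dsym k l m n has_real_derivative (- 2 * Dsym k l m n t + hop (\<lambda>m n. Dsym k l m n t) m n)) (at t)"
proof -
  have main: "(Dsym k l m n has_real_derivative (- 2 * Dsym k l m n t + hop (\<lambda>m n. Dsym k l m n t) m n)) (at t)"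
    if "n \<ge> 1" "n < m" for m n
  proof -
    have "hop (\<lambda>m n. Dsym k l m n t) m n = \<gamma> m / 2 * (D k l (m + 1) n t + D k l (m - 1) n t)
        + \<gamma> n / 2 * (D k l m (n + 1) t + D k l m (n - 1) t)"
      using that by (auto simp: hop_def Dsym_def)
    moreover have "Dsym k l m n = D k l m n" using that by (simp add: Dsym_def)
    ultimately show ?thesis using D_deriv[of m n k l t] that by (simp only: add.assoc)
  qed
  show ?thesis
  proof (cases "n < m")
    case False
    then show ?thesis using main[of m n] assms
      unfolding Dsym_sym[of k l m n] hop_sym[of "\<lambda>m n. Dsym k l m n t" m n, OF fun_cong[OF Dsym_sym]] by simp
  qed (use main assms in auto)
qed

text \<open>Both sides solve the same homogeneous problem with the same data. The comparison takes
  place in the class of growth \<open>(2 / \<gamma> 1 + 1) ^ (m + n)\<close>.\<close>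

lemma flow_bump_eq_Dsym:
  assumes kl: "1 \<le> l" "l < k" and t: "t \<ge> 0"
  shows "flow (bump k l) m n t = Dsym k l m n t"
proof -
  let ?K = "2 / \<gamma> 1 + 1"
  obtain B where B: "B \<ge> 0" "\<And>m t. t \<ge> 0 \<Longrightarrow> \<bar>a m k t\<bar> \<le> B * ?K ^ m" using a_bound by blast
  obtain C where C: "C \<ge> 0" "\<And>m t. t \<ge> 0 \<Longrightarrow> \<bar>a m l t\<bar> \<le> C * ?K ^ m" using a_bound by blast
  have K: "?K \<ge> 1" using gam_nonneg[of 1] by simp
  have Db: "\<bar>D k l m n t\<bar> \<le> 2 * B * C * ?K ^ (m + n)" if "t \<ge> 0" for m n t
  proof -
    have "\<bar>a m k t\<bar> * \<bar>a n l t\<bar> \<le> (B * ?K ^ m) * (C * ?K ^ n)"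
      "\<bar>a m l t\<bar> * \<bar>a n k t\<bar> \<le> (C * ?K ^ m) * (B * ?K ^ n)"
      using B C that K by (intro mult_mono mult_nonneg_nonneg; simp)+
    moreover have "\<bar>D k l m n t\<bar> \<le> \<bar>a m k t\<bar> * \<bar>a n l t\<bar> + \<bar>a m l t\<bar> * \<bar>a n k t\<bar>"
      unfolding D_def abs_mult[symmetric] by (rule abs_triangle_ineq4)
    moreover have "(B * ?K ^ m) * (C * ?K ^ n) + (C * ?K ^ m) * (B * ?K ^ n) = 2 * B * C * ?K ^ (m + n)"
      by (simp only: power_add) simp
    ultimately show ?thesis by linarith
  qed
  have bb: "\<bar>bump k l m n\<bar> \<le> 1" for m n by (simp add: bump_def)
  have "flow (bump k l) m n t - Dsym k l m n t = 0"
  proof (rule hop_flow_unique[where u = "\<lambda>m n t. flow (bump k l) m n t - Dsym k l m n t" and B = "1 + 2 * B * C" and K = ?K])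
    show "\<bar>flow (bump k l) m n t - Dsym k l m n t\<bar> \<le> (1 + 2 * B * C) * ?K ^ (m + n)" if "t \<ge> 0" for m n t
    proof -
      have "\<bar>flow (bump k l) m n t\<bar> \<le> 1" by (rule flow_bound[OF bb that])
      also have "1 \<le> ?K ^ (m + n)" using K by (rule one_le_power)
      finally have "\<bar>flow (bump k l) m n t\<bar> \<le> ?K ^ (m + n)" .
      moreover have "\<bar>Dsym k l m n t\<bar> \<le> 2 * B * C * ?K ^ (m + n)"
        using Db[OF that, of m n] Db[OF that, of n m] by (simp add: Dsym_def add.commute)
      ultimately have "\<bar>flow (bump k l) m n t - Dsym k l m n t\<bar> \<le> ?K ^ (m + n) + 2 * B * C * ?K ^ (m + n)"
        by linarith
      then show ?thesis by (simp only: distrib_right mult_1)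
    qed
    have fc: "continuous_on {0..} (flow (bump k l) m n)" for m n
      using evolvesD(2) is_fund_flow[OF kl] unfolding is_fund_def by blast
    show "continuous_on {0..} (\<lambda>t. flow (bump k l) m n t - Dsym k l m n t)" for m n
      unfolding Dsym_def D_def[abs_def]
      by (auto intro!: continuous_intros fc a_continuous)
    show "((\<lambda>t. flow (bump k l) m n t - Dsym k l m n t) has_real_derivative
        - 2 * (flow (bump k l) m n t - Dsym k l m n t) + hop (\<lambda>m n. flow (bump k l) m n t - Dsym k l m n t) m n) (at t)"
      if "1 \<le> m" "1 \<le> n" "m \<noteq> n" for m n t
      unfolding hop_diff
      by (rule DERIV_cong[OF DERIV_diff[OF flow_deriv[OF bb] Dsym_deriv[OF that]]]) simp
    show "flow (bump k l) m n t - Dsym k l m n t = 0" if "m = 0 \<or> n = 0 \<or> m = n" for m n t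
    proof -
      have "flow (bump k l) m n t = 0"
        by (rule flow_boundary[OF that]) (use that kl in \<open>auto simp: bump_def\<close>)
      moreover have "Dsym k l m n t = 0"
        using that by (auto simp: Dsym_def D_def a_0)
      ultimately show ?thesis by simp
    qed
    show "flow (bump k l) m n 0 - Dsym k l m n 0 = 0" for m n
    proof -
      \<comment> \<open>Inside the wedge the second product of the determinant vanishes at t = 0,
        because \<open>m = l\<close> and \<open>n = k\<close> contradict
        \<open>l < k\<close>.\<close>
      have main: "bump k l m n = D k l m n 0" if "n \<le> m" for m n
      proof (cases "n = 0 \<or> m = n")
        case True
        then show ?thesis using kl by (auto simp: D_def a_0 bump_def)
      next
        case False
        then show ?thesis using that kl by (auto simp: D_def a_init bump_def)
      qed
      have "bump k l m n = bump k l n m" by (auto simp: bump_def)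
      then show ?thesis using main[of m n] main[of n m] by (auto simp: flow_0 Dsym_def)
    qed
  qed (use K t in auto)
  then show ?thesis by simp
qed

section \<open>Asymptotics of the determinant\<close>

lemma a_eq_moments:
  assumes "degree (p m) \<le> N" "degree (p k) \<le> N"
  shows "4 * pi * \<gamma> k * a m k t = (\<Sum>i\<le>N. \<Sum>j\<le>N. coeff (p m) i * coeff (p k) j * M (i + j) t)"
proof (cases "k = 0")
  case True
  then show ?thesis by simp
next
  case False
  have "integral {-pi..pi} (\<lambda>x. exp (- t * (1 - cos x)) * (c m x * c k x * w x))
      = integral {-pi..pi} (\<lambda>x. \<Sum>i\<le>N. \<Sum>j\<le>N. coeff (p m) i * coeff (p k) j * ((1 - cos x) ^ (i + j) * exp (- t * (1 - cos x)) * w x))"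
  proof (intro arg_cong[of _ _ "integral {-pi..pi}"] ext)
    fix x
    have "c m x * c k x = (\<Sum>i\<le>N. \<Sum>j\<le>N. (coeff (p m) i * (1 - cos x) ^ i) * (coeff (p k) j * (1 - cos x) ^ j))"
      unfolding c_eq_poly poly_eq_sum[OF assms(1)] poly_eq_sum[OF assms(2)] by (rule sum_product)
    then have "c m x * c k x * (w x * exp (- t * (1 - cos x)))
        = (\<Sum>i\<le>N. \<Sum>j\<le>N. coeff (p m) i * coeff (p k) j * ((1 - cos x) ^ (i + j) * exp (- t * (1 - cos x)) * w x))"
      by (simp only: sum_distrib_right) (intro sum.cong refl, simp only: power_add mult_ac)
    then show "exp (- t * (1 - cos x)) * (c m x * c k x * w x)
        = (\<Sum>i\<le>N. \<Sum>j\<le>N. coeff (p m) i * coeff (p k) j * ((1 - cos x) ^ (i + j) * exp (- t * (1 - cos x)) * w x))"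
      by (simp only: mult_ac)
  qed
  also have "\<dots> = (\<Sum>i\<le>N. \<Sum>j\<le>N. coeff (p m) i * coeff (p k) j * M (i + j) t)"
    unfolding M_def
    by (intro integral_unique has_integral_sum has_integral_mult_right integrable_integral
        integrable_continuous_real continuous_intros) auto
  finally show ?thesis using gam_pos[of k] False by (simp add: a_def)
qed

lemma D_eq_moments:
  assumes "degree (p m) \<le> N" "degree (p n) \<le> N" "degree (p k) \<le> N" "degree (p l) \<le> N"
  shows "16 * pi\<^sup>2 * \<gamma> k * \<gamma> l * D k l m n t =
    (\<Sum>i\<le>N. \<Sum>j\<le>N. \<Sum>x\<le>N. \<Sum>y\<le>N. coeff (p m) i * coeff (p n) j * coeff (p k) x * coeff (p l) y
       * (M (i + x) t * M (j + y) t - M (i + y) t * M (j + x) t))"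
proof -
  let ?A = "\<lambda>i. coeff (p m) i" let ?B = "\<lambda>i. coeff (p n) i"
  let ?C = "\<lambda>i. coeff (p k) i" let ?D = "\<lambda>i. coeff (p l) i"
  have "16 * pi\<^sup>2 * \<gamma> k * \<gamma> l * D k l m n t = (4 * pi * \<gamma> k * a m k t) * (4 * pi * \<gamma> l * a n l t)
      - (4 * pi * \<gamma> l * a m l t) * (4 * pi * \<gamma> k * a n k t)"
    by (simp add: D_def algebra_simps power2_eq_square)
  also have "(4 * pi * \<gamma> k * a m k t) * (4 * pi * \<gamma> l * a n l t)
     = (\<Sum>i\<le>N. \<Sum>j\<le>N. \<Sum>x\<le>N. \<Sum>y\<le>N. ?A i * ?B j * ?C x * ?D y * (M (i + x) t * M (j + y) t))"
    unfolding a_eq_moments[OF assms(1,3)] a_eq_moments[OF assms(2,4)] sum_product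
    by (intro sum.cong refl) (simp only: mult_ac)
  also have "(4 * pi * \<gamma> l * a m l t) * (4 * pi * \<gamma> k * a n k t)
     = (\<Sum>i\<le>N. \<Sum>j\<le>N. \<Sum>y\<le>N. \<Sum>x\<le>N. ?A i * ?B j * ?C x * ?D y * (M (i + y) t * M (j + x) t))"
    unfolding a_eq_moments[OF assms(1,4)] a_eq_moments[OF assms(2,3)] sum_product
    by (intro sum.cong refl) (simp only: mult_ac)
  also have "\<dots> = (\<Sum>i\<le>N. \<Sum>j\<le>N. \<Sum>x\<le>N. \<Sum>y\<le>N. ?A i * ?B j * ?C x * ?D y * (M (i + y) t * M (j + x) t))"
    by (intro sum.cong refl sum.swap)
  finally show ?thesis by (simp only: sum_subtractf[symmetric] right_diff_distrib)
qed

lemma M_expansion: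
  "(\<lambda>t. sqrt t * M j t - W * \<nu> j * (1 / t ^ (j + 1))) \<in> O[at_top](\<lambda>t. 1 / t ^ (j + 2))"
proof -
  obtain C where C: "\<And>t. t > 0 \<Longrightarrow> \<bar>sqrt t * M j t - W * \<nu> j / t ^ (j + 1)\<bar> \<le> C / t ^ (j + 2)"
    using M_asymptotic by blast
  show ?thesis
  proof (rule bigoI[of _ C])
    show "\<forall>\<^sub>F t in at_top. norm (sqrt t * M j t - W * \<nu> j * (1 / t ^ (j + 1))) \<le> C * norm (1 / t ^ (j + 2))"
      using eventually_gt_at_top[of 0]
    proof eventually_elim
      case (elim t)
      then show ?case using C[OF elim] by simp
    qed
  qed
qed

lemma M_bigo: "(\<lambda>t. sqrt t * M j t) \<in> O[at_top](\<lambda>t. 1 / t ^ (j + 1))"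
proof -
  have "(\<lambda>t. (sqrt t * M j t - W * \<nu> j * (1 / t ^ (j + 1))) + W * \<nu> j * (1 / t ^ (j + 1))) \<in> O[at_top](\<lambda>t. 1 / t ^ (j + 1))"
    by (intro sum_in_bigo(1) landau_o.big_trans[OF M_expansion inverse_power_bigo] cmult_inverse_power_bigo) simp_all
  then show ?thesis by simp
qed

text \<open>The factor \<open>t\<close> is split as \<open>sqrt t * sqrt t\<close>, and the two
  approximations are exchanged one at a time.\<close>

lemma M_product_expansion:
  "(\<lambda>t. t * (M i t * M j t) - W\<^sup>2 * \<nu> i * \<nu> j * (1 / t ^ (i + j + 2))) \<in> O[at_top](\<lambda>t. 1 / t ^ (i + j + 3))"
proof -
  let ?L = "\<lambda>j t. sqrt t * M j t" and ?m = "\<lambda>j t. W * \<nu> j * (1 / t ^ (j + 1))"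
  have 1: "(\<lambda>t. (?L i t - ?m i t) * ?L j t) \<in> O[at_top](\<lambda>t. 1 / t ^ (i + 2) * (1 / t ^ (j + 1)))"
    by (intro landau_o.big.mult M_expansion M_bigo)
  have m: "?m i \<in> O[at_top](\<lambda>t. 1 / t ^ (i + 1))" by (rule cmult_inverse_power_bigo) simp
  have 2: "(\<lambda>t. ?m i t * (?L j t - ?m j t)) \<in> O[at_top](\<lambda>t. 1 / t ^ (i + 1) * (1 / t ^ (j + 2)))"
    by (intro landau_o.big.mult M_expansion m)
  have e: "(\<lambda>t :: real. 1 / t ^ (i + 2) * (1 / t ^ (j + 1))) = (\<lambda>t. 1 / t ^ (i + j + 3))"
    "(\<lambda>t :: real. 1 / t ^ (i + 1) * (1 / t ^ (j + 2))) = (\<lambda>t. 1 / t ^ (i + j + 3))"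
    by (auto simp: fun_eq_iff power_add numeral_3_eq_3 power2_eq_square)
  have 3: "(\<lambda>t. (?L i t - ?m i t) * ?L j t + ?m i t * (?L j t - ?m j t)) \<in> O[at_top](\<lambda>t. 1 / t ^ (i + j + 3))"
    by (rule sum_in_bigo(1)[OF 1[unfolded e] 2[unfolded e]])
  have "\<forall>\<^sub>F t in at_top. (?L i t - ?m i t) * ?L j t + ?m i t * (?L j t - ?m j t)
      = t * (M i t * M j t) - W\<^sup>2 * \<nu> i * \<nu> j * (1 / t ^ (i + j + 2))"
    using eventually_gt_at_top[of 0]
  proof eventually_elim
    case (elim t)
    have s: "sqrt t * sqrt t = t" using elim by simp
    have "?L i t * ?L j t = t * (M i t * M j t)"
    proof -
      have gen: "(r * u) * (r * v) = (r * r) * (u * v)" for r u v :: real by (simp only: mult_ac)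
      show ?thesis unfolding gen s ..
    qed
    moreover have "?m i t * ?m j t = W\<^sup>2 * \<nu> i * \<nu> j * (1 / t ^ (i + j + 2))"
    proof -
      have gen: "(b * u * (1 / x)) * (b * v * (1 / y)) = b\<^sup>2 * u * v * (1 / (x * y))" for b u v x y :: real
        by (simp add: power2_eq_square)
      have pw: "t ^ (i + 1) * t ^ (j + 1) = t ^ (i + j + 2)"
        unfolding power_add[symmetric] by (rule arg_cong[of _ _ "\<lambda>n. t ^ n"]) simp
      show ?thesis unfolding gen pw ..
    qed
    ultimately show ?case by (simp only: left_diff_distrib right_diff_distrib)
  qed
  then show ?thesis using 3 by (subst (asm) landau_o.big.in_cong) auto
qed

text \<open>Antisymmetry kills the term when \<open>i = j\<close> or \<open>x = y\<close>. Otherwise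
  both sums are at least 1: either both equal 1, which is the leading case, or the total is at least
  3 and the term is already of the error order.\<close>

lemma determinant_term_expansion:
  "(\<lambda>t. t * (M (i + x) t * M (j + y) t - M (i + y) t * M (j + x) t)
     - (if i + j = 1 \<and> x + y = 1 then W\<^sup>2 * (\<nu> (i + x) * \<nu> (j + y) - \<nu> (i + y) * \<nu> (j + x)) else 0) * (1 / t ^ 4))
   \<in> O[at_top](\<lambda>t. 1 / t ^ 5)"
proof -
  consider "i = j \<or> x = y" | "i + j = 1" "x + y = 1" | "i + j + x + y \<ge> 3" "\<not> (i + j = 1 \<and> x + y = 1)"
    by linarith
  then show ?thesis
  proof cases
    case 1
    then have "\<not> (i + j = 1 \<and> x + y = 1)" by presburger
    then show ?thesis using 1 by (auto simp: mult.commute)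
  next
    case 2
    have e: "(i + x) + (j + y) = 2" "(i + y) + (j + x) = 2" using 2 by auto
    have "(\<lambda>t. (t * (M (i + x) t * M (j + y) t) - W\<^sup>2 * \<nu> (i + x) * \<nu> (j + y) * (1 / t ^ (2 + 2)))
       - (t * (M (i + y) t * M (j + x) t) - W\<^sup>2 * \<nu> (i + y) * \<nu> (j + x) * (1 / t ^ (2 + 2))))
       \<in> O[at_top](\<lambda>t. 1 / t ^ (2 + 3))"
      using M_product_expansion[of "i + x" "j + y"] M_product_expansion[of "i + y" "j + x"]
      unfolding e by (rule sum_in_bigo(2))
    then show ?thesis using 2 by (simp add: algebra_simps)
  next
    case 3
    have b: "(\<lambda>t. t * (M u t * M v t)) \<in> O[at_top](\<lambda>t. 1 / t ^ 5)" if "u + v \<ge> 3" for u v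
    proof -
      have "(\<lambda>t. (t * (M u t * M v t) - W\<^sup>2 * \<nu> u * \<nu> v * (1 / t ^ (u + v + 2))) + W\<^sup>2 * \<nu> u * \<nu> v * (1 / t ^ (u + v + 2)))
          \<in> O[at_top](\<lambda>t. 1 / t ^ 5)"
        by (intro sum_in_bigo(1) landau_o.big_trans[OF M_product_expansion inverse_power_bigo]
            cmult_inverse_power_bigo) (use that in simp_all)
      then show ?thesis by simp
    qed
    have "(\<lambda>t. t * (M (i + x) t * M (j + y) t) - t * (M (i + y) t * M (j + x) t)) \<in> O[at_top](\<lambda>t. 1 / t ^ 5)"
      by (intro sum_in_bigo(2) b) (use 3 in auto)
    moreover have "(i + j = 1 \<and> x + y = 1) = False" using 3(2) by blast
    ultimately show ?thesis by (simp only: if_False right_diff_distrib mult_zero_left diff_zero)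
  qed
qed

lemma \<nu>_determinant: "\<nu> 0 * \<nu> 2 - \<nu> 1 * \<nu> 1 = 3 * pi"
proof -
  have f: "fact 2 = (2 :: real)" "fact 3 = (6 :: real)" "fact 4 = (24 :: real)" "fact 6 = (720 :: real)"
    by (simp_all add: fact_numeral)
  have \<nu>: "\<nu> 0 = sqrt (2 * pi)" "\<nu> 1 = sqrt (2 * pi) * (3 / 2)" "\<nu> 2 = sqrt (2 * pi) * (15 / 4)"
    unfolding \<nu>_def using f by simp_all
  have "s * (s * (15 / 4)) - s * (3 / 2) * (s * (3 / 2)) = s * s * (3 / 2)" for s :: real
    by (simp add: algebra_simps)
  from this[of "sqrt (2 * pi)"] show ?thesis unfolding \<nu> by simp
qed

definition R :: "nat \<Rightarrow> nat \<Rightarrow> real" where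
  "R m n = coeff (p m) 0 * coeff (p n) 1 - coeff (p m) 1 * coeff (p n) 0"

text \<open>Only four index choices, with \<open>{i, j} = {x, y} = {0, 1}\<close>, reach order
  \<open>1 / t ^ 4\<close> after multiplication by \<open>t\<close>; their signs factor into
  \<open>R k l * R m n\<close>.\<close>

lemma D_asymptotic:
  assumes "k \<ge> 1" "l \<ge> 1"
  shows "(\<lambda>t. D k l m n t - 3 * \<tau> ^ 8 / (pi * \<gamma> k * \<gamma> l) * R k l * R m n * (1 / t ^ 5)) \<in> O[at_top](\<lambda>t. 1 / t ^ 6)"
proof -
  \<comment> \<open>Including 1 makes both coefficients that occur in \<open>R\<close> part of the
    sums.\<close>
  define N where "N = Max {1, degree (p m), degree (p n), degree (p k), degree (p l)}"
  have N: "degree (p m) \<le> N" "degree (p n) \<le> N" "degree (p k) \<le> N" "degree (p l) \<le> N" "N \<ge> 1"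
    unfolding N_def by (auto intro!: Max_ge)
  let ?c = "\<lambda>i j x y. coeff (p m) i * coeff (p n) j * coeff (p k) x * coeff (p l) y"
  let ?d = "\<lambda>i j x y t. M (i + x) t * M (j + y) t - M (i + y) t * M (j + x) t"
  let ?l = "\<lambda>i j x y. if i + j = 1 \<and> x + y = 1 then W\<^sup>2 * (\<nu> (i + x) * \<nu> (j + y) - \<nu> (i + y) * \<nu> (j + x)) else 0"
  let ?h = "16 * pi\<^sup>2 * \<gamma> k * \<gamma> l"
  have h: "?h > 0" using gam_pos[of k] gam_pos[of l] assms by simp
  have "(\<lambda>t. \<Sum>i\<le>N. \<Sum>j\<le>N. \<Sum>x\<le>N. \<Sum>y\<le>N. ?c i j x y * (t * ?d i j x y t - ?l i j x y * (1 / t ^ 4))) \<in> O[at_top](\<lambda>t. 1 / t ^ 5)"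
    by (intro big_sum_in_bigo cmult_in_bigo_iff[THEN iffD2] disjI2 determinant_term_expansion)
  moreover have "(\<Sum>i\<le>N. \<Sum>j\<le>N. \<Sum>x\<le>N. \<Sum>y\<le>N. ?c i j x y * (t * ?d i j x y t - ?l i j x y * (1 / t ^ 4)))
     = t * (?h * D k l m n t) - 48 * pi * \<tau> ^ 8 * R k l * R m n * (1 / t ^ 4)" for t
  proof -
    have "(\<Sum>i\<le>N. \<Sum>j\<le>N. \<Sum>x\<le>N. \<Sum>y\<le>N. ?c i j x y * (t * ?d i j x y t - ?l i j x y * (1 / t ^ 4)))
       = t * (\<Sum>i\<le>N. \<Sum>j\<le>N. \<Sum>x\<le>N. \<Sum>y\<le>N. ?c i j x y * ?d i j x y t)
         - (\<Sum>i\<le>N. \<Sum>j\<le>N. \<Sum>x\<le>N. \<Sum>y\<le>N. ?c i j x y * ?l i j x y) * (1 / t ^ 4)"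
      unfolding sum_distrib_left sum_distrib_right sum_subtractf[symmetric]
      by (intro sum.cong refl) (simp only: right_diff_distrib mult_ac)
    also have "(\<Sum>i\<le>N. \<Sum>j\<le>N. \<Sum>x\<le>N. \<Sum>y\<le>N. ?c i j x y * ?d i j x y t) = ?h * D k l m n t"
      using D_eq_moments[OF N(1-4), of t] by simp
    \<comment> \<open>The constant is \<open>W\<^sup>2 * (3 * pi)\<close> with
      \<open>W\<^sup>2 = 16 * \<tau> ^ 8\<close>.\<close>
    also have "(\<Sum>i\<le>N. \<Sum>j\<le>N. \<Sum>x\<le>N. \<Sum>y\<le>N. ?c i j x y * ?l i j x y) = 48 * pi * \<tau> ^ 8 * R k l * R m n"
    proof -
      have y: "(\<Sum>y\<le>N. ?c i j x y * ?l i j x y) = ?c i j x 0 * ?l i j x 0 + ?c i j x 1 * ?l i j x 1" for i j x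
        by (rule sum_first_two[OF N(5)]) simp
      have x: "(\<Sum>x\<le>N. \<Sum>y\<le>N. ?c i j x y * ?l i j x y) = ?c i j 1 0 * ?l i j 1 0 + ?c i j 0 1 * ?l i j 0 1" for i j
        unfolding y by (subst sum_first_two[OF N(5)]) simp_all
      have j: "(\<Sum>j\<le>N. \<Sum>x\<le>N. \<Sum>y\<le>N. ?c i j x y * ?l i j x y)
          = (?c i 0 1 0 * ?l i 0 1 0 + ?c i 0 0 1 * ?l i 0 0 1) + (?c i 1 1 0 * ?l i 1 1 0 + ?c i 1 0 1 * ?l i 1 0 1)" for i
        unfolding x by (rule sum_first_two[OF N(5)]) simp
      have i: "(\<Sum>i\<le>N. \<Sum>j\<le>N. \<Sum>x\<le>N. \<Sum>y\<le>N. ?c i j x y * ?l i j x y)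
          = (?c 0 1 1 0 * ?l 0 1 1 0 + ?c 0 1 0 1 * ?l 0 1 0 1) + (?c 1 0 1 0 * ?l 1 0 1 0 + ?c 1 0 0 1 * ?l 1 0 0 1)"
        unfolding j by (subst sum_first_two[OF N(5)]) simp_all
      have "\<nu> 0 * \<nu> 2 = \<nu> 1 * \<nu> 1 + 3 * pi" using \<nu>_determinant by simp
      then have l: "?l 0 1 1 0 = - (W\<^sup>2 * (3 * pi))" "?l 0 1 0 1 = W\<^sup>2 * (3 * pi)"
          "?l 1 0 1 0 = W\<^sup>2 * (3 * pi)" "?l 1 0 0 1 = - (W\<^sup>2 * (3 * pi))"
        by (simp_all add: mult.commute numeral_2_eq_2)
      show ?thesis unfolding i l R_def by (simp add: algebra_simps)
    qed
    finally show ?thesis .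
  qed
  ultimately have "(\<lambda>t. t * (?h * D k l m n t) - 48 * pi * \<tau> ^ 8 * R k l * R m n * (1 / t ^ 4)) \<in> O[at_top](\<lambda>t. 1 / t ^ 5)"
    by (simp only:)
  then have "(\<lambda>t. 1 / t ^ 1 * (t * (?h * D k l m n t) - 48 * pi * \<tau> ^ 8 * R k l * R m n * (1 / t ^ 4)))
      \<in> O[at_top](\<lambda>t. 1 / t ^ 1 * (1 / t ^ 5))"
    by (intro landau_o.big.mult inverse_power_bigo) auto
  then have "(\<lambda>t. 1 / ?h * (1 / t ^ 1 * (t * (?h * D k l m n t) - 48 * pi * \<tau> ^ 8 * R k l * R m n * (1 / t ^ 4))))
      \<in> O[at_top](\<lambda>t. 1 / t ^ 1 * (1 / t ^ 5))"
    by (intro cmult_in_bigo_iff[THEN iffD2] disjI2)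
  moreover have "(\<lambda>t :: real. 1 / t ^ 1 * (1 / t ^ 5)) = (\<lambda>t. 1 / t ^ 6)"
    by (simp add: fun_eq_iff eval_nat_numeral)
  moreover have "\<forall>\<^sub>F t in at_top. 1 / ?h * (1 / t ^ 1 * (t * (?h * D k l m n t) - 48 * pi * \<tau> ^ 8 * R k l * R m n * (1 / t ^ 4)))
      = D k l m n t - 3 * \<tau> ^ 8 / (pi * \<gamma> k * \<gamma> l) * R k l * R m n * (1 / t ^ 5)"
    using eventually_gt_at_top[of 0]
  proof eventually_elim
    case (elim t)
    have gen: "1 / (16 * pi\<^sup>2 * u * v) * (1 / t ^ 1 * (t * (16 * pi\<^sup>2 * u * v * d) - 48 * pi * z * r * s * (1 / t ^ 4)))
        = d - 3 * z / (pi * u * v) * r * s * (1 / t ^ 5)" if "u > 0" "v > 0" for u v d z r s :: real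
      using that elim by (simp add: field_simps eval_nat_numeral)
    show ?case by (rule gen) (use assms gam_pos in auto)
  qed
  ultimately show ?thesis by (simp only: landau_o.big.in_cong)
qed

section \<open>Return to the normalised polynomials\<close>

lemma Pn_second_derivative: "deriv (deriv (Pn \<kappa> n)) 0 = sqrt (\<gamma> 1 / \<gamma> n) * coeff (p n) 1"
proof -
  let ?s = "sqrt (\<gamma> 1 / \<gamma> n)" and ?q = "pderiv (p n)"
  have P: "Pn \<kappa> n = (\<lambda>\<theta>. ?s * poly (p n) (1 - cos \<theta>))"
    by (simp add: fun_eq_iff Pn_eq c_eq_poly)
  have d: "((\<lambda>\<theta>. poly r (1 - cos \<theta>)) has_real_derivative poly (pderiv r) (1 - cos \<theta>) * sin \<theta>) (at \<theta>)" for r :: "real poly" and \<theta>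
    by (rule DERIV_chain2[of "poly r"]) (auto intro!: poly_DERIV derivative_eq_intros)
  have "deriv (Pn \<kappa> n) = (\<lambda>\<theta>. ?s * (poly ?q (1 - cos \<theta>) * sin \<theta>))"
    unfolding P by (rule ext, rule DERIV_imp_deriv, rule DERIV_cmult, rule d)
  moreover have "((\<lambda>\<theta>. ?s * (poly ?q (1 - cos \<theta>) * sin \<theta>)) has_real_derivative
      ?s * (poly (pderiv ?q) (1 - cos 0) * sin 0 * sin 0 + cos 0 * poly ?q (1 - cos 0))) (at 0)"
    by (rule DERIV_cmult, rule DERIV_mult[OF d DERIV_sin])
  ultimately have "deriv (deriv (Pn \<kappa> n)) 0 = ?s * (poly (pderiv ?q) (1 - cos 0) * sin 0 * sin 0 + cos 0 * poly ?q (1 - cos 0))"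
    by (simp only: DERIV_imp_deriv)
  \<comment> \<open>At 0 the term with the second derivative of the polynomial disappears with
    \<open>sin 0\<close>.\<close>
  then show ?thesis by (simp add: poly_0_coeff_0 coeff_pderiv)
qed

lemma Rmn_eq: "Rmn \<kappa> m n = sqrt (\<gamma> 1 / \<gamma> m) * sqrt (\<gamma> 1 / \<gamma> n) * R m n"
  by (simp add: Rmn_def Pn_second_derivative Pn_eq c_eq_poly poly_0_coeff_0 R_def algebra_simps)

text \<open>The four roots inside the two factors \<open>Rmn\<close> combine with the explicit root
  to \<open>(\<gamma> 1)\<^sup>2 / (\<gamma> k * \<gamma> l)\<close>, which accounts for the
  prefactor \<open>1 / (\<gamma> 1)\<^sup>2\<close>.\<close>

lemma leading_coefficient_eq:
  assumes "m \<ge> 1" "n \<ge> 1" "k \<ge> 1" "l \<ge> 1"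
  shows "3 / (pi * (\<gamma> 1)\<^sup>2) * (qpoch_inf q q ^ 8 / qpoch_inf (- q) q ^ 8)
       * sqrt (\<gamma> m * \<gamma> n / (\<gamma> k * \<gamma> l)) * (Rmn \<kappa> k l * Rmn \<kappa> m n / t ^ 5)
     = 3 * \<tau> ^ 8 / (pi * \<gamma> k * \<gamma> l) * R k l * R m n * (1 / t ^ 5)"
proof -
  have g: "\<gamma> m > 0" "\<gamma> n > 0" "\<gamma> k > 0" "\<gamma> l > 0" "\<gamma> 1 > 0"
    using assms by (auto intro: gam_pos)
  have "sqrt (\<gamma> m * \<gamma> n / (\<gamma> k * \<gamma> l)) * ((sqrt (\<gamma> 1 / \<gamma> k) * sqrt (\<gamma> 1 / \<gamma> l)) * (sqrt (\<gamma> 1 / \<gamma> m) * sqrt (\<gamma> 1 / \<gamma> n)))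
      = sqrt (\<gamma> m * \<gamma> n / (\<gamma> k * \<gamma> l) * ((\<gamma> 1 / \<gamma> k * (\<gamma> 1 / \<gamma> l)) * (\<gamma> 1 / \<gamma> m * (\<gamma> 1 / \<gamma> n))))"
    by (simp only: real_sqrt_mult)
  also have "\<gamma> m * \<gamma> n / (\<gamma> k * \<gamma> l) * ((\<gamma> 1 / \<gamma> k * (\<gamma> 1 / \<gamma> l)) * (\<gamma> 1 / \<gamma> m * (\<gamma> 1 / \<gamma> n)))
      = ((\<gamma> 1)\<^sup>2 / (\<gamma> k * \<gamma> l))\<^sup>2"
    using g by (simp add: field_simps power2_eq_square)
  also have "sqrt (((\<gamma> 1)\<^sup>2 / (\<gamma> k * \<gamma> l))\<^sup>2) = (\<gamma> 1)\<^sup>2 / (\<gamma> k * \<gamma> l)"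
    using g by (simp only: real_sqrt_abs) simp
  finally have s: "sqrt (\<gamma> m * \<gamma> n / (\<gamma> k * \<gamma> l)) * ((sqrt (\<gamma> 1 / \<gamma> k) * sqrt (\<gamma> 1 / \<gamma> l)) * (sqrt (\<gamma> 1 / \<gamma> m) * sqrt (\<gamma> 1 / \<gamma> n)))
      = (\<gamma> 1)\<^sup>2 / (\<gamma> k * \<gamma> l)" .
  have "3 / (pi * (\<gamma> 1)\<^sup>2) * (qpoch_inf q q ^ 8 / qpoch_inf (- q) q ^ 8)
       * sqrt (\<gamma> m * \<gamma> n / (\<gamma> k * \<gamma> l)) * (Rmn \<kappa> k l * Rmn \<kappa> m n / t ^ 5)
     = 3 / (pi * (\<gamma> 1)\<^sup>2) * \<tau> ^ 8 * (sqrt (\<gamma> m * \<gamma> n / (\<gamma> k * \<gamma> l)) * ((sqrt (\<gamma> 1 / \<gamma> k) * sqrt (\<gamma> 1 / \<gamma> l)) * (sqrt (\<gamma> 1 / \<gamma> m) * sqrt (\<gamma> 1 / \<gamma> n))))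
       * R k l * R m n * (1 / t ^ 5)"
  proof -
    have gen: "x * y * z * (u * r * (v * s) / d) = x * y * (z * (u * v)) * r * s * (1 / d)" for x y z u v r s d :: real
      by simp
    show ?thesis unfolding Rmn_eq \<tau>_def power_divide by (rule gen)
  qed
  also have "\<dots> = 3 * \<tau> ^ 8 / (pi * \<gamma> k * \<gamma> l) * R k l * R m n * (1 / t ^ 5)"
    unfolding s using g by simp
  finally show ?thesis .
qed

end

theorem theorem3p2:
  fixes \<kappa> :: real and r0 :: "nat \<Rightarrow> nat \<Rightarrow> real"
  assumes kpos: "\<kappa> > 0"
    and r0_range: "\<And>m n. m \<ge> 1 \<Longrightarrow> n \<ge> 1 \<Longrightarrow> \<bar>r0 m n\<bar> \<le> 1"
    and r0_sym: "\<And>m n. m \<ge> 1 \<Longrightarrow> n \<ge> 1 \<Longrightarrow> r0 m n = r0 n m"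
    and r0_diag: "\<And>m. m \<ge> 1 \<Longrightarrow> r0 m m = 1"
  shows
    "(\<forall>k l. 1 \<le> l \<and> l < k \<longrightarrow>
        (\<exists>g. is_fund \<kappa> k l g) \<and>
        (\<forall>g g'. is_fund \<kappa> k l g \<and> is_fund \<kappa> k l g' \<longrightarrow>
            (\<forall>m n t. t \<ge> 0 \<longrightarrow> g m n t = g' m n t))) \<and>
     (\<exists>r. is_solution \<kappa> r0 r) \<and>
     (\<forall>r r'. is_solution \<kappa> r0 r \<and> is_solution \<kappa> r0 r' \<longrightarrow>
            (\<forall>m n t. t \<ge> 0 \<longrightarrow> r m n t = r' m n t)) \<and>
     (\<forall>G :: nat \<Rightarrow> nat \<Rightarrow> nat \<Rightarrow> nat \<Rightarrow> real \<Rightarrow> real.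
        (\<forall>k l. 1 \<le> l \<and> l < k \<longrightarrow> is_fund \<kappa> k l (G k l)) \<longrightarrow>
        (\<forall>r. is_solution \<kappa> r0 r \<longrightarrow>
           (\<forall>m n t. m \<ge> 1 \<and> n \<ge> 1 \<and> t \<ge> 0 \<longrightarrow>
              ((\<lambda>(k, l). G k l m n t * (r0 k l - rho \<kappa> k l)) has_sum
                 (r m n t - rho \<kappa> m n)) {(k, l). 1 \<le> l \<and> l < k})) \<and>
        (\<forall>k l m n. 1 \<le> l \<and> l < k \<and> 1 \<le> n \<and> n \<le> m \<longrightarrow>
           (\<lambda>t. G k l m n t
              - 3 / (pi * (gam \<kappa> 1)\<^sup>2)
                * (qpoch_inf (qq \<kappa>) (qq \<kappa>) ^ 8 / qpoch_inf (- qq \<kappa>) (qq \<kappa>) ^ 8)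
                * sqrt (gam \<kappa> m * gam \<kappa> n / (gam \<kappa> k * gam \<kappa> l))
                * (Rmn \<kappa> k l * Rmn \<kappa> m n / t ^ 5))
           \<in> O[at_top](\<lambda>t. 1 / t ^ 6)))"
proof -
  interpret ising_chain \<kappa> by unfold_locales (rule kpos)
  have solution: "is_solution \<kappa> r0 (\<lambda>m n t. rho \<kappa> m n + flow (deviation r0) m n t)"
    by (rule is_solution_flow) (use r0_range r0_sym r0_diag in blast)+
  have fund: "g m n t = flow (bump k l) m n t"
    if "is_fund \<kappa> k l g" "1 \<le> l" "l < k" "t \<ge> 0" for g k l m n t
    by (rule is_fund_unique[OF that(1) is_fund_flow[OF that(2,3)] that(4)])
  have superposition: "((\<lambda>(k, l). G k l m n t * (r0 k l - rho \<kappa> k l)) has_sum (r m n t - rho \<kappa> m n)) {(k, l). 1 \<le> l \<and> l < k}"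
    if G: "\<And>k l. 1 \<le> l \<Longrightarrow> l < k \<Longrightarrow> is_fund \<kappa> k l (G k l)" and r: "is_solution \<kappa> r0 r" and t: "t \<ge> 0"
    for G r m n t
  proof -
    have "r m n t = rho \<kappa> m n + flow (deviation r0) m n t"
      by (rule is_solution_unique[OF r solution t])
    moreover have "((\<lambda>(k, l). G k l m n t * (r0 k l - rho \<kappa> k l)) has_sum flow (deviation r0) m n t) {(k, l). 1 \<le> l \<and> l < k}
      \<longleftrightarrow> ((\<lambda>(k, l). (r0 k l - rho \<kappa> k l) * flow (bump k l) m n t) has_sum flow (deviation r0) m n t) {(k, l). 1 \<le> l \<and> l < k}"
    proof (rule has_sum_cong)
      fix x :: "nat \<times> nat" assume x: "x \<in> {(k, l). 1 \<le> l \<and> l < k}"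
      obtain k l where kl: "x = (k, l)" by (cases x)
      have "G k l m n t = flow (bump k l) m n t"
        by (rule fund[OF G _ _ t]) (use x kl in auto)
      then show "(case x of (k, l) \<Rightarrow> G k l m n t * (r0 k l - rho \<kappa> k l))
          = (case x of (k, l) \<Rightarrow> (r0 k l - rho \<kappa> k l) * flow (bump k l) m n t)"
        by (simp add: kl)
    qed
    moreover have "((\<lambda>(k, l). (r0 k l - rho \<kappa> k l) * flow (bump k l) m n t) has_sum flow (deviation r0) m n t) {(k, l). 1 \<le> l \<and> l < k}"
      by (rule flow_superposition) (use r0_range r0_sym r0_diag t in blast)+
    ultimately show ?thesis by simp
  qed
  have asymptotic: "(\<lambda>t. G k l m n t
              - 3 / (pi * (gam \<kappa> 1)\<^sup>2)
                * (qpoch_inf (qq \<kappa>) (qq \<kappa>) ^ 8 / qpoch_inf (- qq \<kappa>) (qq \<kappa>) ^ 8)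
                * sqrt (gam \<kappa> m * gam \<kappa> n / (gam \<kappa> k * gam \<kappa> l))
                * (Rmn \<kappa> k l * Rmn \<kappa> m n / t ^ 5)) \<in> O[at_top](\<lambda>t. 1 / t ^ 6)"
    if G: "is_fund \<kappa> k l (G k l)" and kl: "1 \<le> l" "l < k" and mn: "1 \<le> n" "n \<le> m" for G k l m n
  proof -
    have ind: "m \<ge> 1" "n \<ge> 1" "k \<ge> 1" "l \<ge> 1" using kl mn by auto
    \<comment> \<open>Any fundamental solution equals \<open>flow (bump k l)\<close>, which for
      \<open>n \<le> m\<close> is the determinant itself.\<close>
    have "\<forall>\<^sub>F t in at_top. D k l m n t - 3 * \<tau> ^ 8 / (pi * \<gamma> k * \<gamma> l) * R k l * R m n * (1 / t ^ 5)
        = G k l m n t - 3 * \<tau> ^ 8 / (pi * \<gamma> k * \<gamma> l) * R k l * R m n * (1 / t ^ 5)"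
      using eventually_ge_at_top[of 0]
    proof eventually_elim
      case (elim t)
      then show ?case
        using fund[OF G kl elim] flow_bump_eq_Dsym[OF kl elim, of m n] mn by (simp add: Dsym_def)
    qed
    from landau_o.big.in_cong[OF this] show ?thesis
      unfolding leading_coefficient_eq[OF ind] using D_asymptotic[OF ind(3,4), of m n] by simp
  qed
  show ?thesis
  proof (intro conjI allI impI)
    show "\<exists>g. is_fund \<kappa> k l g" if "1 \<le> l \<and> l < k" for k l
      using is_fund_flow that by blast
    show "g m n t = g' m n t" if "is_fund \<kappa> k l g \<and> is_fund \<kappa> k l g'" "t \<ge> 0" for k l g g' m n t
      using is_fund_unique that by blast
    show "\<exists>r. is_solution \<kappa> r0 r" using solution by blast
    show "r m n t = r' m n t" if "is_solution \<kappa> r0 r \<and> is_solution \<kappa> r0 r'" "t \<ge> 0" for r r' m n t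
      using is_solution_unique that by blast
  qed (use superposition asymptotic in blast)+
qed

end
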